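(* Let $M=I\times_{\phi^{p_1}}F_1\times_{\phi^{p_2}}F_2\times_{\phi^{p_3}}F_3$ be a generalized Kasner space-time with $\dim F_1=\dim F_2=\dim F_3=1$ and $p_i\neq p_j$ for all $i\neq j$ in $\{1,2,3\}$. Put $\zeta=p_1+p_2+p_3$ and $\eta=p_1^2+p_2^2+p_3^2$. Let $\lambda_1,\lambda_2$ be nonzero real constants, $P=\frac{\partial}{\partial t}$, and let $\overline\nabla$ be the quarter-symmetric connection on $M$ determined by $P,\lambda_1,\lambda_2$. Let $\alpha_i$ denote the Einstein constant of $(F_i,\nabla^{F_i})$. Then $(M,\overline\nabla)$ is Einstein with Einstein constant $\alpha$ if and only if one of the following conditions is satisfied (for some constant $c$): (1) $\lambda_2^2=3\lambda_1^2$, $\alpha=3\lambda_1^2-3\lambda_1\lambda_2=\lambda_2^2-3\lambda_1\lambda_2$, $\alpha_i=0$, $\zeta=\eta=0$; (2) $\lambda_2^2=3\lambda_1^2$, $\alpha=3\lambda_1^2-3\lambda_1\lambda_2=\lambda_2^2-3\lambda_1\lambda_2$, $\alpha_i=0$, $\eta\neq0$, $\phi=c$; (3) $\lambda_2\neq3\lambda_1$, $\alpha=0$, $\alpha_i=0$, $\frac{\eta}{\zeta^2}=\frac{3\lambda_1^2-\lambda_2^2}{(3\lambda_1-\lambda_2)^2}$ (in particular $\zeta\ne0$), $\phi=ce^{\frac{3\lambda_1-\lambda_2}{\zeta}t}$.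
   Context: A generalized Kasner space-time is a Lorentzian multiply warped product $M=I\times_{\phi^{p_1}}F_1\cdots\times_{\phi^{p_m}}F_m$, i.e. the product manifold $I\times F_1\times\cdots\times F_m$ with metric $g=-dt^2\oplus\phi^{2p_1}g_{F_1}\oplus\cdots\oplus\phi^{2p_m}g_{F_m}$, where $I=(t_1,t_2)$ is an open interval, $\phi:I\to(0,\infty)$ is smooth, $p_i\in\mathbb{R}$, and $(F_i,g_{F_i})$ are Riemannian manifolds. On a pseudo-Riemannian manifold $(M,g)$ with Levi-Civita connection $\nabla$, a vector field $P$, the 1-form $\pi(X)=g(X,P)$ and nonzero real constants $\lambda_1,\lambda_2$, the quarter-symmetric connection is $\overline\nabla_XY=\nabla_XY+\lambda_1\pi(Y)X-\lambda_2g(X,Y)P$. Its curvature is $\overline R(X,Y)=\overline\nabla_X\overline\nabla_Y-\overline\nabla_Y\overline\nabla_X-\overline\nabla_{[X,Y]}$ and its Ricci tensor is $\overline{Ric}(X,Y)=\sum_k\varepsilon_k\,g(\overline R(X,E_k)Y,E_k)$, where $(E_k)$ is a local orthonormal frame with $g(E_k,E_k)=\varepsilon_k=\pm1$ (note the sign convention; $\overline{Ric}$ need not be symmetric). $(M,\overline\nabla)$ is Einstein with Einstein constant $\alpha\in\mathbb{R}$ if $\overline{Ric}(X,Y)=\alpha g(X,Y)$ for all vector fields $X,Y$; $(F_i,\nabla^{F_i})$ is Einstein with constant $\alpha_i$ if the Ricci tensor of the Levi-Civita connection of $(F_i,g_{F_i})$ equals $\alpha_ig_{F_i}$ (automatically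 $\alpha_i=0$ when $\dim F_i=1$). *)

theory Defs
  imports "HOL-Analysis.Analysis"
begin

section \<open>Smooth maps between Euclidean spaces\<close>

text \<open>Meaningful on open sets \<open>S\<close> only, since full derivatives at points of \<open>S\<close> are used.\<close>

primrec Ck_on :: "nat \<Rightarrow> 'a::real_normed_vector set \<Rightarrow> ('a \<Rightarrow> 'b::real_normed_vector) \<Rightarrow> bool" where
  "Ck_on 0 S f \<longleftrightarrow> continuous_on S f"
| "Ck_on (Suc k) S f \<longleftrightarrow>
     (\<forall>x\<in>S. f differentiable (at x)) \<and>
     (\<forall>v. Ck_on k S (\<lambda>x. frechet_derivative f (at x) v))"

definition smooth_on :: "'a::real_normed_vector set \<Rightarrow> ('a \<Rightarrow> 'b::real_normed_vector) \<Rightarrow> bool" where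
  "smooth_on S f \<longleftrightarrow> (\<forall>k. Ck_on k S f)"


section \<open>Smooth manifolds\<close>

text \<open>
  A manifold of dimension \<open>DIM('e)\<close> is given by its set of points, a subset of a Hausdorff second
  countable space, and a smooth atlas that is indexed by the points: \<open>chart M p\<close>, with domain
  \<open>chart_dom M p\<close>, is a chart around \<open>p\<close>. Since a point has a distinguished chart,
  the tangent space at \<open>p\<close> can be identified with \<open>'e\<close>: a vector \<open>v\<close> of type \<open>'e\<close> stands for the
  tangent vector at \<open>p\<close> with coordinates \<open>v\<close> in the chart \<open>chart M p\<close>. Hence vector fields are
  functions of type \<open>'m \<Rightarrow> 'e\<close>, and tensors at \<open>p\<close> are multilinear maps on \<open>'e\<close>.
\<close>

record ('m, 'e) manifold =
  points :: "'m set"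
  chart_dom :: "'m \<Rightarrow> 'm set"
  chart :: "'m \<Rightarrow> 'm \<Rightarrow> 'e"

definition inv_chart :: "('m, 'e) manifold \<Rightarrow> 'm \<Rightarrow> 'e \<Rightarrow> 'm" where
  "inv_chart M p = inv_into (chart_dom M p) (chart M p)"

definition smooth_manifold ::
  "('m::{t2_space, second_countable_topology}, 'e::euclidean_space) manifold \<Rightarrow> bool" where
  "smooth_manifold M \<longleftrightarrow>
     points M \<noteq> {} \<and>
     (\<forall>p\<in>points M.
        p \<in> chart_dom M p \<and> chart_dom M p \<subseteq> points M \<and>
        openin (top_of_set (points M)) (chart_dom M p) \<and>
        open (chart M p ` chart_dom M p) \<and>
        homeomorphism (chart_dom M p) (chart M p ` chart_dom M p) (chart M p) (inv_chart M p)) \<and>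
     (\<forall>p\<in>points M. \<forall>q\<in>points M.
        smooth_on (chart M p ` (chart_dom M p \<inter> chart_dom M q)) (chart M q \<circ> inv_chart M p))"

abbreviation open_in_manifold ::
  "('m::topological_space, 'e) manifold \<Rightarrow> 'm set \<Rightarrow> bool" where
  "open_in_manifold M U \<equiv> openin (top_of_set (points M)) U"

definition smooth_fun_on ::
  "('m, 'e::euclidean_space) manifold \<Rightarrow> 'm set \<Rightarrow> ('m \<Rightarrow> real) \<Rightarrow> bool" where
  "smooth_fun_on M U f \<longleftrightarrow>
     (\<forall>p\<in>points M. smooth_on (chart M p ` (chart_dom M p \<inter> U)) (f \<circ> inv_chart M p))"

text \<open>The coordinates of a vector field in the chart around \<open>p\<close>: at a point \<open>q\<close> of the
  domain, \<open>X q\<close> consists of coordinates in the chart around \<open>q\<close>, so it is transformed by the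
  derivative of the change of charts.\<close>

definition vf_coords ::
  "('m, 'e::euclidean_space) manifold \<Rightarrow> 'm \<Rightarrow> ('m \<Rightarrow> 'e) \<Rightarrow> 'e \<Rightarrow> 'e" where
  "vf_coords M p X z =
     (let q = inv_chart M p z
      in frechet_derivative (chart M p \<circ> inv_chart M q) (at (chart M q q)) (X q))"

definition smooth_vf_on ::
  "('m, 'e::euclidean_space) manifold \<Rightarrow> 'm set \<Rightarrow> ('m \<Rightarrow> 'e) \<Rightarrow> bool" where
  "smooth_vf_on M U X \<longleftrightarrow>
     (\<forall>p\<in>points M. smooth_on (chart M p ` (chart_dom M p \<inter> U)) (vf_coords M p X))"

definition deriv_along ::
  "('m, 'e::euclidean_space) manifold \<Rightarrow> 'm \<Rightarrow> 'e \<Rightarrow> ('m \<Rightarrow> real) \<Rightarrow> real" where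
  "deriv_along M p v f = frechet_derivative (f \<circ> inv_chart M p) (at (chart M p p)) v"

text \<open>The coordinate formula \<open>[X,Y]\<^sup>i = X\<^sup>j \<partial>\<^sub>j Y\<^sup>i - Y\<^sup>j \<partial>\<^sub>j X\<^sup>i\<close>, at \<open>p\<close> in the chart around \<open>p\<close>.\<close>

definition lie_bracket ::
  "('m, 'e::euclidean_space) manifold \<Rightarrow> ('m \<Rightarrow> 'e) \<Rightarrow> ('m \<Rightarrow> 'e) \<Rightarrow> 'm \<Rightarrow> 'e" where
  "lie_bracket M X Y p =
     frechet_derivative (vf_coords M p Y) (at (chart M p p)) (X p) -
     frechet_derivative (vf_coords M p X) (at (chart M p p)) (Y p)"

definition prod_manifold ::
  "('m, 'e) manifold \<Rightarrow> ('n, 'f) manifold \<Rightarrow> ('m \<times> 'n, 'e \<times> 'f) manifold" where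
  "prod_manifold M N =
     \<lparr> points = points M \<times> points N,
       chart_dom = (\<lambda>(p, q). chart_dom M p \<times> chart_dom N q),
       chart = (\<lambda>(p, q). map_prod (chart M p) (chart N q)) \<rparr>"

definition interval_manifold :: "ereal \<Rightarrow> ereal \<Rightarrow> (real, real) manifold" where
  "interval_manifold a b =
     \<lparr> points = einterval a b, chart_dom = (\<lambda>_. einterval a b), chart = (\<lambda>_ t. t) \<rparr>"


section \<open>Metrics and connections\<close>

type_synonym ('m, 'e) metric = "'m \<Rightarrow> 'e \<Rightarrow> 'e \<Rightarrow> real"

definition pseudo_riemannian_metric ::
  "('m::topological_space, 'e::euclidean_space) manifold \<Rightarrow> ('m, 'e) metric \<Rightarrow> bool" where
  "pseudo_riemannian_metric M g \<longleftrightarrow>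
     (\<forall>p\<in>points M. bilinear (g p) \<and> (\<forall>v w. g p v w = g p w v) \<and>
        (\<forall>v. (\<forall>w. g p v w = 0) \<longrightarrow> v = 0)) \<and>
     (\<forall>U X Y. open_in_manifold M U \<and> smooth_vf_on M U X \<and> smooth_vf_on M U Y \<longrightarrow>
        smooth_fun_on M U (\<lambda>p. g p (X p) (Y p)))"

definition riemannian_metric ::
  "('m::topological_space, 'e::euclidean_space) manifold \<Rightarrow> ('m, 'e) metric \<Rightarrow> bool" where
  "riemannian_metric M g \<longleftrightarrow>
     pseudo_riemannian_metric M g \<and> (\<forall>p\<in>points M. \<forall>v. v \<noteq> 0 \<longrightarrow> g p v v > 0)"

text \<open>
  \<open>D p v Y\<close> is the covariant derivative at \<open>p\<close> of \<open>Y\<close> in the direction of the tangent vector \<open>v\<close>;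
  on vector fields, \<open>\<nabla>\<^sub>X Y\<close> is \<open>\<lambda>p. D p (X p) Y\<close>. It acts on vector fields
  that are defined and smooth on some open set (the values of \<open>Y\<close> elsewhere are irrelevant).
  Locality follows from the Leibniz rule, applied with the indicator function of \<open>U\<close>.
\<close>

type_synonym ('m, 'e) connection = "'m \<Rightarrow> 'e \<Rightarrow> ('m \<Rightarrow> 'e) \<Rightarrow> 'e"

definition affine_connection ::
  "('m::topological_space, 'e::euclidean_space) manifold \<Rightarrow> ('m, 'e) connection \<Rightarrow> bool" where
  "affine_connection M D \<longleftrightarrow>
     (\<forall>U Y. open_in_manifold M U \<and> smooth_vf_on M U Y \<longrightarrow>
        (\<forall>p\<in>U. linear (\<lambda>v. D p v Y)) \<and>
        (\<forall>X. smooth_vf_on M U X \<longrightarrow> smooth_vf_on M U (\<lambda>p. D p (X p) Y)) \<and>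
        (\<forall>Z. smooth_vf_on M U Z \<longrightarrow>
           (\<forall>p\<in>U. \<forall>v. D p v (\<lambda>q. Y q + Z q) = D p v Y + D p v Z)) \<and>
        (\<forall>f. smooth_fun_on M U f \<longrightarrow>
           (\<forall>p\<in>U. \<forall>v. D p v (\<lambda>q. f q *\<^sub>R Y q) = deriv_along M p v f *\<^sub>R Y p + f p *\<^sub>R D p v Y)))"

definition levi_civita_connection ::
  "('m::topological_space, 'e::euclidean_space) manifold \<Rightarrow> ('m, 'e) metric \<Rightarrow>
   ('m, 'e) connection \<Rightarrow> bool" where
  "levi_civita_connection M g D \<longleftrightarrow>
     affine_connection M D \<and>
     (\<forall>U X Y. open_in_manifold M U \<and> smooth_vf_on M U X \<and> smooth_vf_on M U Y \<longrightarrow>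
        (\<forall>p\<in>U. D p (X p) Y - D p (Y p) X = lie_bracket M X Y p)) \<and>
     (\<forall>U Y Z. open_in_manifold M U \<and> smooth_vf_on M U Y \<and> smooth_vf_on M U Z \<longrightarrow>
        (\<forall>p\<in>U. \<forall>v. deriv_along M p v (\<lambda>q. g q (Y q) (Z q)) =
           g p (D p v Y) (Z p) + g p (Y p) (D p v Z)))"

definition quarter_symmetric_connection ::
  "('m, 'e::real_vector) metric \<Rightarrow> ('m, 'e) connection \<Rightarrow> ('m \<Rightarrow> 'e) \<Rightarrow> real \<Rightarrow> real \<Rightarrow>
   ('m, 'e) connection" where
  "quarter_symmetric_connection g D P l1 l2 =
     (\<lambda>p v Y. D p v Y + (l1 * g p (Y p) (P p)) *\<^sub>R v - (l2 * g p v (Y p)) *\<^sub>R P p)"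

definition curvature ::
  "('m, 'e::euclidean_space) manifold \<Rightarrow> ('m, 'e) connection \<Rightarrow>
   ('m \<Rightarrow> 'e) \<Rightarrow> ('m \<Rightarrow> 'e) \<Rightarrow> ('m \<Rightarrow> 'e) \<Rightarrow> 'm \<Rightarrow> 'e" where
  "curvature M D X Y Z p =
     D p (X p) (\<lambda>q. D q (Y q) Z) - D p (Y p) (\<lambda>q. D q (X q) Z) - D p (lie_bracket M X Y p) Z"

definition orthonormal_frame ::
  "('m, 'e::euclidean_space) manifold \<Rightarrow> ('m, 'e) metric \<Rightarrow> 'm set \<Rightarrow>
   (nat \<Rightarrow> 'm \<Rightarrow> 'e) \<Rightarrow> bool" where
  "orthonormal_frame M g U E \<longleftrightarrow>
     (\<forall>k<DIM('e). smooth_vf_on M U (E k)) \<and>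
     (\<forall>p\<in>U. \<forall>j<DIM('e). \<forall>k<DIM('e).
        (j \<noteq> k \<longrightarrow> g p (E j p) (E k p) = 0) \<and> g p (E k p) (E k p) \<in> {1, -1})"

text \<open>\<open>Ric(X,Y) = \<Sum>\<^sub>k \<epsilon>\<^sub>k g(R(X,E\<^sub>k)Y, E\<^sub>k)\<close> with \<open>\<epsilon>\<^sub>k = g(E\<^sub>k,E\<^sub>k)\<close>, for an orthonormal frame \<open>E\<close>
  near \<open>p\<close>; the order of the arguments of \<open>R\<close> makes this the negative of the Ricci
  tensor in the most common convention.\<close>

definition ricci ::
  "('m, 'e::euclidean_space) manifold \<Rightarrow> ('m, 'e) metric \<Rightarrow> ('m, 'e) connection \<Rightarrow>
   (nat \<Rightarrow> 'm \<Rightarrow> 'e) \<Rightarrow> ('m \<Rightarrow> 'e) \<Rightarrow> ('m \<Rightarrow> 'e) \<Rightarrow> 'm \<Rightarrow> real" where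
  "ricci M g D E X Y p =
     (\<Sum>k<DIM('e). g p (E k p) (E k p) * g p (curvature M D X (E k) Y p) (E k p))"

definition einstein ::
  "('m::topological_space, 'e::euclidean_space) manifold \<Rightarrow> ('m, 'e) metric \<Rightarrow>
   ('m, 'e) connection \<Rightarrow> real \<Rightarrow> bool" where
  "einstein M g D a \<longleftrightarrow>
     (\<forall>U E X Y. open_in_manifold M U \<and> orthonormal_frame M g U E \<and>
        smooth_vf_on M U X \<and> smooth_vf_on M U Y \<longrightarrow>
        (\<forall>p\<in>U. ricci M g D E X Y p = a * g p (X p) (Y p)))"


section \<open>Generalized Kasner space-times with three fibres\<close>

definition kasner_manifold ::
  "ereal \<Rightarrow> ereal \<Rightarrow> ('a, 'e) manifold \<Rightarrow> ('b, 'f) manifold \<Rightarrow> ('c, 'h) manifold \<Rightarrow>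
   (real \<times> 'a \<times> 'b \<times> 'c, real \<times> 'e \<times> 'f \<times> 'h) manifold" where
  "kasner_manifold t1 t2 F1 F2 F3 =
     prod_manifold (interval_manifold t1 t2) (prod_manifold F1 (prod_manifold F2 F3))"

definition kasner_metric ::
  "(real \<Rightarrow> real) \<Rightarrow> real \<Rightarrow> real \<Rightarrow> real \<Rightarrow>
   ('a, 'e) metric \<Rightarrow> ('b, 'f) metric \<Rightarrow> ('c, 'h) metric \<Rightarrow>
   (real \<times> 'a \<times> 'b \<times> 'c, real \<times> 'e \<times> 'f \<times> 'h) metric" where
  "kasner_metric \<phi> p1 p2 p3 g1 g2 g3 =
     (\<lambda>(t, x1, x2, x3) (a, v1, v2, v3) (b, w1, w2, w3).
        - (a * b) + \<phi> t powr (2 * p1) * g1 x1 v1 w1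
                  + \<phi> t powr (2 * p2) * g2 x2 v2 w2
                  + \<phi> t powr (2 * p3) * g3 x3 v3 w3)"

definition kasner_dt ::
  "real \<times> 'a \<times> 'b \<times> 'c \<Rightarrow> real \<times> 'e::zero \<times> 'f::zero \<times> 'h::zero" where
  "kasner_dt = (\<lambda>_. (1, 0, 0, 0))"

end

theory Submission
  imports Defs
begin

text \<open>
  On the product of chart domains of the fibres there is an orthonormal frame \<open>e\<^sub>0 = \<partial>\<^sub>t\<close>,
  \<open>e\<^sub>i = \<phi>\<^bsup>-p\<^sub>i\<^esup> u\<^sub>i\<close>, where \<open>u\<^sub>i\<close> is a unit field on the fibre. With \<open>h = \<phi>'/\<phi>\<close> its only nonzero
  brackets are \<open>[e\<^sub>0, e\<^sub>i] = - p\<^sub>i h e\<^sub>i\<close>, so Koszul's formula yields the connection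
  \<open>\<nabla>\<^bsub>e\<^sub>i\<^esub>e\<^sub>0 = p\<^sub>i h e\<^sub>i\<close>, \<open>\<nabla>\<^bsub>e\<^sub>i\<^esub>e\<^sub>i = p\<^sub>i h e\<^sub>0\<close> (the other terms vanish). Since curvature is a tensor, the
  Einstein condition may be tested on this frame, where it becomes
  \<open>\<zeta> h' + \<eta> h\<^sup>2 - l2 \<zeta> h + 3 (l1 l2 - l1\<^sup>2) = - \<alpha>\<close> and \<open>p\<^sub>i h' + (p\<^sub>i h - l2) (\<zeta> h + l2 - 3 l1) = - \<alpha>\<close>.
  As two of the exponents differ, the latter equations force \<open>h' = - h (\<zeta> h + l2 - 3 l1)\<close> and
  \<open>\<alpha> = l2 (\<zeta> h + l2 - 3 l1)\<close>; together with the former equation this makes \<open>h\<close> constant. The case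
  \<open>h = 0\<close> gives condition (2) and \<open>h \<noteq> 0\<close> gives condition (3). Condition (1) never holds,
  because distinct exponents have \<open>\<eta> > 0\<close>.
\<close>

section \<open>Calculus of smooth maps\<close>

text \<open>One obstacle is the encoding: a tangent vector is stored in the chart attached to its
  own base point, so the stored coordinates of a field may jump from point to point. Nothing can be
  differentiated before it is moved to one fixed chart; \<open>vf_coords\<close> and the cocycle
  rule \<open>dtrans_compose\<close> do this. Another is that \<open>einstein\<close> ranges over
  all open sets, orthonormal frames and fields, while connection, bracket and curvature act on
  fields, not on vectors. Passing to one frame rests on two facts: curvature is linear over
  functions in each argument, which for the last argument needs [X,Y]f = X(Yf) - Y(Xf) and hence the
  symmetry of second derivatives; and a bilinear form has the same trace in every orthonormal frame.
  In the final equations the constancy of h has two sources. For \<zeta> \<noteq> 0 the formula for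
  \<alpha> is affine in h and determines it. For \<zeta> = 0 that formula says nothing about h, but
  then the equation from the time direction fixes \<eta> h^2.\<close>

lemma frechet_derivative_cong_open:
  assumes "open S" "x \<in> S" "\<And>y. y \<in> S \<Longrightarrow> f y = g y"
  shows "frechet_derivative f (at x) = frechet_derivative g (at x)"
proof -
  have "(f has_derivative F) (at x) \<longleftrightarrow> (g has_derivative F) (at x)" for F
    using has_derivative_transform_within_open[OF _ assms(1,2)] assms(3) by metis
  \<comment> \<open>\<open>frechet_derivative\<close> is a choice among all derivatives, so equal
    sets of derivatives give equal choices, whether or not the functions are differentiable.\<close>
  then show ?thesis by (simp add: frechet_derivative_def)
qed

lemma Ck_on_cong:
  fixes f g :: "'a::real_normed_vector \<Rightarrow> 'b::real_normed_vector"
  assumes "open S" "\<And>x. x \<in> S \<Longrightarrow> f x = g x" "Ck_on k S f"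
  shows "Ck_on k S g"
  using assms(2,3)
proof (induction k arbitrary: f g)
  case 0
  then show ?case by (simp cong: continuous_on_cong)
next
  case (Suc k)
  have "g differentiable (at x)" if "x \<in> S" for x
  proof -
    have "(f has_derivative frechet_derivative f (at x)) (at x)"
      using Suc.prems(2) that by (simp add: frechet_derivative_works)
    from has_derivative_transform_within_open[OF this assms(1) that Suc.prems(1)]
    show ?thesis by (auto simp: differentiable_def)
  qed
  moreover have "Ck_on k S (\<lambda>x. frechet_derivative g (at x) v)" for v
  proof (rule Suc.IH)
    show "frechet_derivative f (at x) v = frechet_derivative g (at x) v" if "x \<in> S" for x
      using frechet_derivative_cong_open[OF assms(1) that Suc.prems(1)] by simp
    show "Ck_on k S (\<lambda>x. frechet_derivative f (at x) v)"
      using Suc.prems(2) by simp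
  qed
  ultimately show ?case by simp
qed

text \<open>The derivative may be supplied by any formula \<open>f'\<close> valid on
  \<open>S\<close>. Most closure rules below use this: the derivative of a combination is a
  combination of the same kind, so the induction on \<open>k\<close> closes.\<close>

lemma Ck_onI:
  assumes "open S" "\<And>x. x \<in> S \<Longrightarrow> (f has_derivative f' x) (at x)"
    and "\<And>v. Ck_on k S (\<lambda>x. f' x v)"
  shows "Ck_on (Suc k) S f"
proof -
  have "Ck_on k S (\<lambda>x. frechet_derivative f (at x) v)" for v
    by (rule Ck_on_cong[OF assms(1) _ assms(3)]) (simp add: frechet_derivative_at[OF assms(2), symmetric])
  then show ?thesis
    using assms(2) by (auto simp: differentiable_def)
qed

lemma Ck_on_SucD: "Ck_on (Suc k) S f \<Longrightarrow> Ck_on k S f"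
proof (induction k arbitrary: f)
  case 0
  then show ?case
    by (auto intro!: continuous_at_imp_continuous_on differentiable_imp_continuous_within)
next
  case (Suc k)
  then show ?case by (metis Ck_on.simps(2))
qed

lemma Ck_on_subset: "Ck_on k S f \<Longrightarrow> T \<subseteq> S \<Longrightarrow> Ck_on k T f"
  by (induction k arbitrary: f) (auto intro: continuous_on_subset)

lemma Ck_on_const: "Ck_on k S (\<lambda>x. c)"
  by (induction k arbitrary: c) auto

lemma Ck_on_bounded_linear_comp:
  assumes "bounded_linear L" "open S" "Ck_on k S f"
  shows "Ck_on k S (\<lambda>x. L (f x))"
  using assms(3)
proof (induction k arbitrary: f)
  case 0
  then show ?case
    using bounded_linear.continuous_on[OF assms(1)] by simp
next
  case (Suc k)
  show ?case
    by (rule Ck_onI[OF assms(2), where f' = "\<lambda>x v. L (frechet_derivative f (at x) v)"])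
      (use Suc in \<open>auto intro!: bounded_linear.has_derivative[OF assms(1)]
         simp: frechet_derivative_works\<close>)
qed

lemma Ck_on_bounded_linear: "bounded_linear L \<Longrightarrow> open S \<Longrightarrow> Ck_on k S L"
proof (cases k)
  case (Suc n)
  assume "bounded_linear L" "open S"
  then show ?thesis unfolding Suc
    by (intro Ck_onI[where f' = "\<lambda>x. L"])
      (auto intro: bounded_linear_imp_has_derivative Ck_on_const)
qed (auto intro: linear_continuous_on)

lemma Ck_on_add:
  assumes "open S" "Ck_on k S f" "Ck_on k S g"
  shows "Ck_on k S (\<lambda>x. f x + g x)"
  using assms(2,3)
proof (induction k arbitrary: f g)
  case 0
  then show ?case by (auto intro: continuous_on_add)
next
  case (Suc k)
  show ?case
    by (rule Ck_onI[OF assms(1), where f' = "\<lambda>x v. frechet_derivative f (at x) v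
          + frechet_derivative g (at x) v"])
      (use Suc in \<open>auto intro!: has_derivative_add simp: frechet_derivative_works\<close>)
qed

text \<open>The product rule pairs a differentiated factor with an undifferentiated one;
  \<open>Ck_on_SucD\<close> lowers the latter to level \<open>k\<close>, where the induction
  hypothesis applies.\<close>

lemma Ck_on_bounded_bilinear:
  assumes "bounded_bilinear B" "open S" "Ck_on k S f" "Ck_on k S g"
  shows "Ck_on k S (\<lambda>x. B (f x) (g x))"
  using assms(3,4)
proof (induction k arbitrary: f g)
  case 0
  then show ?case by (auto intro: bounded_bilinear.continuous_on[OF assms(1)])
next
  case (Suc k)
  show ?case
    by (rule Ck_onI[OF assms(2), where f' = "\<lambda>x v. B (f x) (frechet_derivative g (at x) v)
          + B (frechet_derivative f (at x) v) (g x)"])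
      (use Suc Suc.prems[THEN Ck_on_SucD] in \<open>auto intro!: bounded_bilinear.FDERIV[OF assms(1)] Ck_on_add[OF assms(2)]
         simp: frechet_derivative_works\<close>)
qed

lemma Ck_on_sum:
  assumes "open S" "\<And>i. i \<in> I \<Longrightarrow> Ck_on k S (f i)"
  shows "Ck_on k S (\<lambda>x. \<Sum>i\<in>I. f i x)"
  using assms(2)
  by (induction I rule: infinite_finite_induct) (auto intro: Ck_on_const Ck_on_add[OF assms(1)])

lemma linear_Basis_expansion:
  fixes L :: "'b::euclidean_space \<Rightarrow> 'c::real_vector"
  assumes "linear L"
  shows "L v = (\<Sum>b\<in>Basis. (v \<bullet> b) *\<^sub>R L b)"
  by (metis (no_types, lifting) assms euclidean_representation linear_scale linear_sum sum.cong)

text \<open>\<open>Ck_on\<close> controls derivatives in a fixed direction only, but the chain rule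
  evaluates the derivative of \<open>f\<close> in a direction that moves with \<open>x\<close>.
  Expanding this direction in \<open>Basis\<close> separates the two dependencies.\<close>

lemma Ck_on_compose:
  fixes f :: "'b::euclidean_space \<Rightarrow> 'c::real_normed_vector"
    and h :: "'a::real_normed_vector \<Rightarrow> 'b"
  assumes "open S" "open T" "h ` S \<subseteq> T" "Ck_on k T f" "Ck_on k S h"
  shows "Ck_on k S (\<lambda>x. f (h x))"
  using assms(4,5)
proof (induction k arbitrary: f)
  case 0
  then show ?case using assms(3) by (auto intro: continuous_on_compose2)
next
  case (Suc k)
  have d: "((\<lambda>x. f (h x)) has_derivative
      (\<lambda>v. \<Sum>b\<in>Basis. (frechet_derivative h (at x) v \<bullet> b) *\<^sub>R frechet_derivative f (at (h x)) b)) (at x)"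
    if "x \<in> S" for x
  proof -
    have df: "(f has_derivative frechet_derivative f (at (h x))) (at (h x))"
      using Suc.prems(1) assms(3) that frechet_derivative_works by auto
    have dh: "(h has_derivative frechet_derivative h (at x)) (at x)"
      using Suc.prems(2) that frechet_derivative_works by auto
    have "((\<lambda>x. f (h x)) has_derivative
        (\<lambda>v. frechet_derivative f (at (h x)) (frechet_derivative h (at x) v))) (at x)"
      using has_derivative_compose[OF dh df] .
    then show ?thesis
      by (subst (asm) linear_Basis_expansion[OF has_derivative_linear[OF df]])
  qed
  show ?case
  proof (rule Ck_onI[OF assms(1) d])
    fix v
    show "Ck_on k S (\<lambda>x. \<Sum>b\<in>Basis. (frechet_derivative h (at x) v \<bullet> b) *\<^sub>R frechet_derivative f (at (h x)) b)"
      using Suc.prems Suc.IH Ck_on_SucD[OF Suc.prems(2)]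
      by (intro Ck_on_sum Ck_on_bounded_bilinear[OF bounded_bilinear_scaleR]
          Ck_on_bounded_linear_comp[OF bounded_linear_inner_left] assms(1)) auto
  qed
qed

text \<open>With the factor \<open>c\<close> the family is closed under differentiation, so the
  induction hypothesis applies to the derivative.\<close>

lemma Ck_on_powr: "Ck_on k {0<..} (\<lambda>x::real. c * x powr a)"
proof (induction k arbitrary: c a)
  case 0
  then show ?case by (auto intro!: continuous_intros)
next
  case (Suc k)
  show ?case
  proof (rule Ck_onI[where f' = "\<lambda>x v. (v * c * a) * x powr (a - 1)"])
    fix x :: real assume "x \<in> {0<..}"
    then show "((\<lambda>x. c * x powr a) has_derivative (\<lambda>v. (v * c * a) * x powr (a - 1))) (at x)"
      by (auto intro!: derivative_eq_intros simp: powr_diff field_simps)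
  qed (use Suc in auto)
qed

section \<open>Closure properties of smooth maps\<close>

named_theorems smooth

lemma smooth_on_cong:
  assumes "smooth_on S f" "open S" "\<And>x. x \<in> S \<Longrightarrow> f x = g x"
  shows "smooth_on S g"
  using assms Ck_on_cong unfolding smooth_on_def by metis

lemma smooth_on_subset: "smooth_on S f \<Longrightarrow> T \<subseteq> S \<Longrightarrow> smooth_on T f"
  using Ck_on_subset unfolding smooth_on_def by metis

lemma smooth_on_const [smooth]: "smooth_on S (\<lambda>x. c)"
  by (simp add: smooth_on_def Ck_on_const)

lemma smooth_on_bounded_linear: "bounded_linear L \<Longrightarrow> open S \<Longrightarrow> smooth_on S L"
  by (simp add: smooth_on_def Ck_on_bounded_linear)

lemma smooth_on_bounded_linear_comp:
  "bounded_linear L \<Longrightarrow> open S \<Longrightarrow> smooth_on S f \<Longrightarrow> smooth_on S (\<lambda>x. L (f x))"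
  by (simp add: smooth_on_def Ck_on_bounded_linear_comp)

lemmas smooth_on_fst [smooth] = smooth_on_bounded_linear_comp[OF bounded_linear_fst]
lemmas smooth_on_snd [smooth] = smooth_on_bounded_linear_comp[OF bounded_linear_snd]
lemmas smooth_on_inner_left [smooth] = smooth_on_bounded_linear_comp[OF bounded_linear_inner_left]
lemmas smooth_on_minus [smooth] =
  smooth_on_bounded_linear_comp[OF bounded_linear_minus[OF bounded_linear_ident]]

lemma smooth_on_ident [smooth]: "open S \<Longrightarrow> smooth_on S (\<lambda>x. x)"
  by (simp add: smooth_on_bounded_linear bounded_linear_ident)

lemma smooth_on_add [smooth]:
  "open S \<Longrightarrow> smooth_on S f \<Longrightarrow> smooth_on S g \<Longrightarrow> smooth_on S (\<lambda>x. f x + g x)"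
  by (simp add: smooth_on_def Ck_on_add)

lemma smooth_on_diff [smooth]:
  "open S \<Longrightarrow> smooth_on S f \<Longrightarrow> smooth_on S g \<Longrightarrow> smooth_on S (\<lambda>x. f x - g x)"
  using smooth_on_add[OF _ _ smooth_on_minus, of S f g] by simp

lemma smooth_on_scaleR [smooth]:
  "open S \<Longrightarrow> smooth_on S f \<Longrightarrow> smooth_on S g \<Longrightarrow> smooth_on S (\<lambda>x. f x *\<^sub>R g x)"
  by (simp add: smooth_on_def Ck_on_bounded_bilinear bounded_bilinear_scaleR)

lemma smooth_on_mult [smooth]:
  fixes f g :: "_ \<Rightarrow> real"
  shows "open S \<Longrightarrow> smooth_on S f \<Longrightarrow> smooth_on S g \<Longrightarrow> smooth_on S (\<lambda>x. f x * g x)"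
  by (simp add: smooth_on_def Ck_on_bounded_bilinear bounded_bilinear_mult)

lemma smooth_on_sum [smooth]:
  "open S \<Longrightarrow> (\<And>i. i \<in> I \<Longrightarrow> smooth_on S (f i)) \<Longrightarrow> smooth_on S (\<lambda>x. \<Sum>i\<in>I. f i x)"
  by (simp add: smooth_on_def Ck_on_sum)

lemma smooth_on_Pair [smooth]:
  assumes "open S" "smooth_on S f" "smooth_on S g"
  shows "smooth_on S (\<lambda>x. (f x, g x))"
proof -
  have "smooth_on S (\<lambda>x. (f x, 0) + (0, g x))"
    by (intro smooth_on_add assms smooth_on_bounded_linear_comp[OF _ assms(1,2)]
        smooth_on_bounded_linear_comp[OF _ assms(1,3)] bounded_linear_Pair
        bounded_linear_ident bounded_linear_zero)
  then show ?thesis by simp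
qed

lemma smooth_on_compose:
  fixes f :: "'b::euclidean_space \<Rightarrow> 'c::real_normed_vector"
    and h :: "'a::real_normed_vector \<Rightarrow> 'b"
  assumes "smooth_on T f" "smooth_on S h" "open S" "open T" "\<And>x. x \<in> S \<Longrightarrow> h x \<in> T"
  shows "smooth_on S (\<lambda>x. f (h x))"
  using assms Ck_on_compose[OF assms(3,4)] unfolding smooth_on_def by blast

lemma smooth_on_powr [smooth]:
  fixes f :: "_ \<Rightarrow> real"
  assumes "open S" "smooth_on S f" "\<And>x. x \<in> S \<Longrightarrow> f x > 0"
  shows "smooth_on S (\<lambda>x. f x powr a)"
proof -
  have "smooth_on {0<..} (\<lambda>x::real. x powr a)"
    using Ck_on_powr[of _ 1] by (simp add: smooth_on_def)
  then show ?thesis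
    using smooth_on_compose[OF _ assms(2,1) open_greaterThan, where f = "\<lambda>x. x powr a"] assms(3) by simp
qed

lemma smooth_on_imp_differentiable:
  assumes "smooth_on S f" "x \<in> S"
  shows "f differentiable (at x)"
  using assms unfolding smooth_on_def by (metis Ck_on.simps(2))

lemma smooth_on_imp_has_derivative:
  assumes "smooth_on S f" "x \<in> S"
  shows "(f has_derivative frechet_derivative f (at x)) (at x)"
  using smooth_on_imp_differentiable[OF assms] frechet_derivative_works by blast

lemma smooth_on_frechet_derivative:
  assumes "smooth_on S f"
  shows "smooth_on S (\<lambda>x. frechet_derivative f (at x) v)"
  using assms unfolding smooth_on_def by (metis Ck_on.simps(2))

text \<open>Both the base point \<open>h x\<close> and the direction \<open>V x\<close> vary here.
  This is the shape of a vector field after a change of chart and of a function differentiated along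
  a field; the basis expansion reduces it to fixed directions.\<close>

lemma smooth_on_frechet_derivative_apply:
  fixes f :: "'b::euclidean_space \<Rightarrow> 'c::real_normed_vector"
  assumes "smooth_on T f" "smooth_on S h" "smooth_on S V" "open S" "open T" "\<And>x. x \<in> S \<Longrightarrow> h x \<in> T"
  shows "smooth_on S (\<lambda>x. frechet_derivative f (at (h x)) (V x))"
proof -
  have "smooth_on S (\<lambda>x. \<Sum>b\<in>Basis. (V x \<bullet> b) *\<^sub>R frechet_derivative f (at (h x)) b)"
    by (intro smooth assms smooth_on_compose[OF smooth_on_frechet_derivative[OF assms(1)] assms(2,4,5)])
  then show ?thesis
    by (rule smooth_on_cong[OF _ assms(4)]) (metis assms(1,6)
        linear_Basis_expansion linear_frechet_derivative smooth_on_imp_differentiable)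
qed

text \<open>The second difference quotient is evaluated by the mean value theorem in both orders.\<close>

lemma second_difference_mvt:
  fixes f :: "'a::real_normed_vector \<Rightarrow> real"
  assumes h: "h > 0"
    and S: "\<And>s t. 0 \<le> s \<Longrightarrow> s \<le> h \<Longrightarrow> 0 \<le> t \<Longrightarrow> t \<le> h \<Longrightarrow> x + s *\<^sub>R v + t *\<^sub>R w \<in> S"
    and f: "\<And>y. y \<in> S \<Longrightarrow> f differentiable (at y)"
    and f': "\<And>y. y \<in> S \<Longrightarrow> (\<lambda>z. frechet_derivative f (at z) v) differentiable (at y)"
  shows "\<exists>s t. 0 < s \<and> s < h \<and> 0 < t \<and> t < h \<and>
    f (x + h *\<^sub>R v + h *\<^sub>R w) - f (x + h *\<^sub>R v) - f (x + h *\<^sub>R w) + f x =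
    h * h * frechet_derivative (\<lambda>z. frechet_derivative f (at z) v) (at (x + s *\<^sub>R v + t *\<^sub>R w)) w"
proof -
  define G where "G z = frechet_derivative f (at z) v" for z
  have df: "(f has_derivative frechet_derivative f (at y)) (at y)" if "y \<in> S" for y
    using f[OF that] frechet_derivative_works by blast
  have dG: "(G has_derivative frechet_derivative G (at y)) (at y)" if "y \<in> S" for y
    using f'[OF that] frechet_derivative_works unfolding G_def by blast
  have d1: "((\<lambda>s. f (x + s *\<^sub>R v + t *\<^sub>R w)) has_real_derivative G (x + s *\<^sub>R v + t *\<^sub>R w)) (at s)"
    if "0 \<le> s" "s \<le> h" "0 \<le> t" "t \<le> h" for s t
  proof -
    have "((\<lambda>s. x + s *\<^sub>R v + t *\<^sub>R w) has_derivative (\<lambda>r. r *\<^sub>R v)) (at s)"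
      by (auto intro!: derivative_eq_intros)
    from has_derivative_compose[OF this df[OF S[OF that]]]
    have "((\<lambda>s. f (x + s *\<^sub>R v + t *\<^sub>R w)) has_derivative
        (\<lambda>r. r * G (x + s *\<^sub>R v + t *\<^sub>R w))) (at s)"
      using linear_scale[OF linear_frechet_derivative[OF f[OF S[OF that]]]]
      by (simp add: G_def)
    then show ?thesis
      by (simp add: has_field_derivative_def mult_commute_abs)
  qed
  have d2: "((\<lambda>t. G (x + s *\<^sub>R v + t *\<^sub>R w)) has_real_derivative
      frechet_derivative G (at (x + s *\<^sub>R v + t *\<^sub>R w)) w) (at t)"
    if "0 \<le> s" "s \<le> h" "0 \<le> t" "t \<le> h" for s t
  proof -
    have "((\<lambda>t. x + s *\<^sub>R v + t *\<^sub>R w) has_derivative (\<lambda>r. r *\<^sub>R w)) (at t)"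
      by (auto intro!: derivative_eq_intros)
    from has_derivative_compose[OF this dG[OF S[OF that]]]
    have "((\<lambda>t. G (x + s *\<^sub>R v + t *\<^sub>R w)) has_derivative
        (\<lambda>r. r * frechet_derivative G (at (x + s *\<^sub>R v + t *\<^sub>R w)) w)) (at t)"
      using linear_scale[OF has_derivative_linear[OF dG[OF S[OF that]]]]
      by simp
    then show ?thesis
      by (simp add: has_field_derivative_def mult_commute_abs)
  qed
  obtain s where s: "0 < s" "s < h"
    "(f (x + h *\<^sub>R v + h *\<^sub>R w) - f (x + h *\<^sub>R v)) - (f (x + h *\<^sub>R w) - f x) =
      h * (G (x + s *\<^sub>R v + h *\<^sub>R w) - G (x + s *\<^sub>R v))"
  proof -
    have "((\<lambda>s. f (x + s *\<^sub>R v + h *\<^sub>R w) - f (x + s *\<^sub>R v)) has_real_derivative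
        G (x + s *\<^sub>R v + h *\<^sub>R w) - G (x + s *\<^sub>R v)) (at s)" if "0 \<le> s" "s \<le> h" for s
      using DERIV_diff[OF d1[of s h] d1[of s 0]] that h by simp
    from MVT2[OF h this] show ?thesis using that by auto
  qed
  obtain t where t: "0 < t" "t < h"
    "G (x + s *\<^sub>R v + h *\<^sub>R w) - G (x + s *\<^sub>R v) =
      h * frechet_derivative G (at (x + s *\<^sub>R v + t *\<^sub>R w)) w"
    using MVT2[OF h d2[of s]] s by auto
  show ?thesis
    using s t by (intro exI[of _ s] exI[of _ t]) (auto simp: G_def[abs_def] algebra_simps)
qed

text \<open>The second difference is symmetric in \<open>v\<close> and \<open>w\<close>, and
  \<open>second_difference_mvt\<close> equates it with either mixed derivative at some point of a
  small parallelogram. The two points may differ, so continuity of \<open>A\<close> and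
  \<open>B\<close> at \<open>x\<close> is what links their values to \<open>A x\<close> and
  \<open>B x\<close>.\<close>

lemma second_derivative_symmetric:
  fixes f :: "'a::real_normed_vector \<Rightarrow> real"
  assumes "open S" "x \<in> S" and f: "Ck_on 2 S f"
  shows "frechet_derivative (\<lambda>z. frechet_derivative f (at z) v) (at x) w =
    frechet_derivative (\<lambda>z. frechet_derivative f (at z) w) (at x) v"
proof -
  define A where "A y = frechet_derivative (\<lambda>z. frechet_derivative f (at z) v) (at y) w" for y
  define B where "B y = frechet_derivative (\<lambda>z. frechet_derivative f (at z) w) (at y) v" for y
  have C: "Ck_on (Suc (Suc 0)) S f" using f by (simp add: numeral_2_eq_2)
  then have cont: "continuous_on S A" "continuous_on S B"
    by (auto simp: A_def[abs_def] B_def[abs_def])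
  have "A x = B x"
  proof (rule ccontr)
    assume "A x \<noteq> B x"
    \<comment> \<open>Half the distance: two strict approximations to a common value, one of
      \<open>A x\<close> and one of \<open>B x\<close>, then contradict the triangle
      inequality.\<close>
    define e where "e = dist (A x) (B x) / 2"
    have e: "e > 0" using \<open>A x \<noteq> B x\<close> by (simp add: e_def)
    have "isCont A x" "isCont B x"
      using cont assms(1,2) continuous_on_eq_continuous_at by blast+
    then have "\<forall>\<^sub>F y in nhds x. dist (A y) (A x) < e" "\<forall>\<^sub>F y in nhds x. dist (B y) (B x) < e"
      using e by (auto simp: isCont_def tendsto_at_iff_tendsto_nhds dest!: tendstoD)
    moreover have "\<forall>\<^sub>F y in nhds x. y \<in> S"
      using assms(1,2) eventually_nhds by blast
    ultimately have "\<forall>\<^sub>F y in nhds x. dist (A y) (A x) < e \<and> dist (B y) (B x) < e \<and> y \<in> S"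
      by eventually_elim auto
    then obtain d where d: "d > 0"
      "\<And>y. dist y x < d \<Longrightarrow> dist (A y) (A x) < e \<and> dist (B y) (B x) < e \<and> y \<in> S"
      unfolding eventually_nhds_metric by blast
    \<comment> \<open>Chosen so that the whole parallelogram stays in the ball of radius
      \<open>d\<close> around \<open>x\<close>; the summand 1 keeps the denominator positive when
      both vectors vanish.\<close>
    define h where "h = d / (norm v + norm w + 1)"
    have pos: "norm v + norm w + 1 > 0"
      using norm_ge_zero[of v] norm_ge_zero[of w] by linarith
    have h: "h > 0" using d(1) pos by (simp add: h_def)
    have hb: "h * norm v + h * norm w < d"
    proof -
      have "h * (norm v + norm w) < h * (norm v + norm w + 1)"
        using h by (intro mult_strict_left_mono) auto
      also have "\<dots> = d" using pos by (simp add: h_def)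
      finally show ?thesis by (simp add: algebra_simps)
    qed
    have near: "dist (x + s *\<^sub>R v + t *\<^sub>R w) x < d"
      if "0 \<le> s" "s \<le> h" "0 \<le> t" "t \<le> h" for s t
    proof -
      have "dist (x + s *\<^sub>R v + t *\<^sub>R w) x = norm (s *\<^sub>R v + t *\<^sub>R w)"
        by (simp add: dist_norm algebra_simps)
      also have "\<dots> \<le> s * norm v + t * norm w"
        using norm_triangle_ineq[of "s *\<^sub>R v" "t *\<^sub>R w"] that by simp
      also have "\<dots> \<le> h * norm v + h * norm w"
        using that by (intro add_mono mult_right_mono) auto
      finally show ?thesis using hb by linarith
    qed
    obtain s1 t1 where 1: "0 < s1" "s1 < h" "0 < t1" "t1 < h"
      "f (x + h *\<^sub>R v + h *\<^sub>R w) - f (x + h *\<^sub>R v) - f (x + h *\<^sub>R w) + f x =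
        h * h * A (x + s1 *\<^sub>R v + t1 *\<^sub>R w)"
      using second_difference_mvt[OF h, of x v w S f] near d(2) C unfolding A_def by fastforce
    obtain s2 t2 where 2: "0 < s2" "s2 < h" "0 < t2" "t2 < h"
      "f (x + h *\<^sub>R w + h *\<^sub>R v) - f (x + h *\<^sub>R w) - f (x + h *\<^sub>R v) + f x =
        h * h * B (x + s2 *\<^sub>R w + t2 *\<^sub>R v)"
    proof -
      have "x + s *\<^sub>R w + t *\<^sub>R v \<in> S" if "0 \<le> s" "s \<le> h" "0 \<le> t" "t \<le> h" for s t
        using near[of t s] d(2) that by (simp add: add.commute add.left_commute)
      then show ?thesis
        using that second_difference_mvt[OF h, of x w v S f] C unfolding B_def by fastforce
    qed
    have "h * h * A (x + s1 *\<^sub>R v + t1 *\<^sub>R w) = h * h * B (x + t2 *\<^sub>R v + s2 *\<^sub>R w)"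
    proof -
      have "x + h *\<^sub>R w + h *\<^sub>R v = x + h *\<^sub>R v + h *\<^sub>R w"
        "x + s2 *\<^sub>R w + t2 *\<^sub>R v = x + t2 *\<^sub>R v + s2 *\<^sub>R w"
        by simp_all
      note 2(5)[unfolded this]
      with 1(5) show ?thesis by linarith
    qed
    then have "A (x + s1 *\<^sub>R v + t1 *\<^sub>R w) = B (x + t2 *\<^sub>R v + s2 *\<^sub>R w)"
      using h by simp
    moreover have "dist (A (x + s1 *\<^sub>R v + t1 *\<^sub>R w)) (A x) < e"
      using d(2)[OF near[of s1 t1]] 1 by simp
    moreover have "dist (B (x + t2 *\<^sub>R v + s2 *\<^sub>R w)) (B x) < e"
      using d(2)[OF near[of t2 s2]] 2 by simp
    ultimately have "dist (A x) (B x) < e + e"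
      by (metis dist_triangle_half_l dist_commute field_sum_of_halves e_def dist_triangle3 add_strict_mono order_le_less_trans)
    then show False by (simp add: e_def)
  qed
  then show ?thesis by (simp add: A_def B_def)
qed

section \<open>Charts, vector fields and functions on a manifold\<close>

lemma lie_bracket_antisym: "lie_bracket M Y X p = - lie_bracket M X Y p"
  by (simp add: lie_bracket_def)

locale smooth_mfd =
  fixes M :: "('m::{t2_space, second_countable_topology}, 'e::euclidean_space) manifold"
  assumes smooth_manifold: "smooth_manifold M"
begin

abbreviation trans :: "'m \<Rightarrow> 'm \<Rightarrow> 'e \<Rightarrow> 'e" where
  "trans p q \<equiv> chart M q \<circ> inv_chart M p"

lemma in_chart_dom: "p \<in> points M \<Longrightarrow> p \<in> chart_dom M p"
  using smooth_manifold by (simp add: smooth_manifold_def)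

lemma chart_dom_subset: "p \<in> points M \<Longrightarrow> q \<in> chart_dom M p \<Longrightarrow> q \<in> points M"
  using smooth_manifold by (auto simp: smooth_manifold_def)

lemma open_chart_dom: "p \<in> points M \<Longrightarrow> open_in_manifold M (chart_dom M p)"
  using smooth_manifold by (simp add: smooth_manifold_def)

lemma chart_homeomorphism: "p \<in> points M \<Longrightarrow>
    homeomorphism (chart_dom M p) (chart M p ` chart_dom M p) (chart M p) (inv_chart M p)"
  using smooth_manifold by (simp add: smooth_manifold_def)

lemma inv_chart_chart [simp]:
  "p \<in> points M \<Longrightarrow> q \<in> chart_dom M p \<Longrightarrow> inv_chart M p (chart M p q) = q"
  using chart_homeomorphism by (simp add: homeomorphism_def)

lemma open_in_manifold_subset: "open_in_manifold M U \<Longrightarrow> q \<in> U \<Longrightarrow> q \<in> points M"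
  using openin_subset by fastforce

lemma open_chart_image:
  assumes "p \<in> points M" "open_in_manifold M U"
  shows "open (chart M p ` (chart_dom M p \<inter> U))"
proof -
  have "openin (top_of_set (chart_dom M p)) (chart_dom M p \<inter> U)"
    using assms chart_dom_subset by (meson openin_subset_trans openin_Int open_chart_dom
        inf_le1 subsetI)
  from homeomorphism_imp_open_map[OF chart_homeomorphism[OF assms(1)] this]
  show ?thesis
    using openin_open_eq smooth_manifold assms(1) by (auto simp: smooth_manifold_def)
qed

lemma open_chart_image_dom: "p \<in> points M \<Longrightarrow> open (chart M p ` chart_dom M p)"
  using open_chart_image[OF _ open_chart_dom] by fastforce

lemma open_chart_image_sub:
  assumes "p \<in> points M" "open_in_manifold M U" "U \<subseteq> chart_dom M p"
  shows "open (chart M p ` U)"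
  using open_chart_image[OF assms(1,2)] assms(3) by (simp add: inf_absorb2)

lemma smooth_trans:
  assumes "p \<in> points M" "q \<in> points M"
  shows "smooth_on (chart M p ` (chart_dom M p \<inter> chart_dom M q)) (trans p q)"
  using smooth_manifold assms by (simp add: smooth_manifold_def)

lemma trans_has_derivative:
  assumes "p \<in> points M" "q \<in> points M" "r \<in> chart_dom M p" "r \<in> chart_dom M q"
  shows "(trans p q has_derivative frechet_derivative (trans p q) (at (chart M p r)))
    (at (chart M p r))"
  using smooth_on_imp_has_derivative[OF smooth_trans] assms by blast

lemma linear_dtrans:
  assumes "p \<in> points M" "q \<in> points M" "r \<in> chart_dom M p" "r \<in> chart_dom M q"
  shows "linear (frechet_derivative (trans p q) (at (chart M p r)))"
  using trans_has_derivative[OF assms] has_derivative_linear by blast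

lemma dtrans_self:
  assumes "p \<in> points M" "q \<in> chart_dom M p"
  shows "frechet_derivative (trans p p) (at (chart M p q)) v = v"
proof -
  have "frechet_derivative (trans p p) (at (chart M p q)) = frechet_derivative (\<lambda>x. x) (at (chart M p q))"
    by (rule frechet_derivative_cong_open[OF open_chart_image_dom[OF assms(1)]]) (use assms in auto)
  then show ?thesis by simp
qed

text \<open>The cocycle rule of the tangent bundle. The chain rule yields it because passing from
  \<open>p\<close> to \<open>s\<close> through the chart of \<open>q\<close> agrees near the point
  with passing directly; every change of coordinates of a vector field rests on it.\<close>

lemma dtrans_compose:
  assumes "p \<in> points M" "q \<in> points M" "s \<in> points M"
    "r \<in> chart_dom M p" "r \<in> chart_dom M q" "r \<in> chart_dom M s"
  shows "frechet_derivative (trans q s) (at (chart M q r))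
      (frechet_derivative (trans p q) (at (chart M p r)) v) =
    frechet_derivative (trans p s) (at (chart M p r)) v"
proof -
  let ?S = "chart M p ` (chart_dom M p \<inter> chart_dom M q)"
  have "trans p q (chart M p r) = chart M q r" using assms by simp
  then have "((\<lambda>z. trans q s (trans p q z)) has_derivative
      (\<lambda>v. frechet_derivative (trans q s) (at (chart M q r))
        (frechet_derivative (trans p q) (at (chart M p r)) v))) (at (chart M p r))"
    using has_derivative_compose[OF trans_has_derivative[OF assms(1,2,4,5)], where g = "trans q s"]
      trans_has_derivative[OF assms(2,3,5,6)] by simp
  then have "frechet_derivative (\<lambda>z. trans q s (trans p q z)) (at (chart M p r)) =
      (\<lambda>v. frechet_derivative (trans q s) (at (chart M q r))
        (frechet_derivative (trans p q) (at (chart M p r)) v))"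
    using frechet_derivative_at by metis
  moreover have "frechet_derivative (\<lambda>z. trans q s (trans p q z)) (at (chart M p r)) =
      frechet_derivative (trans p s) (at (chart M p r))"
    by (rule frechet_derivative_cong_open[OF open_chart_image[OF assms(1) open_chart_dom[OF assms(2)]]])
      (use assms in auto)
  ultimately show ?thesis by metis
qed

section \<open>Coordinates and smoothness of vector fields and functions\<close>

lemma vf_coords_chart:
  assumes "p \<in> points M" "q \<in> chart_dom M p"
  shows "vf_coords M p X (chart M p q) = frechet_derivative (trans q p) (at (chart M q q)) (X q)"
  using assms by (simp add: vf_coords_def)

lemma vf_coords_self:
  assumes "p \<in> points M"
  shows "vf_coords M p X (chart M p p) = X p"
  using assms by (simp add: vf_coords_chart in_chart_dom dtrans_self)

lemma vf_coords_change:
  assumes "p \<in> points M" "p' \<in> points M" "q \<in> chart_dom M p" "q \<in> chart_dom M p'"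
  shows "vf_coords M p' X (chart M p' q) =
    frechet_derivative (trans p p') (at (chart M p q)) (vf_coords M p X (chart M p q))"
proof -
  have q: "q \<in> points M" using assms chart_dom_subset by blast
  show ?thesis
    using assms q by (simp add: vf_coords_chart dtrans_compose in_chart_dom)
qed

lemma smooth_vf_on_subset: "smooth_vf_on M U X \<Longrightarrow> V \<subseteq> U \<Longrightarrow> smooth_vf_on M V X"
  unfolding smooth_vf_on_def by (meson image_mono inf_mono order_refl smooth_on_subset)

text \<open>\<open>smooth_vf_on\<close> tests every chart. One chart whose domain contains
  \<open>V\<close> is enough, because the coordinates in any other chart arise from it by the
  derivative of the chart change, taken at the transported point.\<close>

lemma smooth_vf_onI_chart:
  assumes p: "p \<in> points M" and V: "open_in_manifold M V" "V \<subseteq> chart_dom M p"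
    and X: "smooth_on (chart M p ` V) (vf_coords M p X)"
  shows "smooth_vf_on M V X"
  unfolding smooth_vf_on_def
proof
  fix p' assume p': "p' \<in> points M"
  let ?S = "chart M p' ` (chart_dom M p' \<inter> V)"
  have S: "open ?S" using open_chart_image[OF p' V(1)] .
  have t: "smooth_on ?S (trans p' p)"
    by (rule smooth_on_subset[OF smooth_trans[OF p' p]]) (use V in auto)
  have d: "smooth_on (chart M p ` (chart_dom M p \<inter> chart_dom M p')) (trans p p')"
    by (rule smooth_trans[OF p p'])
  have "smooth_on ?S (\<lambda>z. frechet_derivative (trans p p') (at (trans p' p z)) (vf_coords M p X (trans p' p z)))"
  proof (rule smooth_on_frechet_derivative_apply[OF d t _ S])
    show "smooth_on ?S (\<lambda>z. vf_coords M p X (trans p' p z))"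
      by (rule smooth_on_compose[OF X t S open_chart_image_sub[OF p V]]) (use p' V in auto)
  qed (use p p' V open_chart_image[OF p open_chart_dom[OF p']] in auto)
  then show "smooth_on ?S (vf_coords M p' X)"
    by (rule smooth_on_cong[OF _ S]) (use vf_coords_change[OF p p'] V p' in \<open>force\<close>)
qed

lemma vf_coords_add:
  assumes "p \<in> points M" "z \<in> chart M p ` chart_dom M p"
  shows "vf_coords M p (\<lambda>q. X q + Y q) z = vf_coords M p X z + vf_coords M p Y z"
proof -
  obtain q where q: "q \<in> chart_dom M p" "z = chart M p q" using assms by auto
  then have "q \<in> points M" using chart_dom_subset assms by blast
  then show ?thesis
    using q assms linear_add[OF linear_dtrans] by (simp add: vf_coords_chart in_chart_dom)
qed

lemma vf_coords_scaleR:
  assumes "p \<in> points M" "z \<in> chart M p ` chart_dom M p"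
  shows "vf_coords M p (\<lambda>q. f q *\<^sub>R X q) z = f (inv_chart M p z) *\<^sub>R vf_coords M p X z"
proof -
  obtain q where q: "q \<in> chart_dom M p" "z = chart M p q" using assms by auto
  then have "q \<in> points M" using chart_dom_subset assms by blast
  then show ?thesis
    using q assms linear_scale[OF linear_dtrans] by (simp add: vf_coords_chart in_chart_dom)
qed

lemma vf_coords_zero:
  assumes "p \<in> points M" "z \<in> chart M p ` chart_dom M p"
  shows "vf_coords M p (\<lambda>q. 0) z = 0"
  using vf_coords_scaleR[OF assms, of "\<lambda>q. 0" "\<lambda>q. 0"] by simp

lemma vf_coords_cong:
  assumes "p \<in> points M" "z \<in> chart M p ` (chart_dom M p \<inter> U)" "\<And>q. q \<in> U \<Longrightarrow> X q = Y q"
  shows "vf_coords M p X z = vf_coords M p Y z"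
  using assms by (auto simp: vf_coords_def Let_def)

lemma smooth_vf_on_cong:
  assumes U: "open_in_manifold M U" and "smooth_vf_on M U X" "\<And>q. q \<in> U \<Longrightarrow> X q = Y q"
  shows "smooth_vf_on M U Y"
  unfolding smooth_vf_on_def
proof
  fix p assume p: "p \<in> points M"
  show "smooth_on (chart M p ` (chart_dom M p \<inter> U)) (vf_coords M p Y)"
    by (rule smooth_on_cong[of _ "vf_coords M p X"])
      (use assms(2) p vf_coords_cong[OF p _ assms(3)] open_chart_image[OF p U]
        in \<open>auto simp: smooth_vf_on_def\<close>)
qed

lemma smooth_fun_on_cong:
  assumes U: "open_in_manifold M U" and "smooth_fun_on M U f" "\<And>q. q \<in> U \<Longrightarrow> f q = g q"
  shows "smooth_fun_on M U g"
  unfolding smooth_fun_on_def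
proof
  fix p assume p: "p \<in> points M"
  show "smooth_on (chart M p ` (chart_dom M p \<inter> U)) (g \<circ> inv_chart M p)"
    by (rule smooth_on_cong[of _ "f \<circ> inv_chart M p"])
      (use assms p open_chart_image in \<open>auto simp: smooth_fun_on_def\<close>)
qed

lemma smooth_vf_on_add:
  assumes U: "open_in_manifold M U" and "smooth_vf_on M U X" "smooth_vf_on M U Y"
  shows "smooth_vf_on M U (\<lambda>q. X q + Y q)"
  unfolding smooth_vf_on_def
proof
  fix p assume p: "p \<in> points M"
  note S = open_chart_image[OF p U]
  show "smooth_on (chart M p ` (chart_dom M p \<inter> U)) (vf_coords M p (\<lambda>q. X q + Y q))"
    by (rule smooth_on_cong[OF smooth_on_add[OF S, of "vf_coords M p X" "vf_coords M p Y"] S])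
      (use assms p in \<open>auto simp: smooth_vf_on_def vf_coords_add\<close>)
qed

lemma smooth_vf_on_scaleR:
  assumes U: "open_in_manifold M U" and "smooth_fun_on M U f" "smooth_vf_on M U X"
  shows "smooth_vf_on M U (\<lambda>q. f q *\<^sub>R X q)"
  unfolding smooth_vf_on_def
proof
  fix p assume p: "p \<in> points M"
  note S = open_chart_image[OF p U]
  show "smooth_on (chart M p ` (chart_dom M p \<inter> U)) (vf_coords M p (\<lambda>q. f q *\<^sub>R X q))"
    by (rule smooth_on_cong[OF smooth_on_scaleR[OF S, of "f \<circ> inv_chart M p" "vf_coords M p X"] S])
      (use assms p in \<open>auto simp: smooth_vf_on_def smooth_fun_on_def vf_coords_scaleR\<close>)
qed

lemma smooth_vf_on_zero: "open_in_manifold M U \<Longrightarrow> smooth_vf_on M U (\<lambda>q. 0)"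
  unfolding smooth_vf_on_def
proof
  fix p assume U: "open_in_manifold M U" and p: "p \<in> points M"
  show "smooth_on (chart M p ` (chart_dom M p \<inter> U)) (vf_coords M p (\<lambda>q. 0))"
    by (rule smooth_on_cong[OF smooth_on_const[of _ 0] open_chart_image[OF p U]])
      (use p in \<open>auto simp: vf_coords_zero\<close>)
qed

lemma smooth_fun_on_const: "smooth_fun_on M U (\<lambda>q. c)"
  by (simp add: smooth_fun_on_def o_def smooth_on_const)

lemma smooth_fun_on_mult:
  "open_in_manifold M U \<Longrightarrow> smooth_fun_on M U f \<Longrightarrow> smooth_fun_on M U g \<Longrightarrow>
    smooth_fun_on M U (\<lambda>q. f q * g q)"
  unfolding smooth_fun_on_def o_def by (simp add: smooth_on_mult open_chart_image)

lemma smooth_vf_on_sum: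
  assumes U: "open_in_manifold M U"
  shows "(\<And>i. i \<in> I \<Longrightarrow> smooth_vf_on M U (X i)) \<Longrightarrow> smooth_vf_on M U (\<lambda>q. \<Sum>i\<in>I. X i q)"
  by (induction I rule: infinite_finite_induct)
    (auto intro: smooth_vf_on_zero U smooth_vf_on_add)

text \<open>The jump at the boundary of \<open>U\<close> is invisible to smoothness on
  \<open>U\<close>, which only sees the value 1. This is the cutoff used in
  \<open>conn_cong\<close>.\<close>

lemma smooth_fun_on_indicator: "open_in_manifold M U \<Longrightarrow> smooth_fun_on M U (indicator U)"
  by (rule smooth_fun_on_cong[OF _ smooth_fun_on_const[of _ 1]]) auto

subsection \<open>Directional derivatives\<close>

lemma smooth_fun_has_derivative:
  assumes "open_in_manifold M U" "smooth_fun_on M U f" "p \<in> points M" "q \<in> chart_dom M p" "q \<in> U"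
  shows "((f \<circ> inv_chart M p) has_derivative
    frechet_derivative (f \<circ> inv_chart M p) (at (chart M p q))) (at (chart M p q))"
  using assms smooth_on_imp_has_derivative unfolding smooth_fun_on_def by blast

text \<open>\<open>deriv_along\<close> at \<open>q\<close> is computed in the chart of
  \<open>q\<close>, which changes with \<open>q\<close>. An expression in the fixed chart of
  \<open>p\<close> is needed before the result can be differentiated again.\<close>

lemma deriv_along_chart:
  assumes U: "open_in_manifold M U" "smooth_fun_on M U f" and p: "p \<in> points M"
    and q: "q \<in> chart_dom M p" "q \<in> U"
  shows "deriv_along M q v f = frechet_derivative (f \<circ> inv_chart M p) (at (chart M p q))
    (frechet_derivative (trans q p) (at (chart M q q)) v)"
proof -
  have qM: "q \<in> points M" using p q chart_dom_subset by blast
  have "((\<lambda>z. (f \<circ> inv_chart M p) (trans q p z)) has_derivative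
      (\<lambda>v. frechet_derivative (f \<circ> inv_chart M p) (at (chart M p q))
        (frechet_derivative (trans q p) (at (chart M q q)) v))) (at (chart M q q))"
    using has_derivative_compose[OF trans_has_derivative[OF qM p in_chart_dom[OF qM] q(1)],
        where g = "f \<circ> inv_chart M p"] smooth_fun_has_derivative[OF U p q] qM in_chart_dom
    by simp
  then have "frechet_derivative (\<lambda>z. (f \<circ> inv_chart M p) (trans q p z)) (at (chart M q q)) =
      (\<lambda>v. frechet_derivative (f \<circ> inv_chart M p) (at (chart M p q))
        (frechet_derivative (trans q p) (at (chart M q q)) v))"
    using frechet_derivative_at by metis
  moreover have "frechet_derivative (\<lambda>z. (f \<circ> inv_chart M p) (trans q p z)) (at (chart M q q)) =
      frechet_derivative (f \<circ> inv_chart M q) (at (chart M q q))"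
    by (rule frechet_derivative_cong_open[OF open_chart_image[OF qM open_chart_dom[OF p]]])
      (use p qM q in_chart_dom in auto)
  ultimately show ?thesis unfolding deriv_along_def by metis
qed

lemma deriv_along_vf_chart:
  assumes "open_in_manifold M U" "smooth_fun_on M U f" "p \<in> points M"
    "q \<in> chart_dom M p" "q \<in> U"
  shows "deriv_along M q (X q) f =
    frechet_derivative (f \<circ> inv_chart M p) (at (chart M p q)) (vf_coords M p X (chart M p q))"
  using deriv_along_chart[OF assms] vf_coords_chart[OF assms(3,4)] by simp

lemma smooth_fun_on_deriv_along:
  assumes U: "open_in_manifold M U" and f: "smooth_fun_on M U f" and X: "smooth_vf_on M U X"
  shows "smooth_fun_on M U (\<lambda>q. deriv_along M q (X q) f)"
  unfolding smooth_fun_on_def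
proof
  fix p assume p: "p \<in> points M"
  let ?S = "chart M p ` (chart_dom M p \<inter> U)"
  have S: "open ?S" using open_chart_image[OF p U] .
  have "smooth_on ?S (\<lambda>z. frechet_derivative (f \<circ> inv_chart M p) (at z) (vf_coords M p X z))"
    by (rule smooth_on_frechet_derivative_apply[of ?S])
      (use f X p S smooth_on_ident in \<open>auto simp: smooth_fun_on_def smooth_vf_on_def\<close>)
  then show "smooth_on ?S ((\<lambda>q. deriv_along M q (X q) f) \<circ> inv_chart M p)"
    by (rule smooth_on_cong[OF _ S]) (use deriv_along_vf_chart[OF U f p] p in \<open>force\<close>)
qed

lemma deriv_along_cong:
  assumes U: "open_in_manifold M U" "p \<in> U" and "\<And>q. q \<in> U \<Longrightarrow> f q = g q"
  shows "deriv_along M p v f = deriv_along M p v g"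
proof -
  have p: "p \<in> points M" using open_in_manifold_subset U by blast
  have "frechet_derivative (f \<circ> inv_chart M p) (at (chart M p p)) =
      frechet_derivative (g \<circ> inv_chart M p) (at (chart M p p))"
    by (rule frechet_derivative_cong_open[OF open_chart_image[OF p U(1)]])
      (use assms p in_chart_dom in auto)
  then show ?thesis by (simp add: deriv_along_def)
qed

lemma deriv_along_const: "deriv_along M p v (\<lambda>q. c) = 0"
  by (simp add: deriv_along_def o_def)

lemma deriv_along_linear:
  assumes "open_in_manifold M U" "smooth_fun_on M U f" "p \<in> U"
  shows "linear (\<lambda>v. deriv_along M p v f)"
proof -
  have "p \<in> points M" using open_in_manifold_subset assms by blast
  then show ?thesis
    using smooth_fun_has_derivative[OF assms(1,2) _ in_chart_dom] assms(3) has_derivative_linear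
    unfolding deriv_along_def by blast
qed

lemma vf_coords_has_derivative:
  assumes "open_in_manifold M U" "smooth_vf_on M U X" "p \<in> U"
  shows "(vf_coords M p X has_derivative frechet_derivative (vf_coords M p X) (at (chart M p p)))
    (at (chart M p p))"
proof -
  have "p \<in> points M" using open_in_manifold_subset assms by blast
  then show ?thesis
    using assms in_chart_dom unfolding smooth_vf_on_def
    by (intro smooth_on_imp_has_derivative[of "chart M p ` (chart_dom M p \<inter> U)"]) auto
qed

subsection \<open>The Lie bracket\<close>

lemma lie_bracket_cong:
  assumes U: "open_in_manifold M U" "p \<in> U" and "\<And>q. q \<in> U \<Longrightarrow> X q = X' q" "\<And>q. q \<in> U \<Longrightarrow> Y q = Y' q"
  shows "lie_bracket M X Y p = lie_bracket M X' Y' p"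
proof -
  have p: "p \<in> points M" using open_in_manifold_subset U by blast
  have "frechet_derivative (vf_coords M p Z) (at (chart M p p)) =
      frechet_derivative (vf_coords M p Z') (at (chart M p p))"
    if "\<And>q. q \<in> U \<Longrightarrow> Z q = Z' q" for Z Z'
    by (rule frechet_derivative_cong_open[OF open_chart_image[OF p U(1)]])
      (use U p in_chart_dom vf_coords_cong[OF p _ that] in auto)
  from this[of X X', OF assms(3)] this[of Y Y', OF assms(4)] show ?thesis
    by (simp add: lie_bracket_def assms(3,4)[OF U(2)])
qed

lemma lie_bracket_add_left:
  assumes U: "open_in_manifold M U" "p \<in> U"
    and X: "smooth_vf_on M U X" "smooth_vf_on M U X'" and Y: "smooth_vf_on M U Y"
  shows "lie_bracket M (\<lambda>q. X q + X' q) Y p = lie_bracket M X Y p + lie_bracket M X' Y p"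
proof -
  have p: "p \<in> points M" using open_in_manifold_subset U by blast
  have "frechet_derivative (vf_coords M p (\<lambda>q. X q + X' q)) (at (chart M p p)) =
      frechet_derivative (\<lambda>z. vf_coords M p X z + vf_coords M p X' z) (at (chart M p p))"
    by (rule frechet_derivative_cong_open[OF open_chart_image_dom[OF p]])
      (use p in_chart_dom vf_coords_add in auto)
  also have "\<dots> = (\<lambda>v. frechet_derivative (vf_coords M p X) (at (chart M p p)) v +
      frechet_derivative (vf_coords M p X') (at (chart M p p)) v)"
    by (rule frechet_derivative_at[symmetric])
      (intro has_derivative_add vf_coords_has_derivative[OF U(1) _ U(2)] X)
  finally show ?thesis
    using linear_add[OF has_derivative_linear[OF vf_coords_has_derivative[OF U(1) Y U(2)]]]
    by (simp add: lie_bracket_def)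
qed

lemma lie_bracket_scaleR_left:
  assumes U: "open_in_manifold M U" "p \<in> U"
    and X: "smooth_vf_on M U X" and f: "smooth_fun_on M U f" and Y: "smooth_vf_on M U Y"
  shows "lie_bracket M (\<lambda>q. f q *\<^sub>R X q) Y p =
    f p *\<^sub>R lie_bracket M X Y p - deriv_along M p (Y p) f *\<^sub>R X p"
proof -
  have p: "p \<in> points M" using open_in_manifold_subset U by blast
  have "frechet_derivative (vf_coords M p (\<lambda>q. f q *\<^sub>R X q)) (at (chart M p p)) =
      frechet_derivative (\<lambda>z. (f \<circ> inv_chart M p) z *\<^sub>R vf_coords M p X z) (at (chart M p p))"
    by (rule frechet_derivative_cong_open[OF open_chart_image_dom[OF p]])
      (use p in_chart_dom vf_coords_scaleR in auto)
  also have "\<dots> = (\<lambda>v. (f \<circ> inv_chart M p) (chart M p p) *\<^sub>R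
        frechet_derivative (vf_coords M p X) (at (chart M p p)) v +
      frechet_derivative (f \<circ> inv_chart M p) (at (chart M p p)) v *\<^sub>R vf_coords M p X (chart M p p))"
    by (rule frechet_derivative_at[symmetric])
      (intro has_derivative_scaleR vf_coords_has_derivative[OF U(1) _ U(2)] X
        smooth_fun_has_derivative[OF U(1) f p in_chart_dom[OF p] U(2)])
  finally show ?thesis
    using linear_scale[OF has_derivative_linear[OF vf_coords_has_derivative[OF U(1) Y U(2)]]] p
    by (simp add: lie_bracket_def deriv_along_def vf_coords_self in_chart_dom algebra_simps)
qed

text \<open>The product rule gives a first-order term from the derivative of \<open>y\<close> and a
  Hessian term. Symmetry of second derivatives puts the Hessian into the stated form, with the fixed
  vector \<open>v\<close> applied first, so that exchanging two fields merely exchanges its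
  arguments.\<close>

lemma frechet_derivative_of_derivative_apply:
  fixes F :: "'e \<Rightarrow> real"
  assumes "open S" "z \<in> S" "smooth_on S F" "smooth_on S y"
  shows "frechet_derivative (\<lambda>z. frechet_derivative F (at z) (y z)) (at z) v =
    frechet_derivative F (at z) (frechet_derivative y (at z) v) +
    frechet_derivative (\<lambda>x. frechet_derivative F (at x) v) (at z) (y z)"
proof -
  define G where "G b x = frechet_derivative F (at x) b" for b x
  have lin: "linear (frechet_derivative F (at x))" if "x \<in> S" for x
    using smooth_on_imp_has_derivative[OF assms(3) that] has_derivative_linear by blast
  have G: "smooth_on S (G b)" for b
    using smooth_on_frechet_derivative[OF assms(3)] by (simp add: G_def[abs_def])
  note dG = smooth_on_imp_has_derivative[OF G assms(2)]
  have "frechet_derivative (\<lambda>x. frechet_derivative F (at x) (y x)) (at z) =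
      frechet_derivative (\<lambda>x. \<Sum>b\<in>Basis. (y x \<bullet> b) * G b x) (at z)"
    by (rule frechet_derivative_cong_open[OF assms(1,2)])
      (simp add: linear_Basis_expansion[OF lin] G_def)
  also have "\<dots> = (\<lambda>v. \<Sum>b\<in>Basis. (y z \<bullet> b) * frechet_derivative (G b) (at z) v +
      (frechet_derivative y (at z) v \<bullet> b) * G b z)"
    by (rule frechet_derivative_at[symmetric])
      (intro has_derivative_sum has_derivative_mult has_derivative_inner_left dG
        smooth_on_imp_has_derivative[OF assms(4,2)])
  finally have "frechet_derivative (\<lambda>x. frechet_derivative F (at x) (y x)) (at z) v =
      (\<Sum>b\<in>Basis. (y z \<bullet> b) * frechet_derivative (G b) (at z) v) +
      (\<Sum>b\<in>Basis. (frechet_derivative y (at z) v \<bullet> b) * G b z)"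
    by (simp add: sum.distrib)
  also have "(\<Sum>b\<in>Basis. (frechet_derivative y (at z) v \<bullet> b) * G b z) =
      frechet_derivative F (at z) (frechet_derivative y (at z) v)"
    by (simp add: linear_Basis_expansion[OF lin[OF assms(2)], of "frechet_derivative y (at z) v"] G_def)
  also have "(\<Sum>b\<in>Basis. (y z \<bullet> b) * frechet_derivative (G b) (at z) v) =
      (\<Sum>b\<in>Basis. (y z \<bullet> b) * frechet_derivative (G v) (at z) b)"
    using second_derivative_symmetric[OF assms(1,2), of F] assms(3)
    unfolding G_def[abs_def] smooth_on_def by (intro sum.cong) auto
  also have "\<dots> = frechet_derivative (G v) (at z) (y z)"
    by (simp add: linear_Basis_expansion[OF has_derivative_linear[OF dG], of _ "y z"])
  finally show ?thesis by (simp add: G_def[abs_def])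
qed

text \<open>Both iterated derivatives contain the Hessian of \<open>f\<close>, with its arguments
  exchanged; these parts cancel. The derivatives of the coefficients remain, and their difference is
  the coordinate formula of the bracket.\<close>

lemma deriv_along_lie_bracket:
  assumes U: "open_in_manifold M U" "p \<in> U"
    and X: "smooth_vf_on M U X" and f: "smooth_fun_on M U f" and Y: "smooth_vf_on M U Y"
  shows "deriv_along M p (lie_bracket M X Y p) f =
    deriv_along M p (X p) (\<lambda>q. deriv_along M q (Y q) f) -
    deriv_along M p (Y p) (\<lambda>q. deriv_along M q (X q) f)"
proof -
  have p: "p \<in> points M" using open_in_manifold_subset U by blast
  let ?S = "chart M p ` (chart_dom M p \<inter> U)" and ?z = "chart M p p"
  let ?F = "f \<circ> inv_chart M p"
  have S: "open ?S" "?z \<in> ?S" using open_chart_image[OF p U(1)] in_chart_dom p U by auto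
  have F: "smooth_on ?S ?F" using f p by (simp add: smooth_fun_on_def)
  have *: "deriv_along M p v (\<lambda>q. deriv_along M q (Y q) f) =
      frechet_derivative ?F (at ?z) (frechet_derivative (vf_coords M p Y) (at ?z) v) +
      frechet_derivative (\<lambda>x. frechet_derivative ?F (at x) v) (at ?z) (Y p)"
    if Y: "smooth_vf_on M U Y" for v Y
  proof -
    have "frechet_derivative ((\<lambda>q. deriv_along M q (Y q) f) \<circ> inv_chart M p) (at ?z) =
        frechet_derivative (\<lambda>z. frechet_derivative ?F (at z) (vf_coords M p Y z)) (at ?z)"
      by (rule frechet_derivative_cong_open[OF S])
        (use deriv_along_vf_chart[OF U(1) f p] p in \<open>force\<close>)
    then show ?thesis
      using frechet_derivative_of_derivative_apply[OF S F, of "vf_coords M p Y" v] Y p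
      by (simp add: deriv_along_def smooth_vf_on_def vf_coords_self)
  qed
  have "frechet_derivative (\<lambda>x. frechet_derivative ?F (at x) (X p)) (at ?z) (Y p) =
      frechet_derivative (\<lambda>x. frechet_derivative ?F (at x) (Y p)) (at ?z) (X p)"
    using second_derivative_symmetric[OF S, of ?F] F by (auto simp: smooth_on_def)
  then show ?thesis
    using linear_diff[OF deriv_along_linear[OF U(1) f U(2)]]
    by (simp add: lie_bracket_def *[OF X] *[OF Y]) (simp add: deriv_along_def)
qed

end

section \<open>Orthonormal bases of an indefinite inner product\<close>

text \<open>Pairing a vanishing combination with \<open>e k\<close> kills its k-th coefficient,
  since \<open>b (e k) (e k)\<close> is nonzero; so these \<open>DIM('e)\<close> vectors are
  independent and span. Being a sign, \<open>b (e k) (e k)\<close> is its own inverse, hence it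
  appears as a factor and not as a divisor.\<close>

lemma orthonormal_expansion:
  fixes b :: "'e::euclidean_space \<Rightarrow> 'e \<Rightarrow> real" and e :: "nat \<Rightarrow> 'e"
  assumes b: "bilinear b"
    and orth: "\<And>j k. j < DIM('e) \<Longrightarrow> k < DIM('e) \<Longrightarrow> j \<noteq> k \<Longrightarrow> b (e j) (e k) = 0"
    and unit: "\<And>k. k < DIM('e) \<Longrightarrow> b (e k) (e k) \<in> {1, -1}"
  shows "v = (\<Sum>k<DIM('e). (b (e k) (e k) * b v (e k)) *\<^sub>R e k)"
proof -
  let ?N = "{..<DIM('e)}"
  have lin: "linear (\<lambda>v. b v w)" for w
    using b by (simp add: bilinear_def)
  have coeff: "b (\<Sum>j\<in>?N. c j *\<^sub>R e j) (e k) = c k * b (e k) (e k)" if "k < DIM('e)" for c k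
  proof -
    have "b (\<Sum>j\<in>?N. c j *\<^sub>R e j) (e k) = (\<Sum>j\<in>?N. c j * b (e j) (e k))"
      by (simp add: linear_sum[OF lin] linear_scale[OF lin])
    also have "\<dots> = (\<Sum>j\<in>?N. if j = k then c k * b (e k) (e k) else 0)"
      using orth that by (intro sum.cong) auto
    finally show ?thesis using that by simp
  qed
  have nz: "b (e k) (e k) \<noteq> 0" if "k < DIM('e)" for k
    using unit[OF that] by auto
  have inj: "inj_on e ?N"
  proof (rule inj_onI)
    fix j k assume "j \<in> ?N" "k \<in> ?N" "e j = e k"
    then show "j = k" using orth[of j k] nz[of k] by auto
  qed
  have ind: "independent (e ` ?N)"
  proof (rule independent_if_scalars_zero)
    fix f x assume 0: "(\<Sum>x\<in>e ` ?N. f x *\<^sub>R x) = 0" and "x \<in> e ` ?N"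
    then obtain k where k: "k < DIM('e)" "x = e k" by auto
    have "(\<Sum>j\<in>?N. f (e j) *\<^sub>R e j) = 0"
      using 0 by (simp add: sum.reindex[OF inj])
    then have "f (e k) * b (e k) (e k) = b 0 (e k)"
      using coeff[OF k(1), of "\<lambda>j. f (e j)"] by simp
    then show "f x = 0"
      using nz[OF k(1)] k linear_0[OF lin] by simp
  qed simp
  have "dim (UNIV :: 'e set) \<le> card (e ` ?N)"
    by (simp add: card_image[OF inj])
  then have span: "UNIV \<subseteq> span (e ` ?N)"
    using card_ge_dim_independent[OF subset_UNIV ind] by blast
  have "linear (\<lambda>v. \<Sum>k\<in>?N. (b (e k) (e k) * b v (e k)) *\<^sub>R e k)"
    using linear_add[OF lin] linear_scale[OF lin]
    by (intro linearI) (simp_all add: sum.distrib algebra_simps scaleR_sum_right)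
  moreover have "e j = (\<Sum>k\<in>?N. (b (e k) (e k) * b (e j) (e k)) *\<^sub>R e k)" if "j < DIM('e)" for j
  proof -
    have "(\<Sum>k\<in>?N. (b (e k) (e k) * b (e j) (e k)) *\<^sub>R e k) = (\<Sum>k\<in>?N. if k = j then e j else 0)"
      using orth unit that by (intro sum.cong) force+
    then show ?thesis using that by simp
  qed
  ultimately show ?thesis
    using linear_eq_on_span[OF linear_id, of _ "e ` ?N" v] span unfolding id_def by blast
qed

text \<open>Expand one argument of \<open>B\<close> in the basis \<open>e\<close>, exchange the
  sums, and collect the other argument by the expansion in \<open>E\<close>. This makes the Ricci
  tensor independent of the frame.\<close>

lemma orthonormal_trace:
  fixes b B :: "'e::euclidean_space \<Rightarrow> 'e \<Rightarrow> real" and e E :: "nat \<Rightarrow> 'e"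
  assumes b: "bilinear b" and sym: "\<And>v w. b v w = b w v" and B: "bilinear B"
    and e: "\<And>j k. j < DIM('e) \<Longrightarrow> k < DIM('e) \<Longrightarrow> j \<noteq> k \<Longrightarrow> b (e j) (e k) = 0"
      "\<And>k. k < DIM('e) \<Longrightarrow> b (e k) (e k) \<in> {1, -1}"
    and E: "\<And>j k. j < DIM('e) \<Longrightarrow> k < DIM('e) \<Longrightarrow> j \<noteq> k \<Longrightarrow> b (E j) (E k) = 0"
      "\<And>k. k < DIM('e) \<Longrightarrow> b (E k) (E k) \<in> {1, -1}"
  shows "(\<Sum>k<DIM('e). b (E k) (E k) * B (E k) (E k)) =
    (\<Sum>k<DIM('e). b (e k) (e k) * B (e k) (e k))"
proof -
  let ?N = "{..<DIM('e)}"
  have lin: "linear (\<lambda>v. B v w)" "linear (\<lambda>w. B v w)" for v w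
    using B by (simp_all add: bilinear_def)
  have s: "b (E k) (e j) = b (e j) (E k)" for j k by (rule sym)
  have "(\<Sum>k\<in>?N. b (E k) (E k) * B (E k) (E k)) =
      (\<Sum>k\<in>?N. b (E k) (E k) * B (E k) (\<Sum>j\<in>?N. (b (e j) (e j) * b (E k) (e j)) *\<^sub>R e j))"
    using orthonormal_expansion[OF b e] by simp
  also have "\<dots> = (\<Sum>k\<in>?N. \<Sum>j\<in>?N. b (e j) (e j) * (b (E k) (E k) * b (e j) (E k) * B (E k) (e j)))"
    by (simp add: linear_sum[OF lin(2)] linear_scale[OF lin(2)] sum_distrib_left s ac_simps)
  also have "\<dots> = (\<Sum>j\<in>?N. b (e j) (e j) * B (\<Sum>k\<in>?N. (b (E k) (E k) * b (e j) (E k)) *\<^sub>R E k) (e j))"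
    by (subst sum.swap) (simp add: linear_sum[OF lin(1)] linear_scale[OF lin(1)] sum_distrib_left)
  also have "\<dots> = (\<Sum>j\<in>?N. b (e j) (e j) * B (e j) (e j))"
    using orthonormal_expansion[OF b E] by simp
  finally show ?thesis .
qed


section \<open>Curvature of an affine connection is a tensor\<close>

locale affine_mfd = smooth_mfd M
  for M :: "('m::{t2_space, second_countable_topology}, 'e::euclidean_space) manifold" +
  fixes D :: "('m, 'e) connection"
  assumes affine: "affine_connection M D"
begin

lemmas affineD = affine[unfolded affine_connection_def, THEN spec, THEN spec, THEN mp, OF conjI]

lemma conn_smooth: "open_in_manifold M U \<Longrightarrow> smooth_vf_on M U X \<Longrightarrow> smooth_vf_on M U Y \<Longrightarrow>
    smooth_vf_on M U (\<lambda>q. D q (X q) Y)"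
  by (rule affineD[THEN conjunct2, THEN conjunct1, rule_format])

context
  fixes U p
  assumes U: "open_in_manifold M U" "p \<in> U"
begin

lemma conn_linear: "smooth_vf_on M U Y \<Longrightarrow> linear (\<lambda>v. D p v Y)"
  by (rule affineD[OF U(1), THEN conjunct1, rule_format, OF _ U(2)])

lemma conn_add: "smooth_vf_on M U Y \<Longrightarrow> smooth_vf_on M U Z \<Longrightarrow>
    D p v (\<lambda>q. Y q + Z q) = D p v Y + D p v Z"
  by (rule affineD[OF U(1), THEN conjunct2, THEN conjunct2, THEN conjunct1, rule_format, OF _ _ U(2)])

lemma conn_scaleR: "smooth_fun_on M U f \<Longrightarrow> smooth_vf_on M U Y \<Longrightarrow>
    D p v (\<lambda>q. f q *\<^sub>R Y q) = deriv_along M p v f *\<^sub>R Y p + f p *\<^sub>R D p v Y"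
  by (rule affineD[OF U(1), THEN conjunct2, THEN conjunct2, THEN conjunct2, rule_format, OF _ _ U(2)])

text \<open>Multiplied by the indicator of \<open>U\<close>, the two fields become equal as total
  functions. By the Leibniz rule this multiplication leaves the covariant derivative at
  \<open>p\<close> unchanged, since the indicator is 1 throughout \<open>U\<close>.\<close>

lemma conn_cong:
  assumes Y: "smooth_vf_on M U Y" "\<And>q. q \<in> U \<Longrightarrow> Y q = Z q"
  shows "D p v Y = D p v Z"
proof -
  have Z: "smooth_vf_on M U Z" using smooth_vf_on_cong[OF U(1) Y] .
  have "D p v W = D p v (\<lambda>q. indicator U q *\<^sub>R W q)" if "smooth_vf_on M U W" for W
    using conn_scaleR[OF smooth_fun_on_indicator[OF U(1)] that, of v]
      deriv_along_cong[OF U, of "indicator U" "\<lambda>q. 1"] U by (simp add: deriv_along_const)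
  moreover have "(\<lambda>q. indicator U q *\<^sub>R Y q) = (\<lambda>q. indicator U q *\<^sub>R Z q)"
  proof
    show "indicator U q *\<^sub>R Y q = indicator U q *\<^sub>R Z q" for q
      by (cases "q \<in> U") (simp_all add: Y(2))
  qed
  ultimately show ?thesis using Y(1) Z by metis
qed

end

context
  fixes U p
  assumes U: "open_in_manifold M U" "p \<in> U"
begin

text \<open>Carries the tensor rules from the first argument to the second, and makes the curvature
  of a one-dimensional fibre vanish.\<close>

lemma curvature_antisym:
  assumes "smooth_vf_on M U Z"
  shows "curvature M D Y X Z p = - curvature M D X Y Z p"
  using linear_neg[OF conn_linear[OF U assms]]
  by (simp add: curvature_def lie_bracket_antisym[of M Y X])

lemma curvature_cong:
  assumes X: "smooth_vf_on M U X" "\<And>q. q \<in> U \<Longrightarrow> X q = X' q"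
    and Y: "smooth_vf_on M U Y" "\<And>q. q \<in> U \<Longrightarrow> Y q = Y' q"
    and Z: "smooth_vf_on M U Z" "\<And>q. q \<in> U \<Longrightarrow> Z q = Z' q"
  shows "curvature M D X Y Z p = curvature M D X' Y' Z' p"
proof -
  have *: "D q (X q) Z = D q (X' q) Z'" "D q (Y q) Z = D q (Y' q) Z'" if "q \<in> U" for q
    using conn_cong[OF U(1) that Z] X(2) Y(2) that by auto
  have "D p v (\<lambda>q. D q (X q) Z) = D p v (\<lambda>q. D q (X' q) Z')" for v
    by (rule conn_cong[OF U conn_smooth[OF U(1) X(1) Z(1)]]) (use * in simp)
  moreover have "D p v (\<lambda>q. D q (Y q) Z) = D p v (\<lambda>q. D q (Y' q) Z')" for v
    by (rule conn_cong[OF U conn_smooth[OF U(1) Y(1) Z(1)]]) (use * in simp)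
  ultimately show ?thesis
    using lie_bracket_cong[OF U X(2) Y(2)] conn_cong[OF U Z] X(2)[OF U(2)] Y(2)[OF U(2)]
    by (simp add: curvature_def)
qed

lemma curvature_add_left:
  assumes X: "smooth_vf_on M U X" "smooth_vf_on M U X'"
    and Y: "smooth_vf_on M U Y" and Z: "smooth_vf_on M U Z"
  shows "curvature M D (\<lambda>q. X q + X' q) Y Z p = curvature M D X Y Z p + curvature M D X' Y Z p"
proof -
  have "D p v (\<lambda>q. D q (X q + X' q) Z) = D p v (\<lambda>q. D q (X q) Z + D q (X' q) Z)" for v
    by (rule conn_cong[OF U]) (use conn_linear[OF U(1) _ Z] linear_add
        conn_smooth[OF U(1) smooth_vf_on_add[OF U(1) X] Z] in auto)
  also have "\<dots> v = D p v (\<lambda>q. D q (X q) Z) + D p v (\<lambda>q. D q (X' q) Z)" for v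
    by (intro conn_add[OF U] conn_smooth[OF U(1)] X Z)
  finally show ?thesis
    using linear_add[OF conn_linear[OF U Z]] linear_add[OF conn_linear[OF U conn_smooth[OF U(1) Y Z]]]
    by (simp add: curvature_def lie_bracket_add_left[OF U X Y])
qed

text \<open>The derivative of \<open>f\<close> along \<open>Y\<close> arises twice, once from
  differentiating f times D_X Z along \<open>Y\<close> and once from the bracket of f X with
  \<open>Y\<close>; the two contributions have opposite signs.\<close>

lemma curvature_scaleR_left:
  assumes X: "smooth_vf_on M U X" and f: "smooth_fun_on M U f"
    and Y: "smooth_vf_on M U Y" and Z: "smooth_vf_on M U Z"
  shows "curvature M D (\<lambda>q. f q *\<^sub>R X q) Y Z p = f p *\<^sub>R curvature M D X Y Z p"
proof -
  note Zlin = conn_linear[OF U(1) _ Z]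
  have "D p v (\<lambda>q. D q (f q *\<^sub>R X q) Z) = D p v (\<lambda>q. f q *\<^sub>R D q (X q) Z)" for v
    by (rule conn_cong[OF U]) (use linear_scale[OF Zlin]
        conn_smooth[OF U(1) smooth_vf_on_scaleR[OF U(1) f X] Z] in auto)
  also have "\<dots> v = deriv_along M p v f *\<^sub>R D p (X p) Z + f p *\<^sub>R D p v (\<lambda>q. D q (X q) Z)" for v
    by (intro conn_scaleR[OF U] conn_smooth[OF U(1)] f X Z)
  finally show ?thesis
    by (simp add: curvature_def lie_bracket_scaleR_left[OF U X f Y] linear_scale[OF Zlin[OF U(2)]]
        linear_diff[OF Zlin[OF U(2)]] linear_scale[OF conn_linear[OF U conn_smooth[OF U(1) Y Z]]])
      (simp add: algebra_simps)
qed

lemma curvature_add_mid: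
  assumes X: "smooth_vf_on M U X" and Y: "smooth_vf_on M U Y" "smooth_vf_on M U Y'"
    and Z: "smooth_vf_on M U Z"
  shows "curvature M D X (\<lambda>q. Y q + Y' q) Z p = curvature M D X Y Z p + curvature M D X Y' Z p"
  using curvature_add_left[OF Y X Z] by (simp add: curvature_antisym[OF Z, of X])

lemma curvature_scaleR_mid:
  assumes X: "smooth_vf_on M U X" and Y: "smooth_vf_on M U Y" and f: "smooth_fun_on M U f"
    and Z: "smooth_vf_on M U Z"
  shows "curvature M D X (\<lambda>q. f q *\<^sub>R Y q) Z p = f p *\<^sub>R curvature M D X Y Z p"
  using curvature_scaleR_left[OF Y f X Z] by (simp add: curvature_antisym[OF Z, of X])

lemma curvature_add_right:
  assumes X: "smooth_vf_on M U X" and Y: "smooth_vf_on M U Y"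
    and Z: "smooth_vf_on M U Z" "smooth_vf_on M U Z'"
  shows "curvature M D X Y (\<lambda>q. Z q + Z' q) p = curvature M D X Y Z p + curvature M D X Y Z' p"
proof -
  have "D p v (\<lambda>q. D q (W q) (\<lambda>q. Z q + Z' q)) =
      D p v (\<lambda>q. D q (W q) Z) + D p v (\<lambda>q. D q (W q) Z')" if W: "smooth_vf_on M U W" for v W
  proof -
    have "D p v (\<lambda>q. D q (W q) (\<lambda>q. Z q + Z' q)) = D p v (\<lambda>q. D q (W q) Z + D q (W q) Z')"
      by (rule conn_cong[OF U]) (use conn_add[OF U(1) _ Z] 
          conn_smooth[OF U(1) W smooth_vf_on_add[OF U(1) Z]] in auto)
    also have "\<dots> = D p v (\<lambda>q. D q (W q) Z) + D p v (\<lambda>q. D q (W q) Z')"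
      by (intro conn_add[OF U] conn_smooth[OF U(1)] W Z)
    finally show ?thesis .
  qed
  from this[OF X] this[OF Y] show ?thesis
    by (simp add: curvature_def conn_add[OF U Z])
qed

text \<open>The products of a derivative of \<open>f\<close> with a derivative of \<open>Z\<close>
  cancel in pairs. What multiplies \<open>Z\<close> itself is X(Yf) - Y(Xf) - [X,Y]f, which vanishes
  by \<open>deriv_along_lie_bracket\<close>.\<close>

lemma curvature_scaleR_right:
  assumes X: "smooth_vf_on M U X" and Y: "smooth_vf_on M U Y"
    and Z: "smooth_vf_on M U Z" and f: "smooth_fun_on M U f"
  shows "curvature M D X Y (\<lambda>q. f q *\<^sub>R Z q) p = f p *\<^sub>R curvature M D X Y Z p"
proof -
  have "D p v (\<lambda>q. D q (W q) (\<lambda>q. f q *\<^sub>R Z q)) =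
      deriv_along M p v (\<lambda>q. deriv_along M q (W q) f) *\<^sub>R Z p + deriv_along M p (W p) f *\<^sub>R D p v Z +
      deriv_along M p v f *\<^sub>R D p (W p) Z + f p *\<^sub>R D p v (\<lambda>q. D q (W q) Z)"
    if W: "smooth_vf_on M U W" for v W
  proof -
    note df = smooth_fun_on_deriv_along[OF U(1) f W]
    have "D p v (\<lambda>q. D q (W q) (\<lambda>q. f q *\<^sub>R Z q)) =
        D p v (\<lambda>q. deriv_along M q (W q) f *\<^sub>R Z q + f q *\<^sub>R D q (W q) Z)"
      by (rule conn_cong[OF U]) (use conn_scaleR[OF U(1) _ f Z] 
          conn_smooth[OF U(1) W smooth_vf_on_scaleR[OF U(1) f Z]] in auto)
    also have "\<dots> = D p v (\<lambda>q. deriv_along M q (W q) f *\<^sub>R Z q) + D p v (\<lambda>q. f q *\<^sub>R D q (W q) Z)"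
      by (intro conn_add[OF U] smooth_vf_on_scaleR conn_smooth[OF U(1)] W Z df U f)
    also have "\<dots> = deriv_along M p v (\<lambda>q. deriv_along M q (W q) f) *\<^sub>R Z p + deriv_along M p (W p) f *\<^sub>R D p v Z +
      deriv_along M p v f *\<^sub>R D p (W p) Z + f p *\<^sub>R D p v (\<lambda>q. D q (W q) Z)"
      using conn_scaleR[OF U df Z] conn_scaleR[OF U f conn_smooth[OF U(1) W Z]] by simp
    finally show ?thesis .
  qed
  from this[OF X] this[OF Y] show ?thesis
    by (simp add: curvature_def conn_scaleR[OF U f Z] deriv_along_lie_bracket[OF U X f Y] algebra_simps)
qed

text \<open>Stated for an abstract \<open>K\<close> so that it serves each of the three arguments of
  the curvature: linearity over functions turns coefficient functions into their values at
  \<open>p\<close>.\<close>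

lemma tensorial_sum:
  fixes K :: "('m \<Rightarrow> 'e) \<Rightarrow> 'v::real_vector"
  assumes add: "\<And>X Y. smooth_vf_on M U X \<Longrightarrow> smooth_vf_on M U Y \<Longrightarrow> K (\<lambda>q. X q + Y q) = K X + K Y"
    and scale: "\<And>f X. smooth_fun_on M U f \<Longrightarrow> smooth_vf_on M U X \<Longrightarrow> K (\<lambda>q. f q *\<^sub>R X q) = f p *\<^sub>R K X"
    and "finite I" "\<And>i. i \<in> I \<Longrightarrow> smooth_fun_on M U (f i)" "\<And>i. i \<in> I \<Longrightarrow> smooth_vf_on M U (e i)"
  shows "K (\<lambda>q. \<Sum>i\<in>I. f i q *\<^sub>R e i q) = (\<Sum>i\<in>I. f i p *\<^sub>R K (e i))"
  using assms(3-5)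
proof (induction I rule: finite_induct)
  case empty
  show ?case
    using scale[OF smooth_fun_on_const[of _ 0] smooth_vf_on_zero[OF U(1)]] by simp
next
  case (insert i I)
  then show ?case
    by (simp add: add scale smooth_vf_on_sum smooth_vf_on_scaleR U)
qed

lemma curvature_frame_expansion:
  fixes e :: "nat \<Rightarrow> 'm \<Rightarrow> 'e"
  assumes e: "\<And>i. i < n \<Longrightarrow> smooth_vf_on M U (e i)"
    and x: "\<And>i. i < n \<Longrightarrow> smooth_fun_on M U (x i)" "\<And>q. q \<in> U \<Longrightarrow> X q = (\<Sum>i<n. x i q *\<^sub>R e i q)"
    and y: "\<And>i. i < n \<Longrightarrow> smooth_fun_on M U (y i)" "\<And>q. q \<in> U \<Longrightarrow> Y q = (\<Sum>i<n. y i q *\<^sub>R e i q)"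
    and z: "\<And>i. i < n \<Longrightarrow> smooth_fun_on M U (z i)" "\<And>q. q \<in> U \<Longrightarrow> Z q = (\<Sum>i<n. z i q *\<^sub>R e i q)"
  shows "curvature M D X Y Z p =
    (\<Sum>i<n. x i p *\<^sub>R (\<Sum>j<n. y j p *\<^sub>R (\<Sum>k<n. z k p *\<^sub>R curvature M D (e i) (e j) (e k) p)))"
proof -
  let ?s = "\<lambda>c q. \<Sum>i<n. c i q *\<^sub>R e i q"
  have s: "smooth_vf_on M U (?s c)" if "\<And>i. i < n \<Longrightarrow> smooth_fun_on M U (c i)" for c
    using e that by (auto intro!: smooth_vf_on_sum smooth_vf_on_scaleR U)
  have sX: "smooth_vf_on M U X" "smooth_vf_on M U Y" "smooth_vf_on M U Z"
    using smooth_vf_on_cong[OF U(1) s[OF x(1)]] smooth_vf_on_cong[OF U(1) s[OF y(1)]]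
      smooth_vf_on_cong[OF U(1) s[OF z(1)]] x y z by simp_all
  \<comment> \<open>The expansions hold on \<open>U\<close> only, so locality replaces the fields by
    the sums before anything is expanded.\<close>
  have "curvature M D X Y Z p = curvature M D (?s x) (?s y) (?s z) p"
    by (rule curvature_cong) (use sX x y z in auto)
  also have "\<dots> = (\<Sum>i<n. x i p *\<^sub>R curvature M D (e i) (?s y) (?s z) p)"
    by (rule tensorial_sum) (use e x s y z curvature_add_left curvature_scaleR_left in auto)
  also have "\<dots> = (\<Sum>i<n. x i p *\<^sub>R (\<Sum>j<n. y j p *\<^sub>R curvature M D (e i) (e j) (?s z) p))"
    by (intro sum.cong refl arg_cong2[of _ _ _ _ scaleR] tensorial_sum)
      (use e x s y z curvature_add_mid curvature_scaleR_mid in auto)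
  also have "\<dots> = (\<Sum>i<n. x i p *\<^sub>R (\<Sum>j<n. y j p *\<^sub>R (\<Sum>k<n. z k p *\<^sub>R curvature M D (e i) (e j) (e k) p)))"
    by (intro sum.cong refl arg_cong2[of _ _ _ _ scaleR] tensorial_sum)
      (use e x s y z curvature_add_right curvature_scaleR_right in auto)
  finally show ?thesis .
qed

end

end

section \<open>Frames and Ricci curvature\<close>

locale metric_mfd = smooth_mfd M
  for M :: "('m::{t2_space, second_countable_topology}, 'e::euclidean_space) manifold" +
  fixes g :: "('m, 'e) metric"
  assumes metric: "pseudo_riemannian_metric M g"
begin

lemma bilinear_metric: "p \<in> points M \<Longrightarrow> bilinear (g p)"
  and metric_sym: "p \<in> points M \<Longrightarrow> g p v w = g p w v"
  using metric by (auto simp: pseudo_riemannian_metric_def)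

lemma linear_metric: "p \<in> points M \<Longrightarrow> linear (\<lambda>v. g p v w)" "p \<in> points M \<Longrightarrow> linear (\<lambda>w. g p v w)"
  using bilinear_metric by (simp_all add: bilinear_def)

lemma smooth_metric:
  "open_in_manifold M U \<Longrightarrow> smooth_vf_on M U X \<Longrightarrow> smooth_vf_on M U Y \<Longrightarrow>
    smooth_fun_on M U (\<lambda>p. g p (X p) (Y p))"
  using metric unfolding pseudo_riemannian_metric_def by blast

lemma orthonormal_frame_subset:
  "orthonormal_frame M g U E \<Longrightarrow> V \<subseteq> U \<Longrightarrow> orthonormal_frame M g V E"
  unfolding orthonormal_frame_def using smooth_vf_on_subset by blast

lemma frame_expansion:
  assumes "open_in_manifold M U" "orthonormal_frame M g U e" "p \<in> U"
  shows "v = (\<Sum>k<DIM('e). (g p (e k p) (e k p) * g p v (e k p)) *\<^sub>R e k p)"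
  by (rule orthonormal_expansion[OF bilinear_metric])
    (use assms open_in_manifold_subset in \<open>auto simp: orthonormal_frame_def\<close>)

text \<open>Two frames are in play: \<open>E\<close> is the arbitrary frame that takes the trace,
  \<open>e\<close> the one in which everything is to be computed. Tensoriality expresses the
  curvature at \<open>p\<close> through its values on \<open>e\<close>; frame independence of the
  trace then replaces \<open>E\<close> by \<open>e\<close> in the summation.\<close>

lemma ricci_frame_expansion:
  assumes D: "affine_connection M D"
    and U: "open_in_manifold M U" "p \<in> U"
    and e: "orthonormal_frame M g U e" and E: "orthonormal_frame M g U E"
    and X: "smooth_vf_on M U X" and Y: "smooth_vf_on M U Y"
  defines "c \<equiv> \<lambda>v i. g p (e i p) (e i p) * g p v (e i p)"
  shows "ricci M g D E X Y p =
    (\<Sum>i<DIM('e). \<Sum>l<DIM('e). c (X p) i * c (Y p) l * ricci M g D e (e i) (e l) p)"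
proof -
  interpret affine_mfd M D by unfold_locales (rule D)
  let ?n = "DIM('e)"
  have p: "p \<in> points M" using U open_in_manifold_subset by blast
  note lin = linear_metric[OF p]
  have se: "smooth_vf_on M U (e i)" if "i < ?n" for i
    using e that by (auto simp: orthonormal_frame_def)
  have sE: "smooth_vf_on M U (E i)" if "i < ?n" for i
    using E that by (auto simp: orthonormal_frame_def)
  define C where "C Z i q = g q (e i q) (e i q) * g q (Z q) (e i q)" for Z i q
  have C: "smooth_fun_on M U (C Z i)" if "smooth_vf_on M U Z" "i < ?n" for Z i
    unfolding C_def by (intro smooth_fun_on_mult smooth_metric U that se)
  have ex: "Z q = (\<Sum>i<?n. C Z i q *\<^sub>R e i q)" if "q \<in> U" for Z q
    using frame_expansion[OF U(1) e that] by (simp add: C_def)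
  let ?R = "\<lambda>i j k. curvature M D (e i) (e j) (e k) p"
  \<comment> \<open>Curvature takes fields, but a trace needs a bilinear form on vectors.
    \<open>B\<close> extends the pairing of R(X,v)Y with \<open>w\<close> to arbitrary vectors
    \<open>v\<close> and \<open>w\<close> at \<open>p\<close> through the components of
    \<open>v\<close> in the frame \<open>e\<close>.\<close>
  define B where "B v w = (\<Sum>i<?n. \<Sum>j<?n. \<Sum>l<?n. c (X p) i * c v j * c (Y p) l * g p (?R i j l) w)" for v w
  have clin: "c (v + w) j = c v j + c w j" "c (r *\<^sub>R v) j = r * c v j" for v w r j
    using linear_add[OF lin(1)] linear_scale[OF lin(1)] by (auto simp: c_def algebra_simps)
  have "bilinear B"
    unfolding bilinear_def
    by (intro conjI allI linearI)
      (simp_all add: B_def clin linear_add[OF lin(2)] linear_scale[OF lin(2)] algebra_simps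
        sum.distrib sum_distrib_left)
  have CE: "C Z i p = c (Z p) i" for Z i
    by (simp add: C_def c_def)
  have RB: "g p (curvature M D X Z Y p) w = B (Z p) w" if Z: "smooth_vf_on M U Z" for Z w
  proof -
    have "curvature M D X Z Y p = (\<Sum>i<?n. c (X p) i *\<^sub>R (\<Sum>j<?n. c (Z p) j *\<^sub>R (\<Sum>k<?n. c (Y p) k *\<^sub>R ?R i j k)))"
      using curvature_frame_expansion[OF U se, where x = "C X" and y = "C Z" and z = "C Y"
          and X = X and Y = Z and Z = Y] C X Y Z ex by (simp add: CE)
    then show ?thesis
      by (simp add: B_def linear_sum[OF lin(1)] linear_scale[OF lin(1)] sum_distrib_left mult.assoc)
  qed
  have "ricci M g D E X Y p = (\<Sum>k<?n. g p (E k p) (E k p) * B (E k p) (E k p))"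
    using RB sE by (simp add: ricci_def)
  also have "\<dots> = (\<Sum>k<?n. g p (e k p) (e k p) * B (e k p) (e k p))"
    by (rule orthonormal_trace[OF bilinear_metric[OF p] metric_sym[OF p] \<open>bilinear B\<close>])
      (use e E U in \<open>auto simp: orthonormal_frame_def\<close>)
  also have "\<dots> = (\<Sum>k<?n. \<Sum>i<?n. \<Sum>l<?n. g p (e k p) (e k p) * (c (X p) i * c (Y p) l * g p (?R i k l) (e k p)))"
  proof (intro sum.cong refl)
    fix k assume k: "k \<in> {..<?n}"
    \<comment> \<open>Orthonormality, together with the square of a sign being 1, makes the
      components of a frame vector a Kronecker delta and collapses the sum over
      \<open>j\<close>.\<close>
    have ck: "c (e k p) j = (if j = k then 1 else 0)" if "j < ?n" for j
      using e U that k unfolding orthonormal_frame_def c_def by fastforce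
    have "(\<Sum>j<?n. c (X p) i * c (e k p) j * c (Y p) l * g p (?R i j l) (e k p)) =
        (\<Sum>j<?n. if j = k then c (X p) i * c (Y p) l * g p (?R i k l) (e k p) else 0)" for i l
      by (intro sum.cong) (auto simp: ck)
    then have "(\<Sum>j<?n. c (X p) i * c (e k p) j * c (Y p) l * g p (?R i j l) (e k p)) =
        c (X p) i * c (Y p) l * g p (?R i k l) (e k p)" for i l
      using k by simp
    moreover have "B (e k p) (e k p) =
        (\<Sum>i<?n. \<Sum>l<?n. \<Sum>j<?n. c (X p) i * c (e k p) j * c (Y p) l * g p (?R i j l) (e k p))"
      unfolding B_def by (intro sum.cong refl sum.swap)
    ultimately show "g p (e k p) (e k p) * B (e k p) (e k p) =
        (\<Sum>i<?n. \<Sum>l<?n. g p (e k p) (e k p) * (c (X p) i * c (Y p) l * g p (?R i k l) (e k p)))"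
      by (simp add: sum_distrib_left)
  qed
  also have "\<dots> = (\<Sum>i<?n. \<Sum>k<?n. \<Sum>l<?n. g p (e k p) (e k p) * (c (X p) i * c (Y p) l * g p (?R i k l) (e k p)))"
    by (rule sum.swap)
  also have "\<dots> = (\<Sum>i<?n. \<Sum>l<?n. \<Sum>k<?n. g p (e k p) (e k p) * (c (X p) i * c (Y p) l * g p (?R i k l) (e k p)))"
    by (intro sum.cong refl sum.swap)
  also have "\<dots> = (\<Sum>i<?n. \<Sum>l<?n. c (X p) i * c (Y p) l * ricci M g D e (e i) (e l) p)"
    by (simp add: ricci_def sum_distrib_left ac_simps)
  finally show ?thesis .
qed

lemma einsteinI_frames:
  assumes D: "affine_connection M D"
    and frames: "\<And>p. p \<in> points M \<Longrightarrow> \<exists>V e. open_in_manifold M V \<and> p \<in> V \<and> orthonormal_frame M g V e \<and>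
      (\<forall>i<DIM('e). \<forall>l<DIM('e). ricci M g D e (e i) (e l) p = a * g p (e i p) (e l p))"
  shows "einstein M g D a"
  unfolding einstein_def
proof safe
  fix U E X Y p
  assume U: "open_in_manifold M U" "p \<in> U" and E: "orthonormal_frame M g U E"
    and XY: "smooth_vf_on M U X" "smooth_vf_on M U Y"
  have p: "p \<in> points M" using U open_in_manifold_subset by blast
  obtain V e where V: "open_in_manifold M V" "p \<in> V" and e: "orthonormal_frame M g V e"
    and ric: "\<And>i l. i < DIM('e) \<Longrightarrow> l < DIM('e) \<Longrightarrow> ricci M g D e (e i) (e l) p = a * g p (e i p) (e l p)"
    using frames[OF p] by blast
  note lin = linear_metric[OF p]
  let ?c = "\<lambda>v i. g p (e i p) (e i p) * g p v (e i p)"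
  \<comment> \<open>The test frame lives on \<open>U\<close> and the chosen frame on
    \<open>V\<close>; since both statements are local, they are compared on the
    intersection.\<close>
  have UV: "open_in_manifold M (U \<inter> V)" "p \<in> U \<inter> V" using U V by auto
  have "ricci M g D E X Y p =
      (\<Sum>i<DIM('e). \<Sum>l<DIM('e). ?c (X p) i * ?c (Y p) l * ricci M g D e (e i) (e l) p)"
    by (rule ricci_frame_expansion[OF D UV]) (use e E XY orthonormal_frame_subset smooth_vf_on_subset in blast)+
  also have "\<dots> = a * g p (\<Sum>i<DIM('e). ?c (X p) i *\<^sub>R e i p) (\<Sum>l<DIM('e). ?c (Y p) l *\<^sub>R e l p)"
    by (subst sum.swap) (simp add: ric linear_sum[OF lin(1)] linear_scale[OF lin(1)] linear_sum[OF lin(2)]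
        linear_scale[OF lin(2)] sum_distrib_left ac_simps)
  also have "\<dots> = a * g p (X p) (Y p)"
    using frame_expansion[OF V(1) e V(2)] by metis
  finally show "ricci M g D E X Y p = a * g p (X p) (Y p)" .
qed

lemma einsteinD_frame:
  assumes "einstein M g D a" "open_in_manifold M V" "orthonormal_frame M g V e" "p \<in> V"
    "i < DIM('e)" "l < DIM('e)"
  shows "ricci M g D e (e i) (e l) p = a * g p (e i p) (e l p)"
  using assms unfolding einstein_def orthonormal_frame_def by blast

text \<open>The two added terms are linear over functions in the direction and in the differentiated
  field, so the Leibniz rule of \<open>D\<close> passes to the sum without extra terms.\<close>

lemma affine_quarter_symmetric_connection:
  assumes D: "affine_connection M D" and P: "\<And>U. open_in_manifold M U \<Longrightarrow> smooth_vf_on M U P"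
  shows "affine_connection M (quarter_symmetric_connection g D P l1 l2)"
proof -
  interpret affine_mfd M D by unfold_locales (rule D)
  let ?D = "quarter_symmetric_connection g D P l1 l2"
  show ?thesis
    unfolding affine_connection_def
  proof (intro allI impI conjI ballI)
    fix U Y assume "open_in_manifold M U \<and> smooth_vf_on M U Y"
    then have U: "open_in_manifold M U" and Y: "smooth_vf_on M U Y" by auto
    {
      fix p assume p: "p \<in> U"
      then have "p \<in> points M" using U open_in_manifold_subset by blast
      note lin = linear_metric[OF this]
      show "linear (\<lambda>v. ?D p v Y)"
        using linear_add[OF conn_linear[OF U p Y]] linear_scale[OF conn_linear[OF U p Y]]
          linear_add[OF lin(1)] linear_scale[OF lin(1)]
        by (intro linearI) (simp_all add: quarter_symmetric_connection_def algebra_simps)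
      fix v
      show "?D p v (\<lambda>q. Y q + Z q) = ?D p v Y + ?D p v Z" if "smooth_vf_on M U Z" for Z
        using conn_add[OF U p Y that] linear_add[OF lin(1)] linear_add[OF lin(2)]
        by (simp add: quarter_symmetric_connection_def algebra_simps)
      show "?D p v (\<lambda>q. f q *\<^sub>R Y q) = deriv_along M p v f *\<^sub>R Y p + f p *\<^sub>R ?D p v Y"
        if "smooth_fun_on M U f" for f
        using conn_scaleR[OF U p that Y] linear_scale[OF lin(1)] linear_scale[OF lin(2)]
        by (simp add: quarter_symmetric_connection_def algebra_simps)
    }
    fix X assume X: "smooth_vf_on M U X"
    have DX: "smooth_vf_on M U (\<lambda>p. D p (X p) Y)"
      by (rule conn_smooth[OF U X Y])
    have "smooth_vf_on M U (\<lambda>p. (D p (X p) Y + (l1 * g p (Y p) (P p)) *\<^sub>R X p) +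
        (- l2 * g p (X p) (Y p)) *\<^sub>R P p)"
      by (intro smooth_vf_on_add smooth_vf_on_scaleR smooth_fun_on_mult smooth_fun_on_const
          smooth_metric U X Y P DX)
    then show "smooth_vf_on M U (\<lambda>p. ?D p (X p) Y)"
      by (simp add: quarter_symmetric_connection_def)
  qed
qed

text \<open>Koszul's formula; the metric coefficients of an orthonormal frame have no derivatives.\<close>

lemma levi_civita_orthonormal_frame:
  assumes D: "levi_civita_connection M g D"
    and U: "open_in_manifold M U" "p \<in> U"
    and e: "\<And>i. i < DIM('e) \<Longrightarrow> smooth_vf_on M U (e i)"
    and on: "\<And>q i j. q \<in> U \<Longrightarrow> i < DIM('e) \<Longrightarrow> j < DIM('e) \<Longrightarrow>
      g q (e i q) (e j q) = (if i = j then s i else 0)"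
    and ij: "i < DIM('e)" "j < DIM('e)" "k < DIM('e)"
  defines "c \<equiv> \<lambda>i j k. g p (lie_bracket M (e i) (e j) p) (e k p)"
  shows "2 * g p (D p (e i p) (e j)) (e k p) = c i j k + c k i j - c j k i"
proof -
  have p: "p \<in> points M" using U open_in_manifold_subset by blast
  note lin = linear_metric[OF p]
  define G where "G i j k = g p (D p (e i p) (e j)) (e k p)" for i j k
  have skew: "G i j k + G i k j = 0" if "i < DIM('e)" "j < DIM('e)" "k < DIM('e)" for i j k
  proof -
    have "deriv_along M p (e i p) (\<lambda>q. g q (e j q) (e k q)) = 0"
      using deriv_along_cong[OF U, of "\<lambda>q. g q (e j q) (e k q)"
          "\<lambda>q. if j = k then s j else 0" "e i p"] on that
      by (simp add: deriv_along_const del: if_cancel)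
    moreover have "deriv_along M p (e i p) (\<lambda>q. g q (e j q) (e k q)) =
        g p (D p (e i p) (e j)) (e k p) + g p (e j p) (D p (e i p) (e k))"
      using D[unfolded levi_civita_connection_def, THEN conjunct2, THEN conjunct2,
          rule_format, OF conjI[OF U(1) conjI[OF e e]] U(2)] that by blast
    ultimately show ?thesis
      using metric_sym[OF p, of "e j p"] by (simp add: G_def)
  qed
  have tor: "G i j k - G j i k = c i j k" if "i < DIM('e)" "j < DIM('e)" for i j k
  proof -
    have "D p (e i p) (e j) - D p (e j p) (e i) = lie_bracket M (e i) (e j) p"
      using D[unfolded levi_civita_connection_def, THEN conjunct2, THEN conjunct1,
          rule_format, OF conjI[OF U(1) conjI[OF e e]] U(2)] that by blast
    then show ?thesis
      using linear_diff[OF lin(1)] by (metis G_def c_def)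
  qed
  show ?thesis
    using tor[OF ij(1,2), of k] tor[OF ij(3,1), of j] tor[OF ij(2,3), of i]
      skew[OF ij] skew[OF ij(2,1,3)] skew[OF ij(3,1,2)]
    unfolding G_def by linarith
qed

end

section \<open>Product manifolds and intervals\<close>

lemma frechet_derivative_map_prod:
  assumes f: "(f has_derivative frechet_derivative f (at x)) (at x)"
    and g: "(g has_derivative frechet_derivative g (at y)) (at y)"
  shows "frechet_derivative (map_prod f g) (at (x, y)) =
    map_prod (frechet_derivative f (at x)) (frechet_derivative g (at y))"
proof (rule frechet_derivative_at[symmetric])
  have "((\<lambda>z. f (fst z)) has_derivative (\<lambda>v. frechet_derivative f (at x) (fst v))) (at (x, y))"
    by (rule has_derivative_compose[OF has_derivative_fst[OF has_derivative_ident]]) (simp add: f)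
  moreover have "((\<lambda>z. g (snd z)) has_derivative (\<lambda>v. frechet_derivative g (at y) (snd v))) (at (x, y))"
    by (rule has_derivative_compose[OF has_derivative_snd[OF has_derivative_ident]]) (simp add: g)
  ultimately show "(map_prod f g has_derivative
      map_prod (frechet_derivative f (at x)) (frechet_derivative g (at y))) (at (x, y))"
    unfolding map_prod_def case_prod_beta' by (rule has_derivative_Pair)
qed

locale prod_mfd = M: smooth_mfd M + N: smooth_mfd N
  for M :: "('m::{t2_space, second_countable_topology}, 'e::euclidean_space) manifold"
    and N :: "('n::{t2_space, second_countable_topology}, 'f::euclidean_space) manifold"
begin

abbreviation "MN \<equiv> prod_manifold M N"

lemma prod_sel:
  "points MN = points M \<times> points N"
  "chart_dom MN (p, q) = chart_dom M p \<times> chart_dom N q"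
  "chart MN (p, q) = map_prod (chart M p) (chart N q)"
  by (simp_all add: prod_manifold_def)

lemma map_prod_image: "map_prod f g ` (A \<times> B) = f ` A \<times> g ` B"
  by force

text \<open>\<open>inv_into\<close> is unspecified off the image, so the componentwise formula is
  claimed for \<open>z\<close> and \<open>w\<close> in the chart images, where injectivity
  determines the inverse.\<close>

lemma inv_chart_prod:
  assumes "p \<in> points M" "q \<in> points N" "z \<in> chart M p ` chart_dom M p" "w \<in> chart N q ` chart_dom N q"
  shows "inv_chart MN (p, q) (z, w) = (inv_chart M p z, inv_chart N q w)"
proof -
  have inj: "inj_on (chart M p) (chart_dom M p)" "inj_on (chart N q) (chart_dom N q)"
    using M.inv_chart_chart[OF assms(1)] N.inv_chart_chart[OF assms(2)] by (metis inj_on_inverseI)+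
  have "inj_on (chart MN (p, q)) (chart_dom MN (p, q))"
    unfolding prod_sel by (rule map_prod_inj_on[OF inj])
  moreover obtain r s where rs: "r \<in> chart_dom M p" "z = chart M p r" "s \<in> chart_dom N q" "w = chart N q s"
    using assms by auto
  ultimately show ?thesis
    using assms by (auto simp: inv_chart_def prod_sel inj intro!: inv_into_f_eq)
qed

lemma smooth_manifold_prod: "smooth_manifold MN"
  unfolding smooth_manifold_def
proof (intro conjI ballI)
  show "points MN \<noteq> {}"
    using M.smooth_manifold N.smooth_manifold by (simp add: prod_sel smooth_manifold_def)
next
  fix pq assume "pq \<in> points MN"
  then obtain p q where pq: "pq = (p, q)" "p \<in> points M" "q \<in> points N"
    by (auto simp: prod_sel)
  show "pq \<in> chart_dom MN pq" "chart_dom MN pq \<subseteq> points MN"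
    using pq M.in_chart_dom N.in_chart_dom M.chart_dom_subset N.chart_dom_subset
    by (auto simp: prod_sel)
  show "open_in_manifold MN (chart_dom MN pq)"
    using pq M.open_chart_dom N.open_chart_dom by (simp add: prod_sel openin_Times)
  show "open (chart MN pq ` chart_dom MN pq)"
    using pq M.open_chart_image_dom N.open_chart_image_dom
    by (simp add: prod_sel map_prod_image open_Times)
  note hM = M.chart_homeomorphism[OF pq(2)] and hN = N.chart_homeomorphism[OF pq(3)]
  have "homeomorphism (chart_dom M p \<times> chart_dom N q) (chart M p ` chart_dom M p \<times> chart N q ` chart_dom N q)
      (\<lambda>z. (chart M p (fst z), chart N q (snd z))) (\<lambda>z. (inv_chart M p (fst z), inv_chart N q (snd z)))"
  proof (rule homeomorphismI)
    show "continuous_on (chart_dom M p \<times> chart_dom N q) (\<lambda>z. (chart M p (fst z), chart N q (snd z)))"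
      by (intro continuous_on_Pair continuous_on_compose2[OF homeomorphism_cont1[OF hM]]
          continuous_on_compose2[OF homeomorphism_cont1[OF hN]] continuous_on_fst continuous_on_snd
          continuous_on_id) auto
    show "continuous_on (chart M p ` chart_dom M p \<times> chart N q ` chart_dom N q)
        (\<lambda>z. (inv_chart M p (fst z), inv_chart N q (snd z)))"
      by (intro continuous_on_Pair continuous_on_compose2[OF homeomorphism_cont2[OF hM]]
          continuous_on_compose2[OF homeomorphism_cont2[OF hN]] continuous_on_fst continuous_on_snd
          continuous_on_id) auto
  qed (use pq in auto)
  then show "homeomorphism (chart_dom MN pq) (chart MN pq ` chart_dom MN pq) (chart MN pq) (inv_chart MN pq)"
    by (rule homeomorphism_cong) (use pq in \<open>auto simp: prod_sel map_prod_image inv_chart_prod\<close>)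
  fix pq' assume "pq' \<in> points MN"
  then obtain p' q' where pq': "pq' = (p', q')" "p' \<in> points M" "q' \<in> points N"
    by (auto simp: prod_sel)
  let ?A = "chart M p ` (chart_dom M p \<inter> chart_dom M p')"
  let ?B = "chart N q ` (chart_dom N q \<inter> chart_dom N q')"
  have im: "chart MN pq ` (chart_dom MN pq \<inter> chart_dom MN pq') = ?A \<times> ?B"
    using pq pq' by (simp add: prod_sel map_prod_image Times_Int_Times)
  have A: "open ?A" using M.open_chart_image[OF pq(2) M.open_chart_dom[OF pq'(2)]] .
  have B: "open ?B" using N.open_chart_image[OF pq(3) N.open_chart_dom[OF pq'(3)]] .
  note AB = open_Times[OF A B]
  have "smooth_on (?A \<times> ?B) (\<lambda>z. (M.trans p p' (fst z), N.trans q q' (snd z)))"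
    by (intro smooth_on_Pair AB smooth_on_compose[OF M.smooth_trans[OF pq(2) pq'(2)] _ AB A]
        smooth_on_compose[OF N.smooth_trans[OF pq(3) pq'(3)] _ AB B] smooth_on_fst smooth_on_snd
        smooth_on_ident) auto
  then show "smooth_on (chart MN pq ` (chart_dom MN pq \<inter> chart_dom MN pq')) (chart MN pq' \<circ> inv_chart MN pq)"
    unfolding im by (rule smooth_on_cong[OF _ AB]) (use pq pq' in \<open>auto simp: prod_sel inv_chart_prod\<close>)
qed

sublocale smooth_mfd MN
  by unfold_locales (rule smooth_manifold_prod)

lemma dtrans_prod:
  assumes "p \<in> points M" "q \<in> points N" "r \<in> chart_dom M p" "s \<in> chart_dom N q"
  shows "frechet_derivative (trans (r, s) (p, q)) (at (chart MN (r, s) (r, s))) =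
    map_prod (frechet_derivative (M.trans r p) (at (chart M r r)))
      (frechet_derivative (N.trans s q) (at (chart N s s)))"
proof -
  have rs: "r \<in> points M" "s \<in> points N"
    using assms M.chart_dom_subset N.chart_dom_subset by auto
  let ?A = "chart M r ` chart_dom M r" and ?B = "chart N s ` chart_dom N s"
  have "frechet_derivative (trans (r, s) (p, q)) (at (chart M r r, chart N s s)) =
      frechet_derivative (map_prod (M.trans r p) (N.trans s q)) (at (chart M r r, chart N s s))"
    by (rule frechet_derivative_cong_open[OF
          open_Times[OF M.open_chart_image_dom[OF rs(1)] N.open_chart_image_dom[OF rs(2)]]])
      (use rs M.in_chart_dom N.in_chart_dom in \<open>auto simp: inv_chart_prod prod_sel\<close>)
  also have "\<dots> = map_prod (frechet_derivative (M.trans r p) (at (chart M r r)))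
      (frechet_derivative (N.trans s q) (at (chart N s s)))"
    by (intro frechet_derivative_map_prod M.trans_has_derivative N.trans_has_derivative assms rs
        M.in_chart_dom N.in_chart_dom)
  finally show ?thesis by (simp add: prod_sel)
qed

end

lemma smooth_manifold_interval:
  assumes "a < b"
  shows "smooth_manifold (interval_manifold a b)"
proof -
  have inv: "inv_into (einterval a b) (\<lambda>t. t) x = x" if "x \<in> einterval a b" for x
    using that by (simp add: inv_into_f_eq)
  have "homeomorphism (einterval a b) (einterval a b) (\<lambda>t. t) (inv_into (einterval a b) (\<lambda>t. t))"
    by (rule homeomorphism_cong[OF homeomorphism_ident]) (auto simp: inv)
  moreover have "smooth_on (einterval a b) (inv_into (einterval a b) (\<lambda>t. t))"
    by (rule smooth_on_cong[OF smooth_on_ident]) (auto simp: inv)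
  ultimately show ?thesis
    using einterval_nonempty[OF assms]
    by (auto simp: smooth_manifold_def interval_manifold_def inv_chart_def o_def)
qed

section \<open>One-dimensional Riemannian manifolds\<close>

locale fibre = smooth_mfd F
  for F :: "('m::{t2_space, second_countable_topology}, real) manifold" +
  fixes g :: "('m, real) metric"
  assumes riemannian: "riemannian_metric F g"
begin

sublocale metric_mfd F g
  using riemannian by unfold_locales (simp add: riemannian_metric_def)

text \<open>The classical coefficient g_11 in the chart around \<open>x\<close>. The number
  \<open>c\<close> is the coordinate vector of that chart at \<open>y\<close>, rewritten in the
  chart that belongs to \<open>y\<close>.\<close>

definition metric_coeff :: "'m \<Rightarrow> real \<Rightarrow> real" where
  "metric_coeff x z = (let y = inv_chart F x z;
     c = frechet_derivative (trans x y) (at z) 1 in g y c c)"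

context
  fixes x assumes x: "x \<in> points F"
begin

text \<open>In dimension one every vector at \<open>y\<close> is a multiple of the coordinate vector
  \<open>?c 1\<close>, with factor \<open>?d v\<close>; bilinearity pulls both factors out.\<close>

lemma metric_eq_coeff:
  assumes y: "y \<in> chart_dom F x"
  shows "g y v w = metric_coeff x (chart F x y) *
    (frechet_derivative (trans y x) (at (chart F y y)) v * frechet_derivative (trans y x) (at (chart F y y)) w)"
proof -
  have yF: "y \<in> points F" using x y chart_dom_subset by blast
  let ?d = "frechet_derivative (trans y x) (at (chart F y y))"
  let ?c = "frechet_derivative (trans x y) (at (chart F x y))"
  have "v = ?d v * ?c 1" for v
  proof -
    have "v = ?c (?d v)"
      using x y yF by (simp add: dtrans_compose in_chart_dom dtrans_self)
    also have "\<dots> = ?d v * ?c 1"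
      using linear_scale[OF linear_dtrans[OF x yF y in_chart_dom[OF yF]], of "?d v" 1] by simp
    finally show ?thesis .
  qed
  then have "g y v w = g y (?d v * ?c 1) (?d w * ?c 1)" by metis
  also have "\<dots> = ?d v * (?d w * g y (?c 1) (?c 1))"
    using linear_scale[OF linear_metric(1)[OF yF], of "?d v" "?c 1"]
      linear_scale[OF linear_metric(2)[OF yF], of _ "?d w" "?c 1"] by simp
  finally show ?thesis
    using x y by (simp add: metric_coeff_def Let_def)
qed

text \<open>Smoothness of a metric is only available through smooth fields, so it is applied to the
  coordinate field \<open>?c\<close>, whose coordinates in this chart are constantly 1. That
  constant also shows that the field vanishes nowhere, whence positivity.\<close>

lemma smooth_metric_coeff: "smooth_on (chart F x ` chart_dom F x) (metric_coeff x)"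
  and metric_coeff_pos: "y \<in> chart_dom F x \<Longrightarrow> metric_coeff x (chart F x y) > 0"
proof -
  let ?c = "\<lambda>y. frechet_derivative (trans x y) (at (chart F x y)) 1"
  have c: "vf_coords F x ?c (chart F x y) = 1" if y: "y \<in> chart_dom F x" for y
  proof -
    have yF: "y \<in> points F" using x y chart_dom_subset by blast
    then show ?thesis
      using x y by (simp add: vf_coords_chart dtrans_compose in_chart_dom dtrans_self)
  qed
  have "smooth_on (chart F x ` chart_dom F x) (vf_coords F x ?c)"
    by (rule smooth_on_cong[OF smooth_on_const[of _ 1] open_chart_image_dom[OF x]]) (use c in auto)
  then have "smooth_vf_on F (chart_dom F x) ?c"
    using smooth_vf_onI_chart[OF x open_chart_dom[OF x]] by blast
  then have "smooth_fun_on F (chart_dom F x) (\<lambda>y. g y (?c y) (?c y))"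
    using smooth_metric[OF open_chart_dom[OF x]] by blast
  then have "smooth_on (chart F x ` (chart_dom F x \<inter> chart_dom F x)) ((\<lambda>y. g y (?c y) (?c y)) \<circ> inv_chart F x)"
    unfolding smooth_fun_on_def using x by blast
  then have "smooth_on (chart F x ` chart_dom F x) ((\<lambda>y. g y (?c y) (?c y)) \<circ> inv_chart F x)"
    by simp
  then show "smooth_on (chart F x ` chart_dom F x) (metric_coeff x)"
    by (rule smooth_on_cong[OF _ open_chart_image_dom[OF x]]) (use x in \<open>auto simp: metric_coeff_def Let_def\<close>)
  assume y: "y \<in> chart_dom F x"
  then have yF: "y \<in> points F" using x chart_dom_subset by blast
  have "?c y \<noteq> 0"
    using c[OF y] linear_0[OF linear_dtrans[OF yF x in_chart_dom[OF yF] y]]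
    by (auto simp: vf_coords_chart[OF x y])
  then show "metric_coeff x (chart F x y) > 0"
    using riemannian yF x y by (simp add: metric_coeff_def Let_def riemannian_metric_def)
qed

text \<open>The coordinate field of the chart around \<open>x\<close> divided by its length, the
  square root of \<open>metric_coeff\<close>.\<close>

definition unit_field :: "'m \<Rightarrow> real" where
  "unit_field y = frechet_derivative (trans x y) (at (chart F x y)) (metric_coeff x (chart F x y) powr (-1/2))"

lemma vf_coords_unit_field:
  "y \<in> chart_dom F x \<Longrightarrow> vf_coords F x unit_field (chart F x y) = metric_coeff x (chart F x y) powr (-1/2)"
  using x chart_dom_subset[OF x]
  by (simp add: unit_field_def vf_coords_chart dtrans_compose in_chart_dom dtrans_self)

lemma smooth_unit_field: "smooth_vf_on F (chart_dom F x) unit_field"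
proof (rule smooth_vf_onI_chart[OF x open_chart_dom[OF x] subset_refl])
  show "smooth_on (chart F x ` chart_dom F x) (vf_coords F x unit_field)"
    by (rule smooth_on_cong[OF smooth_on_powr[OF open_chart_image_dom[OF x] smooth_metric_coeff]
          open_chart_image_dom[OF x]]) (use vf_coords_unit_field metric_coeff_pos in auto)
qed

lemma unit_field_unit:
  assumes y: "y \<in> chart_dom F x"
  shows "g y (unit_field y) (unit_field y) = 1"
proof -
  let ?G = "metric_coeff x (chart F x y)"
  have "g y (unit_field y) (unit_field y) = ?G * (?G powr (-1/2) * ?G powr (-1/2))"
    using metric_eq_coeff[OF y] vf_coords_unit_field[OF y] x y by (simp add: vf_coords_chart)
  also have "\<dots> = 1"
    using metric_coeff_pos[OF y] powr_add[of ?G "-1/2" "-1/2"] by (simp add: powr_minus_divide)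
  finally show ?thesis .
qed

end

text \<open>One unit field \<open>?u\<close> is a whole frame, so the Ricci tensor has only a
  component built from R(u,u), which vanishes by antisymmetry, while g(u,u) = 1.\<close>

lemma einstein_constant_zero:
  assumes D: "affine_connection F D" and E: "einstein F g D a"
  shows "a = 0"
proof -
  interpret affine_mfd F D by unfold_locales (rule D)
  obtain x where x: "x \<in> points F" using smooth_manifold by (auto simp: smooth_manifold_def)
  let ?u = "unit_field x"
  note u = smooth_unit_field[OF x]
  have "orthonormal_frame F g (chart_dom F x) (\<lambda>k. ?u)"
    using u unit_field_unit[OF x] by (simp add: orthonormal_frame_def)
  note ric = einsteinD_frame[OF E open_chart_dom[OF x] this in_chart_dom[OF x], of 0 0]
  have "curvature F D ?u ?u ?u x = 0"
    using curvature_antisym[OF open_chart_dom[OF x] in_chart_dom[OF x] u, of ?u ?u] by simp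
  then have "ricci F g D (\<lambda>k. ?u) ?u ?u x = 0"
    using linear_0[OF linear_metric(1)[OF x]] by (simp add: ricci_def)
  then show "a = 0"
    using ric unit_field_unit[OF x in_chart_dom[OF x]] by simp
qed

end

section \<open>The Kasner space-time and its adapted frame\<close>

lemma less_4_cases: "(i::nat) < 4 \<longleftrightarrow> i = 0 \<or> i = 1 \<or> i = 2 \<or> i = 3"
  by auto

locale kasner = F1: fibre F1 g1 + F2: fibre F2 g2 + F3: fibre F3 g3
  for F1 :: "('a::{t2_space, second_countable_topology}, real) manifold"
    and F2 :: "('b::{t2_space, second_countable_topology}, real) manifold"
    and F3 :: "('c::{t2_space, second_countable_topology}, real) manifold"
    and g1 g2 g3 +
  fixes t1 t2 :: ereal and \<phi> :: "real \<Rightarrow> real" and p1 p2 p3 :: real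
  assumes t12: "t1 < t2"
    and smooth_phi: "smooth_on (einterval t1 t2) \<phi>"
    and phi_pos: "t \<in> einterval t1 t2 \<Longrightarrow> \<phi> t > 0"
begin

abbreviation "J \<equiv> einterval t1 t2"
abbreviation "K \<equiv> kasner_manifold t1 t2 F1 F2 F3"
abbreviation "gK \<equiv> kasner_metric \<phi> p1 p2 p3 g1 g2 g3"

sublocale I: smooth_mfd "interval_manifold t1 t2"
  by unfold_locales (rule smooth_manifold_interval[OF t12])

sublocale F23: prod_mfd F2 F3 ..
sublocale F123: prod_mfd F1 "prod_manifold F2 F3" ..
sublocale K: prod_mfd "interval_manifold t1 t2" "prod_manifold F1 (prod_manifold F2 F3)" ..

sublocale smooth_mfd K
  unfolding kasner_manifold_def by unfold_locales (rule K.smooth_manifold_prod)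

lemma points_K: "points K = J \<times> points F1 \<times> points F2 \<times> points F3"
  by (simp add: kasner_manifold_def prod_manifold_def interval_manifold_def)

lemma chart_dom_K: "chart_dom K (t, x1, x2, x3) = J \<times> chart_dom F1 x1 \<times> chart_dom F2 x2 \<times> chart_dom F3 x3"
  by (simp add: kasner_manifold_def prod_manifold_def interval_manifold_def)

lemma chart_K: "chart K (t, x1, x2, x3) (s, y1, y2, y3) = (s, chart F1 x1 y1, chart F2 x2 y2, chart F3 x3 y3)"
  by (simp add: kasner_manifold_def prod_manifold_def interval_manifold_def)

lemma dtrans_interval:
  assumes "s \<in> J"
  shows "frechet_derivative (I.trans s t) (at (chart (interval_manifold t1 t2) s s)) v = v"
proof -
  have "I.trans s t = I.trans s s" by (simp add: interval_manifold_def)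
  then show ?thesis
    using I.dtrans_self[of s s v] assms by (simp add: interval_manifold_def)
qed

lemma vf_coords_K:
  assumes p: "(t, x1, x2, x3) \<in> points K" and q: "(s, y1, y2, y3) \<in> chart_dom K (t, x1, x2, x3)"
    and X: "X (s, y1, y2, y3) = (a, v1, v2, v3)"
  shows "vf_coords K (t, x1, x2, x3) X (chart K (t, x1, x2, x3) (s, y1, y2, y3)) =
    (a, frechet_derivative (F1.trans y1 x1) (at (chart F1 y1 y1)) v1,
        frechet_derivative (F2.trans y2 x2) (at (chart F2 y2 y2)) v2,
        frechet_derivative (F3.trans y3 x3) (at (chart F3 y3 y3)) v3)"
proof -
  have pq: "t \<in> J" "x1 \<in> points F1" "x2 \<in> points F2" "x3 \<in> points F3"
    "s \<in> J" "y1 \<in> chart_dom F1 x1" "y2 \<in> chart_dom F2 x2" "y3 \<in> chart_dom F3 x3"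
    using p q by (auto simp: points_K chart_dom_K)
  have pq': "t \<in> points (interval_manifold t1 t2)" "s \<in> chart_dom (interval_manifold t1 t2) t"
    using pq by (simp_all add: interval_manifold_def)
  have "vf_coords K (t, x1, x2, x3) X (chart K (t, x1, x2, x3) (s, y1, y2, y3)) =
      frechet_derivative (trans (s, y1, y2, y3) (t, x1, x2, x3))
        (at (chart K (s, y1, y2, y3) (s, y1, y2, y3))) (a, v1, v2, v3)"
    using vf_coords_chart[OF p q] X by simp
  also have "\<dots> = (a, frechet_derivative (F1.trans y1 x1) (at (chart F1 y1 y1)) v1,
        frechet_derivative (F2.trans y2 x2) (at (chart F2 y2 y2)) v2,
        frechet_derivative (F3.trans y3 x3) (at (chart F3 y3 y3)) v3)"
    using pq pq' unfolding kasner_manifold_def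
    by (subst K.dtrans_prod F123.dtrans_prod F23.dtrans_prod |
        simp add: F123.prod_sel F23.prod_sel dtrans_interval)+
  finally show ?thesis .
qed

lemma inv_chart_K:
  assumes p: "(t, x1, x2, x3) \<in> points K" and q: "(s, y1, y2, y3) \<in> chart_dom K (t, x1, x2, x3)"
  shows "inv_chart K (t, x1, x2, x3) (s, chart F1 x1 y1, chart F2 x2 y2, chart F3 x3 y3) = (s, y1, y2, y3)"
  using inv_chart_chart[OF p q] by (simp add: chart_K)

section \<open>Functions of the time coordinate and the time field\<close>

lemma smooth_on_fun_of_time:
  assumes "smooth_on J f" "open S" "\<And>z. z \<in> S \<Longrightarrow> fst z \<in> J"
  shows "smooth_on S (\<lambda>z. f (fst z))"
  by (rule smooth_on_compose[OF assms(1) _ assms(2)]) (auto intro!: smooth assms)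

lemma chart_image_time:
  assumes "p \<in> points K" "z \<in> chart K p ` (chart_dom K p \<inter> U)"
  shows "fst z \<in> J" "fst (inv_chart K p z) = fst z"
  using assms by (cases p; auto simp: points_K chart_dom_K chart_K inv_chart_K)+

lemma smooth_fun_on_time:
  assumes f: "smooth_on J f" and U: "open_in_manifold K U"
  shows "smooth_fun_on K U (\<lambda>q. f (fst q))"
  unfolding smooth_fun_on_def
proof
  fix p assume p: "p \<in> points K"
  note S = open_chart_image[OF p U]
  show "smooth_on (chart K p ` (chart_dom K p \<inter> U)) ((\<lambda>q. f (fst q)) \<circ> inv_chart K p)"
    by (rule smooth_on_cong[OF smooth_on_fun_of_time[OF f S] S])
      (use chart_image_time[OF p] in auto)
qed

lemma deriv_along_time:
  assumes f: "smooth_on J f" and q: "q \<in> points K"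
  shows "deriv_along K q v (\<lambda>q. f (fst q)) = frechet_derivative f (at (fst q)) 1 * fst v"
proof -
  have t: "fst q \<in> J" using q by (auto simp: points_K)
  have ct: "fst (chart K q q) = fst q" by (cases q) (simp add: chart_K)
  have "frechet_derivative ((\<lambda>q. f (fst q)) \<circ> inv_chart K q) (at (chart K q q)) =
      frechet_derivative (\<lambda>z. f (fst z)) (at (chart K q q))"
  proof (rule frechet_derivative_cong_open[OF open_chart_image[OF q open_chart_dom[OF q]]])
    show "((\<lambda>q. f (fst q)) \<circ> inv_chart K q) z = f (fst z)"
      if "z \<in> chart K q ` (chart_dom K q \<inter> chart_dom K q)" for z
      using chart_image_time(2)[OF q that] by simp
  qed (use q in_chart_dom in auto)
  also have "\<dots> = (\<lambda>v. frechet_derivative f (at (fst q)) (fst v))"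
    by (rule frechet_derivative_at[symmetric],
        rule has_derivative_compose[OF has_derivative_fst[OF has_derivative_ident]])
      (use smooth_on_imp_has_derivative[OF f t] ct in simp)
  finally have "deriv_along K q v (\<lambda>q. f (fst q)) = frechet_derivative f (at (fst q)) (fst v)"
    by (simp add: deriv_along_def)
  then show ?thesis
    using linear_scale[OF linear_frechet_derivative[OF smooth_on_imp_differentiable[OF f t]],
        of "fst v" 1] by simp
qed

lemma smooth_vf_on_kasner_dt:
  assumes U: "open_in_manifold K U"
  shows "smooth_vf_on K U kasner_dt"
  unfolding smooth_vf_on_def
proof
  fix p assume p: "p \<in> points K"
  note S = open_chart_image[OF p U]
  obtain t x1 x2 x3 where px: "p = (t, x1, x2, x3)" by (cases p)
  have "vf_coords K p kasner_dt (chart K p q) = (1, 0, 0, 0)" if q: "q \<in> chart_dom K p" for q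
  proof -
    obtain s y1 y2 y3 where qy: "q = (s, y1, y2, y3)" by (cases q)
    have "x1 \<in> points F1" "x2 \<in> points F2" "x3 \<in> points F3"
      "y1 \<in> chart_dom F1 x1" "y2 \<in> chart_dom F2 x2" "y3 \<in> chart_dom F3 x3"
      using p q by (auto simp: px qy points_K chart_dom_K)
    then show ?thesis
      using vf_coords_K[OF p[unfolded px] q[unfolded px qy], of kasner_dt 1 0 0 0]
        linear_0[OF F1.linear_dtrans, of y1 x1 y1] linear_0[OF F2.linear_dtrans, of y2 x2 y2]
        linear_0[OF F3.linear_dtrans, of y3 x3 y3] F1.chart_dom_subset F2.chart_dom_subset
        F3.chart_dom_subset F1.in_chart_dom F2.in_chart_dom F3.in_chart_dom
      by (simp add: px qy kasner_dt_def)
  qed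
  then show "smooth_on (chart K p ` (chart_dom K p \<inter> U)) (vf_coords K p kasner_dt)"
    by (intro smooth_on_cong[OF smooth_on_const[of _ "(1, 0, 0, 0)"] S]) auto
qed

section \<open>The Kasner metric is pseudo-Riemannian\<close>

lemma bilinear_gK:
  assumes "q \<in> points K"
  shows "bilinear (gK q)"
proof -
  obtain s y1 y2 y3 where q: "q = (s, y1, y2, y3)" by (cases q)
  have y: "y1 \<in> points F1" "y2 \<in> points F2" "y3 \<in> points F3"
    using assms by (auto simp: q points_K)
  note add = linear_add[OF F1.linear_metric(1)[OF y(1)]] linear_add[OF F1.linear_metric(2)[OF y(1)]]
    linear_add[OF F2.linear_metric(1)[OF y(2)]] linear_add[OF F2.linear_metric(2)[OF y(2)]]
    linear_add[OF F3.linear_metric(1)[OF y(3)]] linear_add[OF F3.linear_metric(2)[OF y(3)]]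
  note scale = linear_scale[OF F1.linear_metric(1)[OF y(1)]] linear_scale[OF F1.linear_metric(2)[OF y(1)]]
    linear_scale[OF F2.linear_metric(1)[OF y(2)]] linear_scale[OF F2.linear_metric(2)[OF y(2)]]
    linear_scale[OF F3.linear_metric(1)[OF y(3)]] linear_scale[OF F3.linear_metric(2)[OF y(3)]]
  show ?thesis
    unfolding bilinear_def q
    by (intro conjI allI linearI)
      (auto simp: kasner_metric_def add scale[simplified] algebra_simps split: prod.splits)
qed

lemma pseudo_riemannian_gK: "pseudo_riemannian_metric K gK"
  unfolding pseudo_riemannian_metric_def
proof (intro conjI ballI allI impI)
  fix q assume qK: "q \<in> points K"
  obtain s y1 y2 y3 where q: "q = (s, y1, y2, y3)" by (cases q)
  have y: "s \<in> J" "y1 \<in> points F1" "y2 \<in> points F2" "y3 \<in> points F3"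
    using qK by (auto simp: q points_K)
  show "bilinear (gK q)" using bilinear_gK[OF qK] .
  show "gK q v w = gK q w v" for v w
    using y F1.metric_sym[of y1] F2.metric_sym[of y2] F3.metric_sym[of y3]
    by (auto simp: q kasner_metric_def split: prod.splits)
  fix v assume 0: "\<forall>w. gK q v w = 0"
  obtain a v1 v2 v3 where v: "v = (a, v1, v2, v3)" by (cases v)
  \<comment> \<open>Reversing the time component of the test vector turns the Lorentzian form into a
    sum of nonnegative terms, each of which must vanish.\<close>
  have "gK q v (- a, v1, v2, v3) = 0" using 0 by blast
  then have sum: "a * a + \<phi> s powr (2 * p1) * g1 y1 v1 v1 + \<phi> s powr (2 * p2) * g2 y2 v2 v2 +
      \<phi> s powr (2 * p3) * g3 y3 v3 v3 = 0"
    by (simp add: q v kasner_metric_def)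
  have pos: "\<phi> s powr c > 0" for c using phi_pos[OF y(1)] by simp
  have g: "g1 y1 v1 v1 \<ge> 0" "g2 y2 v2 v2 \<ge> 0" "g3 y3 v3 v3 \<ge> 0"
    "v1 \<noteq> 0 \<Longrightarrow> g1 y1 v1 v1 > 0" "v2 \<noteq> 0 \<Longrightarrow> g2 y2 v2 v2 > 0" "v3 \<noteq> 0 \<Longrightarrow> g3 y3 v3 v3 > 0"
    using y F1.riemannian F2.riemannian F3.riemannian linear_0[OF F1.linear_metric(1)[OF y(2)]]
      linear_0[OF F2.linear_metric(1)[OF y(3)]] linear_0[OF F3.linear_metric(1)[OF y(4)]]
    unfolding riemannian_metric_def by (metis order_less_imp_le order_refl)+
  have nn: "a * a \<ge> 0" "\<phi> s powr (2 * p1) * g1 y1 v1 v1 \<ge> 0" "\<phi> s powr (2 * p2) * g2 y2 v2 v2 \<ge> 0"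
    "\<phi> s powr (2 * p3) * g3 y3 v3 v3 \<ge> 0"
    using g pos by (auto intro!: mult_nonneg_nonneg)
  have "a * a = 0" "\<phi> s powr (2 * p1) * g1 y1 v1 v1 = 0" "\<phi> s powr (2 * p2) * g2 y2 v2 v2 = 0"
    "\<phi> s powr (2 * p3) * g3 y3 v3 v3 = 0"
    using sum nn by linarith+
  then have "a = 0" "g1 y1 v1 v1 = 0" "g2 y2 v2 v2 = 0" "g3 y3 v3 v3 = 0"
    using pos[of "2 * p1"] pos[of "2 * p2"] pos[of "2 * p3"] by auto
  then show "v = 0"
    using g by (auto simp: v zero_prod_def)
next
  fix U X Y
  assume "open_in_manifold K U \<and> smooth_vf_on K U X \<and> smooth_vf_on K U Y"
  then have U: "open_in_manifold K U" and X: "smooth_vf_on K U X" and Y: "smooth_vf_on K U Y" by auto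
  show "smooth_fun_on K U (\<lambda>p. gK p (X p) (Y p))"
    unfolding smooth_fun_on_def
  proof
    fix p assume p: "p \<in> points K"
    let ?S = "chart K p ` (chart_dom K p \<inter> U)"
    note S = open_chart_image[OF p U]
    obtain t x1 x2 x3 where px: "p = (t, x1, x2, x3)" by (cases p)
    have x: "x1 \<in> points F1" "x2 \<in> points F2" "x3 \<in> points F3"
      using p by (auto simp: px points_K)
    define x y where "x z = vf_coords K p X z" and "y z = vf_coords K p Y z" for z
    have sx: "smooth_on ?S x" and sy: "smooth_on ?S y"
      using X Y p by (simp_all add: smooth_vf_on_def x_def[abs_def] y_def[abs_def])
    have ph: "smooth_on ?S (\<lambda>z. \<phi> (fst z) powr c)" for c
      by (rule smooth_on_powr[OF S smooth_on_fun_of_time[OF smooth_phi S]])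
        (use chart_image_time[OF p] phi_pos in auto)
    have pr: "smooth_on ?S (\<lambda>z. fst (snd z))" "smooth_on ?S (\<lambda>z. fst (snd (snd z)))"
      "smooth_on ?S (\<lambda>z. snd (snd (snd z)))"
      by (intro smooth S)+
    have G1: "smooth_on ?S (\<lambda>z. F1.metric_coeff x1 (fst (snd z)))"
      by (rule smooth_on_compose[OF F1.smooth_metric_coeff[OF x(1)] pr(1) S F1.open_chart_image_dom[OF x(1)]])
        (auto simp: px chart_dom_K chart_K)
    have G2: "smooth_on ?S (\<lambda>z. F2.metric_coeff x2 (fst (snd (snd z))))"
      by (rule smooth_on_compose[OF F2.smooth_metric_coeff[OF x(2)] pr(2) S F2.open_chart_image_dom[OF x(2)]])
        (auto simp: px chart_dom_K chart_K)
    have G3: "smooth_on ?S (\<lambda>z. F3.metric_coeff x3 (snd (snd (snd z))))"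
      by (rule smooth_on_compose[OF F3.smooth_metric_coeff[OF x(3)] pr(3) S F3.open_chart_image_dom[OF x(3)]])
        (auto simp: px chart_dom_K chart_K)
    \<comment> \<open>The metric in the chart around \<open>p\<close>: fields enter through their
      chart coordinates \<open>x\<close> and \<open>y\<close>, fibre metrics through their
      coefficients, so each factor is a smooth function of \<open>z\<close>.\<close>
    have "smooth_on ?S (\<lambda>z. - (fst (x z) * fst (y z)) +
        \<phi> (fst z) powr (2 * p1) * (F1.metric_coeff x1 (fst (snd z)) * (fst (snd (x z)) * fst (snd (y z)))) +
        \<phi> (fst z) powr (2 * p2) * (F2.metric_coeff x2 (fst (snd (snd z))) * (fst (snd (snd (x z))) * fst (snd (snd (y z))))) +
        \<phi> (fst z) powr (2 * p3) * (F3.metric_coeff x3 (snd (snd (snd z))) * (snd (snd (snd (x z))) * snd (snd (snd (y z))))))"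
      by (intro smooth_on_add smooth_on_minus smooth_on_mult smooth_on_fst smooth_on_snd S ph G1 G2 G3 sx sy)
    then show "smooth_on ?S ((\<lambda>p. gK p (X p) (Y p)) \<circ> inv_chart K p)"
    proof (rule smooth_on_cong[OF _ S])
      fix z assume "z \<in> ?S"
      then obtain q where q: "q \<in> chart_dom K p" "z = chart K p q" by blast
      obtain s y1 y2 y3 where qy: "q = (s, y1, y2, y3)" by (cases q)
      obtain a v1 v2 v3 where Xv: "X q = (a, v1, v2, v3)" by (cases "X q")
      obtain b w1 w2 w3 where Yw: "Y q = (b, w1, w2, w3)" by (cases "Y q")
      have "y1 \<in> chart_dom F1 x1" "y2 \<in> chart_dom F2 x2" "y3 \<in> chart_dom F3 x3"
        using q by (auto simp: px qy chart_dom_K)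
      note G = F1.metric_eq_coeff[OF \<open>x1 \<in> points F1\<close> this(1), of v1 w1]
        F2.metric_eq_coeff[OF \<open>x2 \<in> points F2\<close> this(2), of v2 w2]
        F3.metric_eq_coeff[OF \<open>x3 \<in> points F3\<close> this(3), of v3 w3]
      note c = vf_coords_K[where X = X, OF p[unfolded px] q(1)[unfolded px qy] Xv[unfolded qy]]
        vf_coords_K[where X = Y, OF p[unfolded px] q(1)[unfolded px qy] Yw[unfolded qy]]
      show "- (fst (x z) * fst (y z)) +
        \<phi> (fst z) powr (2 * p1) * (F1.metric_coeff x1 (fst (snd z)) * (fst (snd (x z)) * fst (snd (y z)))) +
        \<phi> (fst z) powr (2 * p2) * (F2.metric_coeff x2 (fst (snd (snd z))) * (fst (snd (snd (x z))) * fst (snd (snd (y z))))) +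
        \<phi> (fst z) powr (2 * p3) * (F3.metric_coeff x3 (snd (snd (snd z))) * (snd (snd (snd (x z))) * snd (snd (snd (y z)))))
        = ((\<lambda>p. gK p (X p) (Y p)) \<circ> inv_chart K p) z"
        using p q(1) Xv Yw unfolding q(2) o_def x_def y_def
        by (simp add: inv_chart_chart px qy c) (simp add: chart_K kasner_metric_def G)
    qed
  qed
qed

sublocale metric_mfd K gK
  by unfold_locales (rule pseudo_riemannian_gK)

text \<open>
  Index \<open>0\<close> is the time direction. Giving it the warping exponent \<open>0\<close> makes the frame below uniform:
  its \<open>i\<close>-th field is \<open>\<phi> powr (- pexp i)\<close> times a unit field of the \<open>i\<close>-th factor.
\<close>

definition pexp :: "nat \<Rightarrow> real" where
  "pexp i = (if i = 1 then p1 else if i = 2 then p2 else if i = 3 then p3 else 0)"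

definition bvec :: "nat \<Rightarrow> real \<times> real \<times> real \<times> real" where
  "bvec i = (if i = 1 then (0, 1, 0, 0) else if i = 2 then (0, 0, 1, 0)
     else if i = 3 then (0, 0, 0, 1) else (1, 0, 0, 0))"

lemma bvec_inner: "i < 4 \<Longrightarrow> j < 4 \<Longrightarrow> bvec i \<bullet> bvec j = (if i = j then 1 else 0)"
  by (auto simp: less_4_cases bvec_def inner_prod_def)

lemma inner_bvec_0: "z \<bullet> bvec 0 = fst z"
  by (cases z) (simp add: bvec_def inner_prod_def)

definition hubble :: "real \<Rightarrow> real" where
  "hubble t = frechet_derivative \<phi> (at t) 1 / \<phi> t"

lemma smooth_hubble: "smooth_on J hubble"
proof -
  have "smooth_on J (\<lambda>t. frechet_derivative \<phi> (at t) 1 * \<phi> t powr (-1))"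
    by (intro smooth_on_mult smooth_on_frechet_derivative smooth_on_powr smooth_phi phi_pos) auto
  then show ?thesis
    by (rule smooth_on_cong) (auto simp: hubble_def powr_minus_divide dest: phi_pos)
qed

lemma phi_has_derivative:
  assumes "t \<in> J"
  shows "(\<phi> has_real_derivative hubble t * \<phi> t) (at t)"
proof -
  have "(\<phi> has_derivative frechet_derivative \<phi> (at t)) (at t)"
    using smooth_on_imp_has_derivative[OF smooth_phi assms] .
  moreover have "frechet_derivative \<phi> (at t) = (*) (hubble t * \<phi> t)"
  proof
    show "frechet_derivative \<phi> (at t) v = hubble t * \<phi> t * v" for v
      using linear_scale[OF linear_frechet_derivative[OF smooth_on_imp_differentiable[OF smooth_phi assms]], of v 1]
        phi_pos[OF assms] by (simp add: hubble_def)
  qed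
  ultimately show ?thesis by (simp add: has_field_derivative_def)
qed

lemma open_in_K_box:
  assumes "x1 \<in> points F1" "x2 \<in> points F2" "x3 \<in> points F3"
  shows "open_in_manifold K (J \<times> chart_dom F1 x1 \<times> chart_dom F2 x2 \<times> chart_dom F3 x3)"
proof -
  obtain t where "t \<in> J" using einterval_nonempty[OF t12] by blast
  then show ?thesis
    using open_chart_dom[of "(t, x1, x2, x3)"] assms by (simp add: points_K chart_dom_K)
qed

section \<open>The adapted frame and its brackets\<close>

context
  fixes x1 x2 x3
  assumes x: "x1 \<in> points F1" "x2 \<in> points F2" "x3 \<in> points F3"
begin

definition box :: "(real \<times> 'a \<times> 'b \<times> 'c) set" where
  "box = J \<times> chart_dom F1 x1 \<times> chart_dom F2 x2 \<times> chart_dom F3 x3"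

definition fcoef :: "nat \<Rightarrow> real \<times> 'a \<times> 'b \<times> 'c \<Rightarrow> real" where
  "fcoef i q = (if i = 1 then F1.unit_field x1 (fst (snd q))
     else if i = 2 then F2.unit_field x2 (fst (snd (snd q)))
     else if i = 3 then F3.unit_field x3 (snd (snd (snd q))) else 1)"

definition frame :: "nat \<Rightarrow> real \<times> 'a \<times> 'b \<times> 'c \<Rightarrow> real \<times> real \<times> real \<times> real" where
  "frame i q = (\<phi> (fst q) powr (- pexp i) * fcoef i q) *\<^sub>R bvec i"

text \<open>\<open>fcoef\<close> reads the unit field in the chart of each point separately. This is
  the same field in the single chart around \<open>p\<close>, as a function of one real coordinate,
  and so can be differentiated.\<close>

definition ccoef :: "real \<times> 'a \<times> 'b \<times> 'c \<Rightarrow> nat \<Rightarrow> real \<Rightarrow> real" where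
  "ccoef p i = (if i = 1 then vf_coords F1 (fst (snd p)) (F1.unit_field x1)
     else if i = 2 then vf_coords F2 (fst (snd (snd p))) (F2.unit_field x2)
     else if i = 3 then vf_coords F3 (snd (snd (snd p))) (F3.unit_field x3) else (\<lambda>_. 1))"

lemma open_box: "open_in_manifold K box"
  unfolding box_def by (rule open_in_K_box[OF x])

lemma box_points: "q \<in> box \<Longrightarrow> q \<in> points K"
  using open_box open_in_manifold_subset by blast

lemma box_time: "q \<in> box \<Longrightarrow> fst q \<in> J"
  by (auto simp: box_def)

lemma frame_0: "q \<in> box \<Longrightarrow> frame 0 q = (1, 0, 0, 0)"
  using phi_pos[OF box_time, of q] by (simp add: frame_def pexp_def fcoef_def bvec_def)

lemma vf_coords_frame:
  assumes p: "p \<in> points K" and q: "q \<in> chart_dom K p" "q \<in> box" and i: "i < 4"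
  shows "vf_coords K p (frame i) (chart K p q) =
    (\<phi> (chart K p q \<bullet> bvec 0) powr (- pexp i) * ccoef p i (chart K p q \<bullet> bvec i)) *\<^sub>R bvec i"
proof -
  obtain t z1 z2 z3 where pz: "p = (t, z1, z2, z3)" by (cases p)
  obtain s y1 y2 y3 where qy: "q = (s, y1, y2, y3)" by (cases q)
  have z: "z1 \<in> points F1" "z2 \<in> points F2" "z3 \<in> points F3"
    "y1 \<in> chart_dom F1 z1" "y2 \<in> chart_dom F2 z2" "y3 \<in> chart_dom F3 z3"
    using p q by (auto simp: pz qy points_K chart_dom_K)
  then have y: "y1 \<in> points F1" "y2 \<in> points F2" "y3 \<in> points F3"
    using F1.chart_dom_subset F2.chart_dom_subset F3.chart_dom_subset by blast+
  note lin = F1.linear_dtrans[OF y(1) z(1) F1.in_chart_dom[OF y(1)] z(4)]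
    F2.linear_dtrans[OF y(2) z(2) F2.in_chart_dom[OF y(2)] z(5)]
    F3.linear_dtrans[OF y(3) z(3) F3.in_chart_dom[OF y(3)] z(6)]
  note lin0 = linear_0[OF lin(1)] linear_0[OF lin(2)] linear_0[OF lin(3)]
  note lins = linear_scale[OF lin(1), simplified] linear_scale[OF lin(2), simplified]
    linear_scale[OF lin(3), simplified]
  note c = vf_coords_K[OF p[unfolded pz] q(1)[unfolded pz qy], of "frame i"]
  have "\<phi> s > 0" using q(2) phi_pos by (auto simp: qy box_def)
  then show ?thesis
    using i F1.vf_coords_chart[OF z(1,4)] F2.vf_coords_chart[OF z(2,5)] F3.vf_coords_chart[OF z(3,6)]
    unfolding less_4_cases pz qy
    by (elim disjE) (subst c, simp add: frame_def bvec_def,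
        simp add: chart_K bvec_def ccoef_def fcoef_def inner_prod_def lin0 lins pexp_def)+
qed

text \<open>The relevant coordinate runs through the image of an overlap of two fibre charts, that
  of \<open>p\<close> and that of the box, where the unit field is smooth. For the time index the
  coefficient is constant.\<close>

lemma smooth_ccoef:
  assumes p: "p \<in> points K" and i: "i < 4"
  obtains T where "open T" "smooth_on T (ccoef p i)"
    "\<And>z. z \<in> chart K p ` (chart_dom K p \<inter> box) \<Longrightarrow> z \<bullet> bvec i \<in> T"
proof -
  obtain t z1 z2 z3 where pz: "p = (t, z1, z2, z3)" by (cases p)
  have z: "z1 \<in> points F1" "z2 \<in> points F2" "z3 \<in> points F3"
    using p by (auto simp: pz points_K)
  consider "i = 0" | "i = 1" | "i = 2" | "i = 3" using i by (auto simp: less_4_cases)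
  then show ?thesis
  proof cases
    case 1
    then show ?thesis
      by (intro that[of UNIV]) (auto simp: ccoef_def smooth_on_const)
  next
    case 2
    then show ?thesis
      using F1.smooth_unit_field[OF x(1)] z(1)
      by (intro that[of "chart F1 z1 ` (chart_dom F1 z1 \<inter> chart_dom F1 x1)"]
          F1.open_chart_image F1.open_chart_dom x)
        (auto simp: ccoef_def smooth_vf_on_def pz bvec_def chart_K inner_prod_def box_def chart_dom_K)
  next
    case 3
    then show ?thesis
      using F2.smooth_unit_field[OF x(2)] z(2)
      by (intro that[of "chart F2 z2 ` (chart_dom F2 z2 \<inter> chart_dom F2 x2)"]
          F2.open_chart_image F2.open_chart_dom x)
        (auto simp: ccoef_def smooth_vf_on_def pz bvec_def chart_K inner_prod_def box_def chart_dom_K)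
  next
    case 4
    then show ?thesis
      using F3.smooth_unit_field[OF x(3)] z(3)
      by (intro that[of "chart F3 z3 ` (chart_dom F3 z3 \<inter> chart_dom F3 x3)"]
          F3.open_chart_image F3.open_chart_dom x)
        (auto simp: ccoef_def smooth_vf_on_def pz bvec_def chart_K inner_prod_def box_def chart_dom_K)
  qed
qed

lemma smooth_frame:
  assumes i: "i < 4"
  shows "smooth_vf_on K box (frame i)"
  unfolding smooth_vf_on_def
proof
  fix p assume p: "p \<in> points K"
  let ?S = "chart K p ` (chart_dom K p \<inter> box)"
  note S = open_chart_image[OF p open_box]
  obtain T where T: "open T" "smooth_on T (ccoef p i)" "\<And>z. z \<in> ?S \<Longrightarrow> z \<bullet> bvec i \<in> T"
    using smooth_ccoef[OF p i] by blast
  have "smooth_on ?S (\<lambda>z. (\<phi> (z \<bullet> bvec 0) powr (- pexp i) * ccoef p i (z \<bullet> bvec i)) *\<^sub>R bvec i)"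
    unfolding inner_bvec_0
    by (intro smooth_on_scaleR smooth_on_mult smooth_on_powr smooth_on_fun_of_time[OF smooth_phi]
        smooth_on_compose[OF T(2)] smooth S T) (use chart_image_time[OF p] phi_pos in auto)
  then show "smooth_on ?S (vf_coords K p (frame i))"
    by (rule smooth_on_cong[OF _ S]) (use vf_coords_frame[OF p _ _ i] in auto)
qed

text \<open>Apart from time, the i-th field depends only on its own coordinate. The number
  \<open>a\<close> collects the derivative along that fibre and may stay unspecified: in a bracket
  it is multiplied by \<open>frame j q \<bullet> bvec i\<close>, which is 0 for distinct
  indices.\<close>

lemma vf_coords_frame_derivative:
  assumes q: "q \<in> box" and i: "i < 4"
  obtains a where "\<And>v. frechet_derivative (vf_coords K q (frame i)) (at (chart K q q)) v =
    (a * (v \<bullet> bvec i)) *\<^sub>R bvec i - (fst v * pexp i * hubble (fst q)) *\<^sub>R frame i q"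
proof -
  have qK: "q \<in> points K" using box_points[OF q] .
  let ?z = "chart K q q"
  let ?S = "chart K q ` (chart_dom K q \<inter> box)"
  have S: "open ?S" "?z \<in> ?S" using open_chart_image[OF qK open_box] q in_chart_dom[OF qK] by auto
  have z0: "fst ?z = fst q" by (cases q) (simp add: chart_K)
  have t: "fst q \<in> J" using box_time[OF q] .
  obtain T where T: "open T" "smooth_on T (ccoef q i)" "\<And>z. z \<in> ?S \<Longrightarrow> z \<bullet> bvec i \<in> T"
    using smooth_ccoef[OF qK i] by blast
  let ?c = "ccoef q i" and ?w = "?z \<bullet> bvec i" and ?f = "\<lambda>t. \<phi> t powr (- pexp i)"
  have dc: "(?c has_derivative frechet_derivative ?c (at ?w)) (at ?w)"
    using smooth_on_imp_has_derivative[OF T(2) T(3)[OF S(2)]] .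
  have cw: "?c ?w = fcoef i q"
    using i qK F1.vf_coords_self F2.vf_coords_self F3.vf_coords_self
    by (cases q) (auto simp: less_4_cases ccoef_def fcoef_def bvec_def chart_K inner_prod_def points_K)
  define A where "A = frechet_derivative ?c (at ?w) 1"
  have dp: "((\<lambda>z. ?f (fst z)) has_derivative (\<lambda>v. - pexp i * hubble (fst q) * ?f (fst q) * fst v)) (at ?z)"
  proof -
    have "(?f has_real_derivative - pexp i * hubble (fst q) * ?f (fst q)) (at (fst ?z))"
      unfolding z0 using phi_pos[OF t]
      by (auto intro!: derivative_eq_intros phi_has_derivative[OF t] simp: powr_diff)
    then have "(?f has_derivative (\<lambda>r. - pexp i * hubble (fst q) * ?f (fst q) * r)) (at (fst ?z))"
      unfolding has_field_derivative_def .
    from has_derivative_compose[OF has_derivative_fst[OF has_derivative_ident] this]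
    show ?thesis .
  qed
  have "((\<lambda>z. (?f (fst z) * ?c (z \<bullet> bvec i)) *\<^sub>R bvec i) has_derivative
      (\<lambda>v. (?f (fst ?z) * frechet_derivative ?c (at ?w) (v \<bullet> bvec i) +
        (- pexp i * hubble (fst q) * ?f (fst q) * fst v) * ?c ?w) *\<^sub>R bvec i)) (at ?z)"
    by (intro has_derivative_scaleR_left has_derivative_mult dp
        has_derivative_compose[OF has_derivative_inner_left[OF has_derivative_ident] dc])
  then have "frechet_derivative (\<lambda>z. (?f (fst z) * ?c (z \<bullet> bvec i)) *\<^sub>R bvec i) (at ?z) =
      (\<lambda>v. (?f (fst ?z) * frechet_derivative ?c (at ?w) (v \<bullet> bvec i) +
        (- pexp i * hubble (fst q) * ?f (fst q) * fst v) * ?c ?w) *\<^sub>R bvec i)"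
    by (rule frechet_derivative_at[symmetric])
  moreover have "frechet_derivative (vf_coords K q (frame i)) (at ?z) =
      frechet_derivative (\<lambda>z. (?f (fst z) * ?c (z \<bullet> bvec i)) *\<^sub>R bvec i) (at ?z)"
    by (rule frechet_derivative_cong_open[OF S])
      (use vf_coords_frame[OF qK _ _ i] in \<open>auto simp: inner_bvec_0\<close>)
  moreover have "frechet_derivative ?c (at ?w) r = r * A" for r
    using linear_scale[OF has_derivative_linear[OF dc], of r 1] by (simp add: A_def)
  ultimately have "frechet_derivative (vf_coords K q (frame i)) (at ?z) v =
      (?f (fst ?z) * A * (v \<bullet> bvec i)) *\<^sub>R bvec i -
      (fst v * pexp i * hubble (fst q)) *\<^sub>R frame i q" for v
    by (simp add: frame_def cw z0 algebra_simps)
  then show ?thesis using that by blast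
qed

lemma lie_bracket_frame:
  assumes q: "q \<in> box" and ij: "i < 4" "j < 4"
  shows "lie_bracket K (frame i) (frame j) q =
    (if j = 0 then pexp i * hubble (fst q) else 0) *\<^sub>R frame i q -
    (if i = 0 then pexp j * hubble (fst q) else 0) *\<^sub>R frame j q"
proof -
  obtain a where a: "\<And>v. frechet_derivative (vf_coords K q (frame i)) (at (chart K q q)) v =
    (a * (v \<bullet> bvec i)) *\<^sub>R bvec i - (fst v * pexp i * hubble (fst q)) *\<^sub>R frame i q"
    using vf_coords_frame_derivative[OF q ij(1)] by blast
  obtain b where b: "\<And>v. frechet_derivative (vf_coords K q (frame j)) (at (chart K q q)) v =
    (b * (v \<bullet> bvec j)) *\<^sub>R bvec j - (fst v * pexp j * hubble (fst q)) *\<^sub>R frame j q"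
    using vf_coords_frame_derivative[OF q ij(2)] by blast
  have f: "fst (frame k q) = (if k = 0 then 1 else 0)" if "k < 4" for k
    using that frame_0[OF q] by (auto simp: less_4_cases frame_def bvec_def)
  have s: "frame k q \<bullet> bvec l = 0" if "k < 4" "l < 4" "k \<noteq> l" for k l
    using bvec_inner that by (simp add: frame_def)
  show ?thesis
  proof (cases "i = j")
    case True
    then show ?thesis by (simp add: lie_bracket_def)
  next
    case False
    then show ?thesis
      by (simp add: lie_bracket_def a b f s ij)
  qed
qed

lemma metric_frame:
  assumes q: "q \<in> box" and ij: "i < 4" "j < 4"
  shows "gK q (frame i q) (frame j q) = (if i = j then if i = 0 then -1 else 1 else 0)"
proof -
  obtain s y1 y2 y3 where qy: "q = (s, y1, y2, y3)" by (cases q)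
  have y: "y1 \<in> chart_dom F1 x1" "y2 \<in> chart_dom F2 x2" "y3 \<in> chart_dom F3 x3" "s \<in> J"
    using q by (auto simp: qy box_def)
  have yF: "y1 \<in> points F1" "y2 \<in> points F2" "y3 \<in> points F3"
    using x y F1.chart_dom_subset F2.chart_dom_subset F3.chart_dom_subset by blast+
  note u = F1.unit_field_unit[OF x(1) y(1)] F2.unit_field_unit[OF x(2) y(2)]
    F3.unit_field_unit[OF x(3) y(3)]
  note lin = F1.linear_metric[OF yF(1)] F2.linear_metric[OF yF(2)] F3.linear_metric[OF yF(3)]
  have g0: "g1 y1 0 v = 0" "g1 y1 v 0 = 0" "g2 y2 0 v = 0" "g2 y2 v 0 = 0" "g3 y3 0 v = 0" "g3 y3 v 0 = 0" for v
    using lin[THEN linear_0] by auto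
  have gs: "g1 y1 (a * v) (b * w) = a * (b * g1 y1 v w)" "g2 y2 (a * v) (b * w) = a * (b * g2 y2 v w)"
    "g3 y3 (a * v) (b * w) = a * (b * g3 y3 v w)" for a b v w
    using lin[THEN linear_scale] by simp_all
  have ph: "\<phi> s > 0" using phi_pos[OF y(4)] .
  \<comment> \<open>The warping factor of the metric is cancelled by the two normalising factors of
    the frame.\<close>
  have pw: "\<phi> s powr (2 * c) * (\<phi> s powr (- c) * \<phi> s powr (- c)) = 1" for c
    using ph by (simp add: powr_add[symmetric])
  show ?thesis
    using ij unfolding less_4_cases
    by (elim disjE) (use ph in \<open>simp_all add: qy kasner_metric_def frame_def bvec_def fcoef_def pexp_def g0 gs u pw\<close>)
qed

lemma orthonormal_frame: "orthonormal_frame K gK box frame"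
  using smooth_frame metric_frame by (auto simp: orthonormal_frame_def)

end

end

section \<open>Ricci curvature of the quarter-symmetric connection\<close>

locale kasner_connection = kasner +
  fixes D and l1 l2 :: real
  assumes levi_civita: "levi_civita_connection K gK D"
begin

abbreviation "Q \<equiv> quarter_symmetric_connection gK D kasner_dt l1 l2"

text \<open>The coefficient of \<open>e i\<close> in the derivative of \<open>e 0\<close> along
  \<open>e i\<close>; \<open>bcoef i\<close> is the coefficient of \<open>e 0\<close> in that of
  \<open>e i\<close> along itself. Since P has square -1, the first added term contributes
  \<open>- l1\<close>; the second contributes \<open>- l2\<close> times the square of
  \<open>e i\<close>. For \<open>i = 0\<close> both coefficients act on \<open>e 0\<close>.\<close>

definition acoef :: "nat \<Rightarrow> real \<Rightarrow> real" where
  "acoef i t = pexp i * hubble t - l1"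

definition bcoef :: "nat \<Rightarrow> real \<Rightarrow> real" where
  "bcoef i t = pexp i * hubble t - l2 * (if i = 0 then -1 else 1)"

definition dhubble :: "real \<Rightarrow> real" where
  "dhubble t = frechet_derivative hubble (at t) 1"

lemma affine_Q: "affine_connection K Q"
  by (rule affine_quarter_symmetric_connection)
    (use levi_civita smooth_vf_on_kasner_dt in \<open>auto simp: levi_civita_connection_def\<close>)

sublocale Q: affine_mfd K Q
  by unfold_locales (rule affine_Q)

lemma hubble_has_derivative:
  assumes "t \<in> J"
  shows "(hubble has_real_derivative dhubble t) (at t)"
proof -
  have "(hubble has_derivative frechet_derivative hubble (at t)) (at t)"
    using smooth_on_imp_has_derivative[OF smooth_hubble assms] .
  moreover have "frechet_derivative hubble (at t) = (*) (dhubble t)"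
  proof
    show "frechet_derivative hubble (at t) v = dhubble t * v" for v
      using linear_scale[OF linear_frechet_derivative[OF smooth_on_imp_differentiable[OF smooth_hubble assms]], of v 1]
      by (simp add: dhubble_def)
  qed
  ultimately show ?thesis by (simp add: has_field_derivative_def)
qed

lemma smooth_coefs: "smooth_on J (acoef i)" "smooth_on J (bcoef i)"
  unfolding acoef_def[abs_def] bcoef_def[abs_def]
  by (intro smooth_on_diff smooth_on_mult smooth_on_const smooth_hubble; simp)+

lemma deriv_coefs:
  assumes "t \<in> J"
  shows "frechet_derivative (acoef i) (at t) 1 = pexp i * dhubble t"
    "frechet_derivative (bcoef i) (at t) 1 = pexp i * dhubble t"
proof -
  have "(acoef i has_real_derivative pexp i * dhubble t) (at t)"
    "(bcoef i has_real_derivative pexp i * dhubble t) (at t)"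
    unfolding acoef_def[abs_def] bcoef_def[abs_def]
    by (auto intro!: derivative_eq_intros hubble_has_derivative[OF assms])
  from this[unfolded has_field_derivative_def, THEN frechet_derivative_at]
  show "frechet_derivative (acoef i) (at t) 1 = pexp i * dhubble t"
    "frechet_derivative (bcoef i) (at t) 1 = pexp i * dhubble t"
    by (metis mult_1_right)+
qed

section \<open>Covariant derivatives and curvature in the adapted frame\<close>

context
  fixes x1 x2 x3
  assumes x: "x1 \<in> points F1" "x2 \<in> points F2" "x3 \<in> points F3"
begin

abbreviation "e \<equiv> frame x1 x2 x3"
abbreviation "V \<equiv> box x1 x2 x3"

lemma frame_eqI:
  assumes q: "q \<in> V" and eq: "\<And>k. k < 4 \<Longrightarrow> gK q v (e k q) = gK q w (e k q)"
  shows "v = w"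
proof -
  have "(\<Sum>k<DIM(real \<times> real \<times> real \<times> real). (gK q (e k q) (e k q) * gK q v (e k q)) *\<^sub>R e k q) =
      (\<Sum>k<DIM(real \<times> real \<times> real \<times> real). (gK q (e k q) (e k q) * gK q w (e k q)) *\<^sub>R e k q)"
    by (intro sum.cong) (auto simp: eq)
  then show ?thesis
    using frame_expansion[OF open_box[OF x] orthonormal_frame[OF x] q] by metis
qed

lemma metric_combination:
  assumes q: "q \<in> V" and "i < 4" "j < 4" "k < 4"
  shows "gK q (a *\<^sub>R e i q + b *\<^sub>R e j q) (e k q) =
    (if i = k then a * (if k = 0 then -1 else 1) else 0) + (if j = k then b * (if k = 0 then -1 else 1) else 0)"
  using linear_metric(1)[OF box_points[OF x q], THEN linear_add]
    linear_metric(1)[OF box_points[OF x q], THEN linear_scale] assms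
  by (simp add: metric_frame[OF x])

lemma levi_civita_frame:
  assumes q: "q \<in> V" and ij: "i < 4" "j < 4"
  shows "D q (e i q) (e j) = (if j = 0 then pexp i * hubble (fst q) else 0) *\<^sub>R e i q +
    (if i = j then pexp i * hubble (fst q) else 0) *\<^sub>R e 0 q"
proof (rule frame_eqI[OF q])
  fix k :: nat assume k: "k < 4"
  \<comment> \<open>The structure functions of the frame with the last index lowered, the input to
    Koszul's formula.\<close>
  define c where "c i j k = gK q (lie_bracket K (e i) (e j) q) (e k q)" for i j k
  have c: "c i j k = (if j = 0 \<and> i = k then pexp i * hubble (fst q) * (if k = 0 then -1 else 1) else 0) -
      (if i = 0 \<and> j = k then pexp j * hubble (fst q) * (if k = 0 then -1 else 1) else 0)"
    if "i < 4" "j < 4" "k < 4" for i j k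
  proof -
    have "c i j k = gK q ((if j = 0 then pexp i * hubble (fst q) else 0) *\<^sub>R e i q +
        (- (if i = 0 then pexp j * hubble (fst q) else 0)) *\<^sub>R e j q) (e k q)"
      using lie_bracket_frame[OF x q that(1,2)] by (simp add: c_def)
    also have "\<dots> = (if j = 0 \<and> i = k then pexp i * hubble (fst q) * (if k = 0 then -1 else 1) else 0) -
      (if i = 0 \<and> j = k then pexp j * hubble (fst q) * (if k = 0 then -1 else 1) else 0)"
      unfolding metric_combination[OF q that] by auto
    finally show ?thesis .
  qed
  have "2 * gK q (D q (e i q) (e j)) (e k q) = c i j k + c k i j - c j k i"
    unfolding c_def
    by (rule levi_civita_orthonormal_frame[OF levi_civita open_box[OF x] q, where s = "\<lambda>i. if i = 0 then -1 else 1"])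
      (use smooth_frame[OF x] metric_frame[OF x] ij k in auto)
  \<comment> \<open>The exponent 0 of the time index makes the uniform formula give zero for every
    derivative along \<open>e 0\<close>.\<close>
  moreover have "pexp 0 = 0" by (simp add: pexp_def)
  ultimately have "gK q (D q (e i q) (e j)) (e k q) = pexp i * hubble (fst q) *
      ((if j = 0 \<and> i = k then if k = 0 then -1 else 1 else 0) + (if i = j \<and> k = 0 then -1 else 0))"
    using c ij k by (auto split: if_splits)
  then show "gK q (D q (e i q) (e j)) (e k q) =
      gK q ((if j = 0 then pexp i * hubble (fst q) else 0) *\<^sub>R e i q +
        (if i = j then pexp i * hubble (fst q) else 0) *\<^sub>R e 0 q) (e k q)"
    using ij k by (simp add: metric_combination[OF q])
qed

lemma Q_frame:
  assumes q: "q \<in> V" and ij: "i < 4" "j < 4"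
  shows "Q q (e i q) (e j) = (if j = 0 then acoef i (fst q) else 0) *\<^sub>R e i q +
    (if i = j then bcoef i (fst q) else 0) *\<^sub>R e 0 q"
proof -
  have P: "kasner_dt q = e 0 q" using frame_0[OF x q] by (simp add: kasner_dt_def)
  show ?thesis
    using ij by (simp add: quarter_symmetric_connection_def P metric_frame[OF x q] levi_civita_frame[OF q]
        acoef_def bcoef_def scaleR_diff_left scaleR_minus_left pexp_def)
qed

text \<open>By \<open>Q_frame\<close> the inner derivative combines \<open>e j\<close> and
  \<open>e 0\<close> with coefficients that depend on time alone, so the Leibniz rule differentiates
  them only for \<open>i = 0\<close>. The derivatives of frame fields left on the right are
  evaluated later by \<open>metric_Q_frame\<close>.\<close>

lemma Q_Q_frame:
  assumes q: "q \<in> V" and ij: "i < 4" "j < 4" "k < 4"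
  shows "Q q (e i q) (\<lambda>q. Q q (e j q) (e k)) =
    (if i = 0 \<and> k = 0 then pexp j * dhubble (fst q) else 0) *\<^sub>R e j q +
    (if k = 0 then acoef j (fst q) else 0) *\<^sub>R Q q (e i q) (e j) +
    (if i = 0 \<and> j = k then pexp j * dhubble (fst q) else 0) *\<^sub>R e 0 q +
    (if j = k then bcoef j (fst q) else 0) *\<^sub>R Q q (e i q) (e 0)"
proof -
  note V = open_box[OF x] and se = smooth_frame[OF x]
  let ?a = "\<lambda>q. if k = 0 then acoef j (fst q) else 0" and ?b = "\<lambda>q. if j = k then bcoef j (fst q) else 0"
  have sa: "smooth_fun_on K V ?a"
    using smooth_fun_on_time[OF smooth_coefs(1) V] smooth_fun_on_const by (cases "k = 0") simp_all
  have sb: "smooth_fun_on K V ?b"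
    using smooth_fun_on_time[OF smooth_coefs(2) V] smooth_fun_on_const by (cases "j = k") simp_all
  have f: "fst (e i q) = (if i = 0 then 1 else 0)"
    using ij(1) frame_0[OF x q] by (auto simp: less_4_cases frame_def[OF x] bvec_def)
  note d = deriv_along_time[OF smooth_coefs(1) box_points[OF x q]]
    deriv_along_time[OF smooth_coefs(2) box_points[OF x q]] deriv_coefs[OF box_time[OF x q]]
  have "Q q (e i q) (\<lambda>q. Q q (e j q) (e k)) = Q q (e i q) (\<lambda>q. ?a q *\<^sub>R e j q + ?b q *\<^sub>R e 0 q)"
    by (rule Q.conn_cong[OF V q Q.conn_smooth[OF V se se]]) (use Q_frame ij in auto)
  also have "\<dots> = Q q (e i q) (\<lambda>q. ?a q *\<^sub>R e j q) + Q q (e i q) (\<lambda>q. ?b q *\<^sub>R e 0 q)"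
    by (intro Q.conn_add[OF V q] smooth_vf_on_scaleR V sa sb se) (use ij in auto)
  also have "\<dots> = (deriv_along K q (e i q) ?a *\<^sub>R e j q + ?a q *\<^sub>R Q q (e i q) (e j)) +
      (deriv_along K q (e i q) ?b *\<^sub>R e 0 q + ?b q *\<^sub>R Q q (e i q) (e 0))"
    using Q.conn_scaleR[OF V q sa se[OF ij(2)], of "e i q"] Q.conn_scaleR[OF V q sb se[of 0], of "e i q"]
    by simp
  also have "deriv_along K q (e i q) ?a = (if i = 0 \<and> k = 0 then pexp j * dhubble (fst q) else 0)"
    using frame_0[OF x q] by (cases "k = 0") (simp_all add: d f deriv_along_const)
  also have "deriv_along K q (e i q) ?b = (if i = 0 \<and> j = k then pexp j * dhubble (fst q) else 0)"
    using frame_0[OF x q] by (cases "j = k") (simp_all add: d f deriv_along_const)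
  finally show ?thesis by simp
qed

lemma metric_Q_frame:
  assumes q: "q \<in> V" and ij: "i < 4" "j < 4" "k < 4"
  shows "gK q (Q q (e i q) (e j)) (e k q) =
    (if i = k \<and> j = 0 then acoef i (fst q) * (if k = 0 then -1 else 1) else 0) +
    (if k = 0 \<and> i = j then - bcoef i (fst q) else 0)"
  unfolding Q_frame[OF q ij(1,2)] using ij metric_combination[OF q ij(1) _ ij(3), of 0] by auto

text \<open>\<open>s i j k m\<close> is the component along \<open>e m\<close> of the iterated
  derivative of \<open>e k\<close>, along \<open>e j\<close> and then \<open>e i\<close>. The two
  terms after \<open>s\<close> come from the bracket of \<open>e i\<close> and \<open>e j\<close>,
  which is nonzero only if one index is the time index.\<close>

lemma metric_curvature_frame:
  assumes q: "q \<in> V" and ij: "i < 4" "j < 4" "k < 4" "m < 4"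
  defines "s \<equiv> \<lambda>i j k m.
      (if i = 0 \<and> k = 0 then pexp j * dhubble (fst q) * gK q (e j q) (e m q) else 0) +
      (if k = 0 then acoef j (fst q) * gK q (Q q (e i q) (e j)) (e m q) else 0) +
      (if i = 0 \<and> j = k then pexp j * dhubble (fst q) * gK q (e 0 q) (e m q) else 0) +
      (if j = k then bcoef j (fst q) * gK q (Q q (e i q) (e 0)) (e m q) else 0)"
  shows "gK q (curvature K Q (e i) (e j) (e k) q) (e m q) = s i j k m - s j i k m -
      (if j = 0 then pexp i * hubble (fst q) * gK q (Q q (e i q) (e k)) (e m q) else 0) +
      (if i = 0 then pexp j * hubble (fst q) * gK q (Q q (e j q) (e k)) (e m q) else 0)"
proof -
  note lin = linear_metric(1)[OF box_points[OF x q]]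
  note Qlin = Q.conn_linear[OF open_box[OF x] q smooth_frame[OF x ij(3)]]
  have s: "gK q (Q q (e i q) (\<lambda>q. Q q (e j q) (e k))) (e m q) = s i j k m" if "i < 4" "j < 4" for i j
    unfolding Q_Q_frame[OF q that ij(3)] s_def
    by (simp add: linear_add[OF lin] linear_scale[OF lin] linear_0[OF lin])
  have l: "gK q (Q q (lie_bracket K (e i) (e j) q) (e k)) (e m q) =
      (if j = 0 then pexp i * hubble (fst q) * gK q (Q q (e i q) (e k)) (e m q) else 0) -
      (if i = 0 then pexp j * hubble (fst q) * gK q (Q q (e j q) (e k)) (e m q) else 0)"
    unfolding lie_bracket_frame[OF x q ij(1,2)] linear_diff[OF Qlin] linear_scale[OF Qlin]
      linear_diff[OF lin] linear_scale[OF lin] by simp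
  show ?thesis
    unfolding curvature_def linear_diff[OF lin] s[OF ij(1,2)] s[OF ij(2,1)] l by simp
qed

text \<open>Every ingredient is by now a scalar function of time, so the sixteen index pairs reduce
  to polynomial identities. The Ricci tensor of such a connection need not be symmetric, but in this
  frame it is diagonal.\<close>

lemma ricci_frame:
  assumes q: "q \<in> V" and ij: "i < 4" "l < 4"
  defines "h \<equiv> hubble (fst q)" and "h' \<equiv> dhubble (fst q)"
  shows "ricci K gK Q e (e i) (e l) q = (if i = l then
      if i = 0 then (p1 + p2 + p3) * h' + (p1\<^sup>2 + p2\<^sup>2 + p3\<^sup>2) * h\<^sup>2 - l2 * (p1 + p2 + p3) * h + 3 * (l1 * l2 - l1\<^sup>2)
      else - (pexp i * h' + (pexp i * h - l2) * ((p1 + p2 + p3) * h + l2 - 3 * l1))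
    else 0)"
proof -
  have four: "{..<DIM(real \<times> real \<times> real \<times> real)} = {0, 1, 2, 3}" by auto
  have "ricci K gK Q e (e i) (e l) q = (\<Sum>k\<in>{0,1,2,3}. gK q (e k q) (e k q) * gK q (curvature K Q (e i) (e k) (e l) q) (e k q))"
    by (simp only: ricci_def four)
  also have "\<dots> = (if i = l then
      if i = 0 then (p1 + p2 + p3) * h' + (p1\<^sup>2 + p2\<^sup>2 + p3\<^sup>2) * h\<^sup>2 - l2 * (p1 + p2 + p3) * h + 3 * (l1 * l2 - l1\<^sup>2)
      else - (pexp i * h' + (pexp i * h - l2) * ((p1 + p2 + p3) * h + l2 - 3 * l1))
    else 0)"
    using ij unfolding less_4_cases
    by (elim disjE; simp add: metric_curvature_frame[OF q] metric_Q_frame[OF q] metric_frame[OF x q]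
        acoef_def bcoef_def pexp_def h_def[symmetric] h'_def[symmetric])
      (simp_all add: power2_eq_square algebra_simps)
  finally show ?thesis .
qed

end

end

section \<open>The Einstein condition as a system of differential equations\<close>

context kasner_connection
begin

text \<open>The frame components depend on time only, so a single triple of fibre points yields the
  equations for all \<open>t\<close>. The value \<open>- \<alpha>\<close> has two origins: in the
  time equation it comes from g(e_0,e_0) = -1, in the others from the minus sign in front of the
  spatial components of the Ricci tensor.\<close>

lemma einstein_iff:
  "einstein K gK Q \<alpha> \<longleftrightarrow> (\<forall>t\<in>J.
     (p1 + p2 + p3) * dhubble t + (p1\<^sup>2 + p2\<^sup>2 + p3\<^sup>2) * (hubble t)\<^sup>2 - l2 * (p1 + p2 + p3) * hubble t
       + 3 * (l1 * l2 - l1\<^sup>2) = - \<alpha> \<and>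
     (\<forall>p\<in>{p1, p2, p3}. p * dhubble t + (p * hubble t - l2) * ((p1 + p2 + p3) * hubble t + l2 - 3 * l1) = - \<alpha>))"
  (is "_ \<longleftrightarrow> (\<forall>t\<in>J. ?A t \<and> (\<forall>p\<in>{p1, p2, p3}. ?B p t))")
proof
  assume E: "einstein K gK Q \<alpha>"
  obtain x1 x2 x3 where x: "x1 \<in> points F1" "x2 \<in> points F2" "x3 \<in> points F3"
    using F1.smooth_manifold F2.smooth_manifold F3.smooth_manifold by (auto simp: smooth_manifold_def)
  show "\<forall>t\<in>J. ?A t \<and> (\<forall>p\<in>{p1, p2, p3}. ?B p t)"
  proof
    fix t assume t: "t \<in> J"
    let ?q = "(t, x1, x2, x3)"
    have q: "?q \<in> box x1 x2 x3"
      using t x F1.in_chart_dom F2.in_chart_dom F3.in_chart_dom by (simp add: box_def[OF x])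
    have "ricci K gK Q (frame x1 x2 x3) (frame x1 x2 x3 i) (frame x1 x2 x3 i) ?q = \<alpha> * (if i = 0 then -1 else 1)"
      if "i < 4" for i
      using einsteinD_frame[OF E open_box[OF x] orthonormal_frame[OF x] q, of i i] that
      by (simp add: metric_frame[OF x q])
    from this[of 0] this[of 1] this[of 2] this[of 3]
    show "?A t \<and> (\<forall>p\<in>{p1, p2, p3}. ?B p t)"
      by (simp add: ricci_frame[OF x q] pexp_def)
  qed
next
  assume eqs: "\<forall>t\<in>J. ?A t \<and> (\<forall>p\<in>{p1, p2, p3}. ?B p t)"
  show "einstein K gK Q \<alpha>"
  proof (rule einsteinI_frames[OF affine_Q])
    fix q assume "q \<in> points K"
    then obtain t x1 x2 x3 where qx: "q = (t, x1, x2, x3)" and t: "t \<in> J"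
      and x: "x1 \<in> points F1" "x2 \<in> points F2" "x3 \<in> points F3"
      by (auto simp: points_K)
    have tq: "fst q = t" by (simp add: qx)
    have q: "q \<in> box x1 x2 x3"
      using t x F1.in_chart_dom F2.in_chart_dom F3.in_chart_dom by (simp add: qx box_def[OF x])
    have "ricci K gK Q (frame x1 x2 x3) (frame x1 x2 x3 i) (frame x1 x2 x3 l) q =
        \<alpha> * gK q (frame x1 x2 x3 i q) (frame x1 x2 x3 l q)" if il: "i < 4" "l < 4" for i l
    proof -
      have "pexp i \<in> {p1, p2, p3}" if "i \<noteq> 0"
        using that il(1) by (auto simp: pexp_def less_4_cases)
      then have "?A t" "i \<noteq> 0 \<Longrightarrow> ?B (pexp i) t"
        using eqs t by blast+
      then show ?thesis
        by (auto simp: ricci_frame[OF x q il] metric_frame[OF x q il] tq)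
    qed
    then show "\<exists>V e. open_in_manifold K V \<and> q \<in> V \<and> orthonormal_frame K gK V e \<and>
      (\<forall>i<DIM(real \<times> real \<times> real \<times> real). \<forall>l<DIM(real \<times> real \<times> real \<times> real).
        ricci K gK Q e (e i) (e l) q = \<alpha> * gK q (e i q) (e l q))"
      using open_box[OF x] q orthonormal_frame[OF x]
      by (intro exI[of _ "box x1 x2 x3"] exI[of _ "frame x1 x2 x3"]) simp
  qed
qed

end

section \<open>Solving the Einstein equations\<close>

lemma convex_einterval: "convex (einterval a b)"
  unfolding is_interval_convex_1[symmetric] is_interval_1 einterval_def
  by (simp, meson ereal_less_eq(3) order_le_less_trans order_less_le_trans)

text \<open>The product \<open>f t * exp (- k * t)\<close> has derivative zero on a convex set,
  hence is constant.\<close>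

lemma exp_solution_on_einterval:
  fixes f :: "real \<Rightarrow> real"
  assumes "\<And>t. t \<in> einterval a b \<Longrightarrow> (f has_real_derivative k * f t) (at t)"
  shows "\<exists>c. \<forall>t\<in>einterval a b. f t = c * exp (k * t)"
proof -
  note convex_einterval[of a b]
  moreover have "((\<lambda>t. f t * exp (- k * t)) has_real_derivative 0) (at t within einterval a b)"
    if "t \<in> einterval a b" for t
  proof -
    have "((\<lambda>t. f t * exp (- k * t)) has_real_derivative 0) (at t)"
      by (auto intro!: derivative_eq_intros assms[OF that])
    then show ?thesis by (rule has_field_derivative_at_within)
  qed
  ultimately obtain c where c: "\<And>t. t \<in> einterval a b \<Longrightarrow> f t * exp (- k * t) = c"
    using has_field_derivative_zero_constant[of "einterval a b" "\<lambda>t. f t * exp (- k * t)"] by blast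
  have "f t = c * exp (k * t)" if "t \<in> einterval a b" for t
  proof -
    have "c * exp (k * t) = f t * (exp (- k * t) * exp (k * t))" by (simp add: c[OF that, symmetric])
    then show ?thesis by (simp add: exp_add[symmetric])
  qed
  then show ?thesis by blast
qed

text \<open>The geometry is gone: what remains is \<phi>, its logarithmic derivative
  \<open>h\<close> and the derivative of \<open>h\<close>. The two alternatives are conditions (2)
  and (3), without their clauses on the fibres.\<close>

lemma einstein_equations_iff:
  fixes \<phi> h h' :: "real \<Rightarrow> real"
  assumes t12: "t1 < t2" and pos: "\<And>t. t \<in> einterval t1 t2 \<Longrightarrow> \<phi> t > 0"
    and d\<phi>: "\<And>t. t \<in> einterval t1 t2 \<Longrightarrow> (\<phi> has_real_derivative h t * \<phi> t) (at t)"
    and dh: "\<And>t. t \<in> einterval t1 t2 \<Longrightarrow> (h has_real_derivative h' t) (at t)"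
    and p: "p1 \<noteq> p2" and l: "l1 \<noteq> 0" "l2 \<noteq> (0::real)"
    and \<eta>: "\<eta> = p1\<^sup>2 + p2\<^sup>2 + p3\<^sup>2"
  shows "(\<forall>t\<in>einterval t1 t2.
      \<zeta> * h' t + \<eta> * (h t)\<^sup>2 - l2 * \<zeta> * h t + 3 * (l1 * l2 - l1\<^sup>2) = - \<alpha> \<and>
      (\<forall>p\<in>{p1, p2, p3}. p * h' t + (p * h t - l2) * (\<zeta> * h t + l2 - 3 * l1) = - \<alpha>)) \<longleftrightarrow>
    (l2\<^sup>2 = 3 * l1\<^sup>2 \<and> \<alpha> = 3 * l1\<^sup>2 - 3 * l1 * l2 \<and> (\<exists>c. \<forall>t\<in>einterval t1 t2. \<phi> t = c)) \<or>
    (l2 \<noteq> 3 * l1 \<and> \<alpha> = 0 \<and> \<zeta> \<noteq> 0 \<and> \<eta> / \<zeta>\<^sup>2 = (3 * l1\<^sup>2 - l2\<^sup>2) / (3 * l1 - l2)\<^sup>2 \<and>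
      (\<exists>c. \<forall>t\<in>einterval t1 t2. \<phi> t = c * exp ((3 * l1 - l2) / \<zeta> * t)))"
    (is "?E \<longleftrightarrow> ?R")
proof
  let ?J = "einterval t1 t2"
  have op: "open ?J" by simp
  obtain t0 where t0: "t0 \<in> ?J" using einterval_nonempty[OF t12] by blast
  have "p1 \<noteq> 0 \<or> p2 \<noteq> 0" using p by auto
  then have "p1\<^sup>2 + p2\<^sup>2 > 0" by (simp add: sum_power2_gt_zero_iff)
  then have \<eta>pos: "\<eta> > 0" using zero_le_power2[of p3] unfolding \<eta> by linarith
  assume E: ?E
  have A: "\<zeta> * h' t + \<eta> * (h t)\<^sup>2 - l2 * \<zeta> * h t + 3 * (l1 * l2 - l1\<^sup>2) = - \<alpha>" if "t \<in> ?J" for t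
    using E that by blast
  have h': "h' t = - h t * (\<zeta> * h t + l2 - 3 * l1)" if "t \<in> ?J" for t
  proof -
    have "p1 * h' t + (p1 * h t - l2) * (\<zeta> * h t + l2 - 3 * l1) = - \<alpha>"
      "p2 * h' t + (p2 * h t - l2) * (\<zeta> * h t + l2 - 3 * l1) = - \<alpha>"
      using E that by auto
    \<comment> \<open>Subtracting the two equations removes \<alpha> and all terms without a factor
      \<open>p\<close>.\<close>
    then have "(p1 - p2) * (h' t + h t * (\<zeta> * h t + l2 - 3 * l1)) = 0"
      by (simp add: algebra_simps)
    then show ?thesis using p by simp
  qed
  have \<alpha>: "\<alpha> = l2 * (\<zeta> * h t + l2 - 3 * l1)" if "t \<in> ?J" for t
  proof -
    have "p1 * h' t + (p1 * h t - l2) * (\<zeta> * h t + l2 - 3 * l1) = - \<alpha>"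
      using E that by auto
    then show ?thesis unfolding h'[OF that] by (simp add: algebra_simps)
  qed
  \<comment> \<open>For nonzero \<zeta> the formula for \<alpha> can be solved for \<open>h\<close>.
    For \<zeta> = 0 it gives \<alpha> = l2 (l2 - 3 l1), and the time equation becomes \<eta> h^2 = 3
    l1^2 - l2^2; so h^2 is constant and h h' = 0, and at a zero of \<open>h\<close> the formula
    \<open>h'\<close> gives h' = 0 as well.\<close>
  have h'0: "h' t = 0" if t: "t \<in> ?J" for t
  proof (cases "\<zeta> = 0")
    case False
    have "h s = (\<alpha> / l2 + 3 * l1 - l2) / \<zeta>" if "s \<in> ?J" for s
      using \<alpha>[OF that] l False by (simp add: field_simps)
    then have "(h has_real_derivative 0) (at t)"
      using has_field_derivative_transform_within_open[OF DERIV_const op t, of "(\<alpha> / l2 + 3 * l1 - l2) / \<zeta>" h] by simp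
    then show ?thesis using DERIV_unique dh[OF t] by blast
  next
    case True
    have "h s * h s = (3 * l1\<^sup>2 - l2\<^sup>2) / \<eta>" if "s \<in> ?J" for s
      using A[OF that] \<alpha>[OF that] \<eta>pos True by (simp add: field_simps power2_eq_square)
    then have "((\<lambda>s. h s * h s) has_real_derivative 0) (at t)"
      using has_field_derivative_transform_within_open[OF DERIV_const op t, of "(3 * l1\<^sup>2 - l2\<^sup>2) / \<eta>" "\<lambda>s. h s * h s"] by simp
    from DERIV_unique[OF this DERIV_mult[OF dh[OF t] dh[OF t]]]
    have "h' t * h t = 0" by auto
    then show ?thesis using h'[OF t] by (cases "h t = 0") simp_all
  qed
  let ?h = "h t0"
  have "(h has_real_derivative 0) (at t within ?J)" if "t \<in> ?J" for t
    using dh[OF that] h'0[OF that] has_field_derivative_at_within by metis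
  moreover note convex_einterval[of t1 t2]
  ultimately have h: "h t = ?h" if "t \<in> ?J" for t
    using has_field_derivative_zero_constant[of ?J h] that t0 by metis
  have ex: "\<exists>c. \<forall>t\<in>?J. \<phi> t = c * exp (?h * t)"
    by (rule exp_solution_on_einterval) (use d\<phi> h in metis)
  have A0: "\<eta> * ?h\<^sup>2 - l2 * \<zeta> * ?h + 3 * (l1 * l2 - l1\<^sup>2) = - \<alpha>"
    using A[OF t0] h'0[OF t0] by simp
  show ?R
  proof (cases "?h = 0")
    case True
    then have "l2\<^sup>2 = 3 * l1\<^sup>2" "\<alpha> = 3 * l1\<^sup>2 - 3 * l1 * l2"
      using A0 \<alpha>[OF t0] by (simp_all add: algebra_simps power2_eq_square)
    then show ?thesis using ex True by simp
  next
    case False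
    then have z: "\<zeta> * ?h = 3 * l1 - l2"
      using h'[OF t0] h'0[OF t0] by simp
    have a0: "\<alpha> = 0" using \<alpha>[OF t0] z by simp
    have *: "\<eta> * ?h\<^sup>2 = 3 * l1\<^sup>2 - l2\<^sup>2"
    proof -
      have "l2 * \<zeta> * ?h = l2 * (3 * l1 - l2)" using z by (simp add: mult.assoc)
      then show ?thesis using A0 a0 by (simp add: algebra_simps power2_eq_square)
    qed
    \<comment> \<open>Equality would turn 3 l1^2 - l2^2 into -6 l1^2, which cannot equal the
      positive number \<eta> h^2. In particular \<zeta> h is nonzero, and so is \<zeta>.\<close>
    have ne: "l2 \<noteq> 3 * l1"
    proof
      assume "l2 = 3 * l1"
      then have "\<eta> * ?h\<^sup>2 = - 6 * l1\<^sup>2" using * by (simp add: power2_eq_square)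
      moreover have "\<eta> * ?h\<^sup>2 > 0" using \<eta>pos False by simp
      ultimately show False using zero_le_power2[of l1] by linarith
    qed
    then have z0: "\<zeta> \<noteq> 0" using z by auto
    have hz: "?h = (3 * l1 - l2) / \<zeta>" using z z0 by (simp add: field_simps)
    have "\<eta> / \<zeta>\<^sup>2 = (3 * l1\<^sup>2 - l2\<^sup>2) / (3 * l1 - l2)\<^sup>2"
      using * z0 ne unfolding hz by (simp add: field_simps)
    then show ?thesis using ex ne a0 z0 unfolding hz by blast
  qed
next
  let ?J = "einterval t1 t2"
  have op: "open ?J" by simp
  \<comment> \<open>For an exponential the logarithmic derivative is its rate: comparing the two
    derivatives of \<phi> and cancelling \<phi> > 0 gives h = k.\<close>
  have const: "h t = k" "h' t = 0" if c: "\<And>t. t \<in> ?J \<Longrightarrow> \<phi> t = c * exp (k * t)" and t: "t \<in> ?J" for c k t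
  proof -
    have hk: "h s = k" if s: "s \<in> ?J" for s
    proof -
      have "((\<lambda>s. c * exp (k * s)) has_real_derivative k * (c * exp (k * s))) (at s)"
        by (auto intro!: derivative_eq_intros)
      then have "(\<phi> has_real_derivative k * (c * exp (k * s))) (at s)"
        by (rule has_field_derivative_transform_within_open[OF _ op s]) (use c in simp)
      then have "k * \<phi> s = h s * \<phi> s"
        using DERIV_unique[OF _ d\<phi>[OF s]] c[OF s] by simp
      then show ?thesis using pos[OF s] by simp
    qed
    have "(h has_real_derivative 0) (at t)"
      by (rule has_field_derivative_transform_within_open[OF DERIV_const op t]) (use hk in simp)
    then show "h t = k" "h' t = 0" using hk[OF t] DERIV_unique dh[OF t] by blast+
  qed
  assume ?R
  then show ?E
  proof (elim disjE conjE exE)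
    fix c assume l2: "l2\<^sup>2 = 3 * l1\<^sup>2" and \<alpha>: "\<alpha> = 3 * l1\<^sup>2 - 3 * l1 * l2" and "\<forall>t\<in>?J. \<phi> t = c"
    \<comment> \<open>A constant is the exponential with rate \<open>k = 0\<close>.\<close>
    then have "h t = 0" "h' t = 0" if "t \<in> ?J" for t
      using const[of c 0, OF _ that] by simp_all
    then show ?E
      using l2 by (simp add: \<alpha> algebra_simps power2_eq_square)
  next
    fix c assume ne: "l2 \<noteq> 3 * l1" and z: "\<zeta> \<noteq> 0" and \<alpha>: "\<alpha> = 0"
      and r: "\<eta> / \<zeta>\<^sup>2 = (3 * l1\<^sup>2 - l2\<^sup>2) / (3 * l1 - l2)\<^sup>2"
      and c: "\<forall>t\<in>?J. \<phi> t = c * exp ((3 * l1 - l2) / \<zeta> * t)"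
    let ?k = "(3 * l1 - l2) / \<zeta>"
    have hk: "h t = ?k" "h' t = 0" if "t \<in> ?J" for t
      using const[of c ?k, OF _ that] c by simp_all
    have "\<eta> * ?k\<^sup>2 = (\<eta> / \<zeta>\<^sup>2) * (3 * l1 - l2)\<^sup>2"
      by (simp add: power_divide)
    also have "\<dots> = 3 * l1\<^sup>2 - l2\<^sup>2" unfolding r using ne by simp
    finally have k2: "\<eta> * ?k\<^sup>2 = 3 * l1\<^sup>2 - l2\<^sup>2" .
    have zk: "\<zeta> * ?k = 3 * l1 - l2" using z by simp
    have zk': "l2 * \<zeta> * ?k = l2 * (3 * l1 - l2)" using z by simp
    show ?E
      unfolding \<alpha> using hk k2 zk zk' by (simp add: algebra_simps power2_eq_square)
  qed
qed

theorem theorem4p20: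
  fixes t1 t2 :: ereal
    and \<phi> :: "real \<Rightarrow> real"
    and p1 p2 p3 \<zeta> \<eta> l1 l2 \<alpha> \<alpha>1 \<alpha>2 \<alpha>3 :: real
    and F1 :: "('a::{t2_space, second_countable_topology}, real) manifold"
    and F2 :: "('b::{t2_space, second_countable_topology}, real) manifold"
    and F3 :: "('c::{t2_space, second_countable_topology}, real) manifold"
    and g1 :: "('a, real) metric" and g2 :: "('b, real) metric" and g3 :: "('c, real) metric"
    and D1 :: "('a, real) connection" and D2 :: "('b, real) connection"
    and D3 :: "('c, real) connection"
    and M :: "(real \<times> 'a \<times> 'b \<times> 'c, real \<times> real \<times> real \<times> real) manifold"
    and g :: "(real \<times> 'a \<times> 'b \<times> 'c, real \<times> real \<times> real \<times> real) metric"
    and D :: "(real \<times> 'a \<times> 'b \<times> 'c, real \<times> real \<times> real \<times> real) connection"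
  assumes "t1 < t2"
    and "smooth_on (einterval t1 t2) \<phi>" and "\<forall>t\<in>einterval t1 t2. \<phi> t > 0"
    and "smooth_manifold F1" and "smooth_manifold F2" and "smooth_manifold F3"
    and "riemannian_metric F1 g1" and "riemannian_metric F2 g2" and "riemannian_metric F3 g3"
    and "p1 \<noteq> p2" and "p1 \<noteq> p3" and "p2 \<noteq> p3"
    and "\<zeta> = p1 + p2 + p3" and "\<eta> = p1\<^sup>2 + p2\<^sup>2 + p3\<^sup>2"
    and "l1 \<noteq> 0" and "l2 \<noteq> 0"
    and "M = kasner_manifold t1 t2 F1 F2 F3"
    and "g = kasner_metric \<phi> p1 p2 p3 g1 g2 g3"
    and "levi_civita_connection M g D"
    and "levi_civita_connection F1 g1 D1" and "einstein F1 g1 D1 \<alpha>1"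
    and "levi_civita_connection F2 g2 D2" and "einstein F2 g2 D2 \<alpha>2"
    and "levi_civita_connection F3 g3 D3" and "einstein F3 g3 D3 \<alpha>3"
  shows "einstein M g (quarter_symmetric_connection g D kasner_dt l1 l2) \<alpha> \<longleftrightarrow>
      (l2\<^sup>2 = 3 * l1\<^sup>2 \<and>
       \<alpha> = 3 * l1\<^sup>2 - 3 * l1 * l2 \<and> 3 * l1\<^sup>2 - 3 * l1 * l2 = l2\<^sup>2 - 3 * l1 * l2 \<and>
       \<alpha>1 = 0 \<and> \<alpha>2 = 0 \<and> \<alpha>3 = 0 \<and> \<zeta> = 0 \<and> \<eta> = 0)
    \<or> (l2\<^sup>2 = 3 * l1\<^sup>2 \<and>
       \<alpha> = 3 * l1\<^sup>2 - 3 * l1 * l2 \<and> 3 * l1\<^sup>2 - 3 * l1 * l2 = l2\<^sup>2 - 3 * l1 * l2 \<and>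
       \<alpha>1 = 0 \<and> \<alpha>2 = 0 \<and> \<alpha>3 = 0 \<and> \<eta> \<noteq> 0 \<and>
       (\<exists>c. \<forall>t\<in>einterval t1 t2. \<phi> t = c))
    \<or> (l2 \<noteq> 3 * l1 \<and> \<alpha> = 0 \<and>
       \<alpha>1 = 0 \<and> \<alpha>2 = 0 \<and> \<alpha>3 = 0 \<and> \<zeta> \<noteq> 0 \<and>
       \<eta> / \<zeta>\<^sup>2 = (3 * l1\<^sup>2 - l2\<^sup>2) / (3 * l1 - l2)\<^sup>2 \<and>
       (\<exists>c. \<forall>t\<in>einterval t1 t2. \<phi> t = c * exp ((3 * l1 - l2) / \<zeta> * t)))"
proof -
  interpret kasner F1 F2 F3 g1 g2 g3 t1 t2 \<phi> p1 p2 p3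
    using assms by unfold_locales auto
  interpret kasner_connection F1 F2 F3 g1 g2 g3 t1 t2 \<phi> p1 p2 p3 D l1 l2
    using assms by unfold_locales simp
  have "\<alpha>1 = 0" "\<alpha>2 = 0" "\<alpha>3 = 0"
    using F1.einstein_constant_zero[of D1 \<alpha>1] F2.einstein_constant_zero[of D2 \<alpha>2]
      F3.einstein_constant_zero[of D3 \<alpha>3] assms by (auto simp: levi_civita_connection_def)
  \<comment> \<open>This excludes condition (1) and supplies the corresponding clause of condition
    (2).\<close>
  moreover have "\<eta> \<noteq> 0"
  proof -
    have "p1 \<noteq> 0 \<or> p2 \<noteq> 0" using assms by auto
    then have "p1\<^sup>2 + p2\<^sup>2 > 0" by (simp add: sum_power2_gt_zero_iff)
    then show ?thesis using zero_le_power2[of p3] assms by linarith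
  qed
  moreover have "l2\<^sup>2 = 3 * l1\<^sup>2 \<Longrightarrow> 3 * l1\<^sup>2 - 3 * l1 * l2 = l2\<^sup>2 - 3 * l1 * l2"
    by simp
  moreover note einstein_iff[of \<alpha>] einstein_equations_iff[where \<alpha> = \<alpha> and \<zeta> = \<zeta>, OF t12 phi_pos
      phi_has_derivative hubble_has_derivative \<open>p1 \<noteq> p2\<close> \<open>l1 \<noteq> 0\<close> \<open>l2 \<noteq> 0\<close> \<open>\<eta> = _\<close>]
  ultimately show ?thesis
    unfolding \<open>M = _\<close> \<open>g = _\<close> \<open>\<zeta> = _\<close>[symmetric] \<open>\<eta> = _\<close>[symmetric] by blast
qed

end
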